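(* Let $F$ be a field of odd characteristic $p$ and let $G$ be a group with a nontrivial orientation $\sigma:G\to\{\pm1\}$ such that the group algebra $FG$ is Lie nilpotent. Let $(FG)^+$ be the set of symmetric elements and $\mathcal{U}^+(FG)$ the set of symmetric units of $FG$ under the oriented classical involution determined by $\sigma$. Then $\mathrm{t}((FG)^+)=|G'|+1$ if and only if the commutator subgroup $G'$ is cyclic. Moreover, if in addition $G$ is a torsion group, then $\mathrm{cl}(\mathcal{U}^+(FG))=|G'|$ if and only if $G'$ is cyclic.
   Context: An orientation of a group $G$ is a homomorphism $\sigma:G\to\{\pm1\}$. The oriented classical involution of $FG$ determined by $\sigma$ is $\left(\sum_{g\in G}\alpha_g g\right)^*=\sum_{g\in G}\alpha_g\sigma(g)g^{-1}$. Put $(FG)^+=\{\alpha\in FG:\alpha^*=\alpha\}$ and let $\mathcal{U}^+(FG)$ be the set of units of $FG$ lying in $(FG)^+$. For a subset $S$ of an associative ring, with $[x,y]=xy-yx$, let $\gamma^1(S)=S$ and let $\gamma^{n+1}(S)=[\gamma^n(S),S]$ be the additive subgroup generated by all $[x,y]$ with $x\in\gamma^n(S)$, $y\in S$. $S$ is Lie nilpotent if $\gamma^n(S)=0$ for some $n$, and the least such $n$ is the Lie nilpotency index $\mathrm{t}(S)$. For a nonempty subset $H$ of a group, with $(x,y)=x^{-1}y^{-1}xy$, let $\gamma_1(H)=H$ and let $\gamma_{n+1}(H)=(\gamma_n(H),H)$ be the subgroup generated by all $(x,y)$ with $x\in\gamma_n(H)$, $y\in H$. $H$ is nilpotent if $\gamma_n(H)=1$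 for some $n$, and its nilpotency class is $\mathrm{cl}(H)=\min\{n\ge 0:\gamma_{n+1}(H)=1\}$. It is known (Passi–Passman–Sehgal) that $FG$ is Lie nilpotent in characteristic $p>0$ if and only if $G$ is nilpotent and $G'$ is a finite $p$-group. *)

theory Defs
  imports
    "HOL-Library.Poly_Mapping"
    "HOL-Computational_Algebra.Group_Closure"
    "HOL-Algebra.Sym_Groups"
    "HOL-Algebra.Elementary_Groups"
begin

text \<open>
  The group \<open>G\<close> is a type \<open>'g\<close> of class \<open>group_add\<close>, the library's class of groups that need not be
  commutative, written additively: \<open>g + h\<close>, \<open>0\<close>, \<open>- g\<close> are the product, the identity and the
  inverse of \<open>G\<close>. The group algebra \<open>FG\<close> is then the ring \<open>'g \<Rightarrow>\<^sub>0 'f\<close> of finitely supported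
  functions with the convolution product of \<open>HOL-Library.Poly_Mapping\<close>.

  The subgroup-theoretic notions are those of \<open>HOL-Algebra\<close>, applied to the records
  \<open>group_of_type\<close> (for \<open>G\<close>) and \<open>unit_group\<close> (for the unit group of \<open>FG\<close>).
\<close>

definition group_of_type :: "'g::group_add monoid" where
  "group_of_type = \<lparr>carrier = UNIV, monoid.mult = (+), one = 0\<rparr>"

definition unit_group :: "'a::monoid_mult monoid" where
  "unit_group = units_of \<lparr>carrier = UNIV, monoid.mult = (*), one = 1\<rparr>"

definition commutator_subgroup :: "'g::group_add set" where
  "commutator_subgroup = derived group_of_type (carrier group_of_type)"

definition torsion_group :: "('a, 'b) monoid_scheme \<Rightarrow> bool" where
  "torsion_group G \<longleftrightarrow> (\<forall>g \<in> carrier G. \<exists>n::nat. n > 0 \<and> g [^]\<^bsub>G\<^esub> n = \<one>\<^bsub>G\<^esub>)"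

text \<open>The library group \<open>sign_img\<close> is the multiplicative group \<open>{-1, 1}\<close> of integers.\<close>

definition orientation :: "('g::group_add \<Rightarrow> int) \<Rightarrow> bool" where
  "orientation \<sigma> \<longleftrightarrow> \<sigma> \<in> hom group_of_type sign_img"

definition classical_involution ::
    "('g::group_add \<Rightarrow> int) \<Rightarrow> ('g \<Rightarrow>\<^sub>0 'f::field) \<Rightarrow> ('g \<Rightarrow>\<^sub>0 'f)" where
  "classical_involution \<sigma> \<alpha> =
     (\<Sum>g \<in> Poly_Mapping.keys \<alpha>.
        Poly_Mapping.single (- g) (Poly_Mapping.lookup \<alpha> g * of_int (\<sigma> g)))"

definition symmetric_elements :: "('g::group_add \<Rightarrow> int) \<Rightarrow> ('g \<Rightarrow>\<^sub>0 'f::field) set" where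
  "symmetric_elements \<sigma> = {\<alpha>. classical_involution \<sigma> \<alpha> = \<alpha>}"

definition symmetric_units :: "('g::group_add \<Rightarrow> int) \<Rightarrow> ('g \<Rightarrow>\<^sub>0 'f::field) set" where
  "symmetric_units \<sigma> = carrier unit_group \<inter> symmetric_elements \<sigma>"

text \<open>
  Both series below start at index 1; the value at 0 is a dummy and is never used. The first term is
  the set itself, not the (additive) subgroup it generates.
\<close>

fun lie_gamma :: "nat \<Rightarrow> 'a::ring set \<Rightarrow> 'a set" where
  "lie_gamma 0 S = S"
| "lie_gamma (Suc 0) S = S"
| "lie_gamma (Suc (Suc n)) S =
     group_closure {x * y - y * x | x y. x \<in> lie_gamma (Suc n) S \<and> y \<in> S}"

definition lie_nilpotent :: "'a::ring set \<Rightarrow> bool" where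
  "lie_nilpotent S \<longleftrightarrow> (\<exists>n \<ge> 1. lie_gamma n S = {0})"

text \<open>Meaningful only if \<open>lie_nilpotent S\<close>.\<close>

definition lie_nilpotency_index :: "'a::ring set \<Rightarrow> nat" where
  "lie_nilpotency_index S = (LEAST n. n \<ge> 1 \<and> lie_gamma n S = {0})"

fun group_gamma :: "('a, 'b) monoid_scheme \<Rightarrow> nat \<Rightarrow> 'a set \<Rightarrow> 'a set" where
  "group_gamma G 0 H = H"
| "group_gamma G (Suc 0) H = H"
| "group_gamma G (Suc (Suc n)) H =
     generate G {inv\<^bsub>G\<^esub> x \<otimes>\<^bsub>G\<^esub> inv\<^bsub>G\<^esub> y \<otimes>\<^bsub>G\<^esub> x \<otimes>\<^bsub>G\<^esub> y | x y. x \<in> group_gamma G (Suc n) H \<and> y \<in> H}"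

text \<open>Meaningful only if some term of the series \<open>group_gamma G n H\<close>, \<open>n \<ge> 1\<close>, is trivial.\<close>

definition nilpotency_class :: "('a, 'b) monoid_scheme \<Rightarrow> 'a set \<Rightarrow> nat" where
  "nilpotency_class G H = (LEAST n. group_gamma G (Suc n) H = {\<one>\<^bsub>G\<^esub>})"

end

theory Submission
  imports Defs "HOL-Algebra.Sylow" "HOL-Algebra.Group_Action" "HOL-Algebra.Multiplicative_Group"
begin

text \<open>
  Put \<open>R = FG\<close> and let \<open>R\<^sup>(\<^sup>n\<^sup>)\<close> be its upper Lie powers. A multilinear commutator of group elements
  survives if some conjugacy class, or the set of commutators, is infinite; so Lie nilpotency makes
  \<open>G'\<close> finite. Lie commutators lie in the nil radical, so \<open>G'\<close> is a \<open>p\<close>-group, and \<open>p\<^sup>k\<close>-th powers are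
  central because \<open>ad(b)\<^sup>p = ad(b\<^sup>p)\<close>.

  Upper bound: descend a \<open>G\<close>-central series of \<open>G'\<close> with factors of order \<open>p\<close>. As long as \<open>G'/M\<close> is
  cyclic, generated by \<open>y\<close>, the powers of \<open>y - 1\<close> filter \<open>R\<close>. At the first noncyclic quotient the new
  central factor \<open>\<langle>c\<rangle>\<close> gives \<open>c - 1\<close> weight 2, less than the weight it would have in the cyclic
  case; this loss persists down to \<open>M = 1\<close> and yields \<open>R\<^sup>(\<^sup>|\<^sup>G\<^sup>'\<^sup>|\<^sup>) = 0\<close>. All this is done with ideals of \<open>R\<close>, without
  quotient groups. Both invariants are bounded by the upper Lie powers.

  Lower bound for \<open>G' = \<langle>x\<rangle>\<close> of order \<open>q\<close>: if \<open>(a, b) = x\<^sup>n\<close> with \<open>p\<close> not dividing \<open>n\<close>, then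
  \<open>r \<mapsto> b\<^sup>-\<^sup>1[r, b]\<close> acts on the layers of the \<open>(x - 1)\<close>-adic filtration with \<open>a\<close> as an eigenvector of
  eigenvalue \<open>n\<close>, so \<open>[a, b, \<dots>, b]\<close> with \<open>q - 1\<close> entries \<open>b\<close> does not vanish. A central \<open>z\<close> with
  \<open>\<sigma>(z) = -1\<close> exists since \<open>p\<close> is odd, and it transfers the computation from \<open>R\<close> to the symmetric
  elements. For units one starts from \<open>1 + a\<close> with \<open>a\<close> of odd order.
\<close>

text \<open>The equivalence turns on saving a single bracket. If G' is cyclic of order q, the powers
  of x - 1 are exhausted after q brackets and not earlier. If a new factor c splits off over a
  cyclic quotient of order p^i, then p^i brackets bring out one factor c - 1, but 2 p^i - 1 of them
  already bring out two, since (y - 1)^(2 p^i - 1) and (y - 1)^(2 p^i - 3) both vanish once p^i >=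
  3. As (c - 1)^p = 0, altogether p^(i+1) - 1 brackets suffice, and the later steps preserve the
  saving.

  For units the factor z + z^-1 is replaced by a central idempotent f orthogonal to its image under
  the involution: a unit may be prescribed on the component of f and completed symmetrically on the
  other one. The remaining obstacle is that the last nonzero term is f rho (x - 1)^(q - 1), where
  the coefficients of rho contain (q - 2)-th powers of eigenvalues. Their plain sum is an
  alternating power sum that is hard to keep away from 0. So only coefficients at group elements
  with the eigenvalue of a are summed: there the powers are constant and the signs add up to 1. This
  is legitimate because the eigenvalue of a group element depends only on its coset of G'.\<close>

abbreviation lie :: "'a::ring \<Rightarrow> 'a \<Rightarrow> 'a" where "lie x y \<equiv> x * y - y * x"

lemma lie_add_left: "lie (x + y) z = lie x z + lie y z" for x y z :: "'a::ring"
  by (simp add: algebra_simps)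

lemma lie_mult_left: "lie (x * y) z = x * lie y z + lie x z * y" for x y z :: "'a::ring"
  by (simp add: algebra_simps)

lemma lie_mult_right: "lie z (x * y) = lie z x * y + x * lie z y" for x y z :: "'a::ring"
  by (simp add: algebra_simps)

subsection \<open>Two-sided ideals\<close>

definition two_sided_ideal :: "'a::ring_1 set \<Rightarrow> bool" where
  "two_sided_ideal I \<longleftrightarrow>
     0 \<in> I \<and> (\<forall>x\<in>I. \<forall>y\<in>I. x + y \<in> I) \<and> (\<forall>x\<in>I. \<forall>r. r * x \<in> I \<and> x * r \<in> I)"

lemma two_sided_idealI:
  assumes "0 \<in> I" "\<And>x y. x \<in> I \<Longrightarrow> y \<in> I \<Longrightarrow> x + y \<in> I"
    and "\<And>r x. x \<in> I \<Longrightarrow> r * x \<in> I" "\<And>r x. x \<in> I \<Longrightarrow> x * r \<in> I"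
  shows "two_sided_ideal I"
  using assms unfolding two_sided_ideal_def by blast

lemma
  assumes "two_sided_ideal I"
  shows ideal_0: "0 \<in> I"
    and ideal_add: "x \<in> I \<Longrightarrow> y \<in> I \<Longrightarrow> x + y \<in> I"
    and ideal_mult_left: "x \<in> I \<Longrightarrow> r * x \<in> I"
    and ideal_mult_right: "x \<in> I \<Longrightarrow> x * r \<in> I"
  using assms unfolding two_sided_ideal_def by blast+

lemma ideal_uminus: "two_sided_ideal I \<Longrightarrow> x \<in> I \<Longrightarrow> - x \<in> I"
  using ideal_mult_left[of I x "-1"] by simp

lemma ideal_diff: "two_sided_ideal I \<Longrightarrow> x \<in> I \<Longrightarrow> y \<in> I \<Longrightarrow> x - y \<in> I"
  using ideal_add[of I x "- y"] ideal_uminus[of I y] by simp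

lemma ideal_lie: "two_sided_ideal I \<Longrightarrow> x \<in> I \<Longrightarrow> lie x y \<in> I"
  by (simp add: ideal_diff ideal_mult_left ideal_mult_right)

lemma ideal_lie': "two_sided_ideal I \<Longrightarrow> x \<in> I \<Longrightarrow> lie y x \<in> I"
  by (simp add: ideal_diff ideal_mult_left ideal_mult_right)

lemma two_sided_ideal_UNIV: "two_sided_ideal UNIV"
  by (simp add: two_sided_ideal_def)

lemma two_sided_ideal_zero: "two_sided_ideal ({0} :: 'a::ring_1 set)"
  by (simp add: two_sided_ideal_def)

definition ideal_gen :: "'a::ring_1 set \<Rightarrow> 'a set" where
  "ideal_gen S = \<Inter>{I. two_sided_ideal I \<and> S \<subseteq> I}"

lemma two_sided_ideal_gen: "two_sided_ideal (ideal_gen S)"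
  unfolding ideal_gen_def by (rule two_sided_idealI)
    (auto intro: ideal_0 ideal_add ideal_mult_left ideal_mult_right)

lemma ideal_gen_base: "x \<in> S \<Longrightarrow> x \<in> ideal_gen S"
  unfolding ideal_gen_def by blast

lemma ideal_gen_subset: "two_sided_ideal I \<Longrightarrow> S \<subseteq> I \<Longrightarrow> ideal_gen S \<subseteq> I"
  unfolding ideal_gen_def by blast

text \<open>As D commutes with everything modulo I, r D u = D r u - [D, r] u with the last term in
  I. With U the whole ring this gives ideals of multiples of D; with U an upper Lie power it keeps
  the factor D in front while U shrinks.\<close>

lemma central_multiples_ideal:
  assumes I: "two_sided_ideal I" and U: "two_sided_ideal U" and D: "\<And>r. lie D r \<in> I"
  shows "two_sided_ideal {D * u + i | u i. u \<in> U \<and> i \<in> I}" (is "two_sided_ideal ?T")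
proof (rule two_sided_idealI)
  show "0 \<in> ?T" using ideal_0[OF I] ideal_0[OF U] by force
next
  fix x y assume "x \<in> ?T" "y \<in> ?T"
  then obtain u i u' i' where *: "x = D * u + i" "y = D * u' + i'" "u \<in> U" "u' \<in> U" "i \<in> I" "i' \<in> I"
    by blast
  then have "x + y = D * (u + u') + (i + i')" by (simp add: algebra_simps)
  with * show "x + y \<in> ?T" using ideal_add[OF I] ideal_add[OF U] by blast
next
  fix r x assume "x \<in> ?T"
  then obtain u i where *: "x = D * u + i" "u \<in> U" "i \<in> I" by blast
  have "x * r = D * (u * r) + i * r" by (simp add: * algebra_simps)
  with * show "x * r \<in> ?T" using ideal_mult_right[OF I] ideal_mult_right[OF U] by blast
  have "r * x = D * (r * u) + (r * i - lie D r * u)" by (simp add: * algebra_simps)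
  moreover have "r * i - lie D r * u \<in> I"
    by (intro ideal_diff[OF I] ideal_mult_left[OF I *(3)] ideal_mult_right[OF I D])
  ultimately show "r * x \<in> ?T" using * ideal_mult_left[OF U] by blast
qed

subsection \<open>Upper Lie powers\<close>

text \<open>Indexed so that \<open>upper_lie n\<close> is the upper Lie power usually denoted \<open>R\<^sup>(\<^sup>n\<^sup>+\<^sup>1\<^sup>)\<close>.\<close>

fun upper_lie :: "nat \<Rightarrow> 'a::ring_1 set" where
  "upper_lie 0 = UNIV"
| "upper_lie (Suc n) = ideal_gen {lie x y | x y. x \<in> upper_lie n}"

lemma upper_lie_ideal: "two_sided_ideal (upper_lie n)"
  by (cases n) (auto simp: two_sided_ideal_UNIV two_sided_ideal_gen)

declare upper_lie.simps(2) [simp del]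

lemma lie_in_upper_lie: "x \<in> upper_lie n \<Longrightarrow> lie x y \<in> upper_lie (Suc n)"
  unfolding upper_lie.simps by (rule ideal_gen_base) blast

lemma upper_lie_Suc_subset:
  assumes "two_sided_ideal I" "\<And>x y. x \<in> upper_lie n \<Longrightarrow> lie x y \<in> I"
  shows "upper_lie (Suc n) \<subseteq> I"
  unfolding upper_lie.simps using assms by (intro ideal_gen_subset) auto

lemma upper_lie_Suc_le: "upper_lie (Suc n) \<subseteq> upper_lie n"
  by (rule upper_lie_Suc_subset) (auto simp: upper_lie_ideal intro: ideal_lie)

lemma upper_lie_antimono: "m \<le> n \<Longrightarrow> upper_lie n \<subseteq> upper_lie m"
  by (rule lift_Suc_antimono_le[of upper_lie]) (rule upper_lie_Suc_le)

lemma group_closure_subset_ideal: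
  assumes "two_sided_ideal I" "S \<subseteq> I"
  shows "group_closure S \<subseteq> I"
proof
  fix x assume "x \<in> group_closure S"
  then show "x \<in> I"
    by induct (use assms in \<open>auto intro: ideal_0 ideal_diff\<close>)
qed

lemma lie_gamma_subset_upper_lie: "lie_gamma (Suc n) S \<subseteq> upper_lie n"
proof (induct n)
  case (Suc n)
  show ?case
    using Suc unfolding lie_gamma.simps
    by (intro group_closure_subset_ideal[OF upper_lie_ideal]) (use lie_in_upper_lie in blast)
qed simp

lemma lie_power_central_mod:
  assumes I: "two_sided_ideal I" and C: "\<And>r. lie C r \<in> I"
  shows "lie (C ^ k) r \<in> I"
proof (induct k)
  case 0
  show ?case using ideal_0[OF I] by simp
next
  case (Suc k)
  have "lie (C ^ Suc k) r = C * lie (C ^ k) r + lie C r * C ^ k"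
    by (simp only: power_Suc lie_mult_left)
  then show ?case
    using Suc C I by (metis ideal_add ideal_mult_left ideal_mult_right)
qed

text \<open>Modulo I the power C^k behaves like a scalar, so after w brackets the recursion starts
  afresh on the cofactor: s further brackets lead into C^k times \<open>upper_lie s\<close>, and s =
  v splits off one more C.\<close>

lemma upper_lie_gain_factor:
  assumes I: "two_sided_ideal I" and C: "\<And>r. lie C r \<in> I"
    and w: "upper_lie w \<subseteq> {C ^ k * r + i | r i. i \<in> I}"
    and v: "upper_lie v \<subseteq> {C * r + i | r i. i \<in> I}"
  shows "upper_lie (w + v) \<subseteq> {C ^ Suc k * r + i | r i. i \<in> I}"
proof -
  define T where "T s = {C ^ k * u + i | u i. u \<in> upper_lie s \<and> i \<in> I}" for s
  have Ck: "lie (C ^ k) r \<in> I" for r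
    by (rule lie_power_central_mod[OF I C])
  have ideal: "two_sided_ideal (T s)" for s
    unfolding T_def by (rule central_multiples_ideal[OF I upper_lie_ideal Ck])
  have sub: "upper_lie (w + s) \<subseteq> T s" for s
  proof (induct s)
    case 0
    show ?case using w unfolding T_def by auto
  next
    case (Suc s)
    have "upper_lie (Suc (w + s)) \<subseteq> T (Suc s)"
    proof (rule upper_lie_Suc_subset[OF ideal])
      fix x y :: 'a assume "x \<in> upper_lie (w + s)"
      then obtain u i where *: "x = C ^ k * u + i" "u \<in> upper_lie s" "i \<in> I"
        using Suc unfolding T_def by blast
      have "lie x y = C ^ k * lie u y + (lie (C ^ k) y * u + lie i y)"
        by (simp add: * algebra_simps)
      moreover have "lie (C ^ k) y * u + lie i y \<in> I"
        using * Ck I by (meson ideal_add ideal_lie ideal_mult_right)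
      ultimately show "lie x y \<in> T (Suc s)"
        unfolding T_def using lie_in_upper_lie[OF *(2)] by blast
    qed
    then show ?case by simp
  qed
  show ?thesis
  proof
    fix x :: 'a assume "x \<in> upper_lie (w + v)"
    then obtain u i where *: "x = C ^ k * u + i" "u \<in> upper_lie v" "i \<in> I"
      using sub unfolding T_def by blast
    then obtain r j where "u = C * r + j" "j \<in> I" using v by blast
    then have "x = C ^ Suc k * r + (C ^ k * j + i)" "C ^ k * j + i \<in> I"
      using * I by (auto simp: distrib_left power_Suc2 mult.assoc simp del: power_Suc intro: ideal_add ideal_mult_left)
    then show "x \<in> {C ^ Suc k * r + i | r i. i \<in> I}" by blast
  qed
qed

subsection \<open>A weighted filtration\<close>

text \<open>\<open>Y\<close> has weight 1 and \<open>C\<close> has weight 2; everything of order 2 in \<open>C\<close> is discarded.\<close>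

locale weighted_filtration =
  fixes I :: "'a::ring_1 set" and Y C :: 'a
  assumes I: "two_sided_ideal I"
    and C_central: "\<And>r. lie C r \<in> I"
    and lie_Y: "\<And>r. \<exists>s t. lie r Y - (Y * Y * s + C * t) \<in> I"
    and lie_UNIV: "\<And>r s. \<exists>u v. lie r s - (Y * u + C * v) \<in> I"
begin

text \<open>The elements of weight at least w. The truncated w - 2 admits every multiple of C when w
  <= 2, and multiples of C C lie in every J w. Only right multiples are written; that J w is
  two-sided is a result (\<open>J_ideal\<close>).\<close>

definition J :: "nat \<Rightarrow> 'a set" where
  "J w = {x. \<exists>r s t. x - (Y ^ w * r + C * (Y ^ (w - 2) * s) + C * (C * t)) \<in> I}"

lemma J_I: "x \<in> I \<Longrightarrow> x \<in> J w"
  unfolding J_def by (rule CollectI, rule exI[of _ 0], rule exI[of _ 0], rule exI[of _ 0]) simp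

lemma J_Y: "Y ^ w * r \<in> J w"
  unfolding J_def
  by (rule CollectI, rule exI[of _ r], rule exI[of _ 0], rule exI[of _ 0]) (simp add: ideal_0[OF I])

lemma J_CY:
  assumes "w \<le> k + 2" shows "C * (Y ^ k * r) \<in> J w"
proof -
  have "C * (Y ^ k * r) = C * (Y ^ (w - 2) * (Y ^ (k - (w - 2)) * r))"
    using assms by (simp add: mult.assoc[symmetric] flip: power_add)
  then show ?thesis
    unfolding J_def using ideal_0[OF I]
    by (intro CollectI exI[of _ 0] exI[of _ "Y ^ (k - (w - 2)) * r"]) simp
qed

lemma J_CC: "C * (C * t) \<in> J w"
  unfolding J_def
  by (rule CollectI, rule exI[of _ 0], rule exI[of _ 0], rule exI[of _ t]) (simp add: ideal_0[OF I])

lemma J_add: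
  assumes "x \<in> J w" "y \<in> J w" shows "x + y \<in> J w"
proof -
  obtain r s t where 1: "x - (Y ^ w * r + C * (Y ^ (w - 2) * s) + C * (C * t)) \<in> I"
    using assms unfolding J_def by blast
  obtain r' s' t' where 2: "y - (Y ^ w * r' + C * (Y ^ (w - 2) * s') + C * (C * t')) \<in> I"
    using assms unfolding J_def by blast
  have "x + y - (Y ^ w * (r + r') + C * (Y ^ (w - 2) * (s + s')) + C * (C * (t + t'))) \<in> I"
    using ideal_add[OF I 1 2] by (simp add: algebra_simps)
  then show ?thesis unfolding J_def by blast
qed

lemma J_mult_right:
  assumes "x \<in> J w" shows "x * y \<in> J w"
proof -
  obtain r s t where 1: "x - (Y ^ w * r + C * (Y ^ (w - 2) * s) + C * (C * t)) \<in> I"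
    using assms unfolding J_def by blast
  have "x * y - (Y ^ w * (r * y) + C * (Y ^ (w - 2) * (s * y)) + C * (C * (t * y))) \<in> I"
    using ideal_mult_right[OF I 1, of y] by (simp add: algebra_simps)
  then show ?thesis unfolding J_def by blast
qed

lemma J_E:
  assumes "x \<in> J w"
  obtains r s t i where "x = Y ^ w * r + C * (Y ^ (w - 2) * s) + C * (C * t) + i" "i \<in> I"
proof -
  from assms obtain r s t where "x - (Y ^ w * r + C * (Y ^ (w - 2) * s) + C * (C * t)) \<in> I"
    unfolding J_def by blast
  then show thesis by (intro that[of r s t]) auto
qed

lemma J_antimono:
  assumes "v \<le> w" shows "J w \<subseteq> J v"
proof
  fix x assume "x \<in> J w"
  then obtain r s t i where *: "x = Y ^ w * r + C * (Y ^ (w - 2) * s) + C * (C * t) + i" "i \<in> I"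
    by (rule J_E)
  have "Y ^ w * r = Y ^ v * (Y ^ (w - v) * r)"
    using assms by (simp add: mult.assoc[symmetric] flip: power_add)
  then show "x \<in> J v"
    unfolding *(1) using assms *(2) J_Y[of v "Y ^ (w - v) * r"]
    by (intro J_add J_CC J_I[of i] J_CY) auto
qed

lemma J_C_mult:
  assumes "x \<in> J w" shows "C * x \<in> J (w + 2)"
proof -
  obtain r s t i where *: "x = Y ^ w * r + C * (Y ^ (w - 2) * s) + C * (C * t) + i" "i \<in> I"
    using assms by (rule J_E)
  show ?thesis
    unfolding *(1) distrib_left using ideal_mult_left[OF I *(2)]
    by (intro J_add J_CC J_I J_CY) auto
qed

lemma J_Y_mult:
  assumes "x \<in> J w" shows "Y * x \<in> J (w + 1)"
proof -
  obtain r s t i where *: "x = Y ^ w * r + C * (Y ^ (w - 2) * s) + C * (C * t) + i" "i \<in> I"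
    using assms by (rule J_E)
  define D where "D = lie Y C"
  have CI: "Y * (C * z) = C * (Y * z) + D * z" for z
    by (simp add: D_def algebra_simps)
  have D: "D * z \<in> I" for z
    using ideal_mult_right[OF I ideal_uminus[OF I C_central[of Y]]] by (simp add: D_def)
  have "Y * (Y ^ w * r) \<in> J (w + 1)"
    using J_Y[of "w + 1" r] by (simp add: mult.assoc)
  moreover have "Y * (C * (Y ^ (w - 2) * s)) \<in> J (w + 1)"
  proof -
    have "C * (Y ^ Suc (w - 2) * s) \<in> J (w + 1)" by (rule J_CY) simp
    then show ?thesis unfolding CI using J_add J_I[OF D] by (metis mult.assoc power_Suc)
  qed
  moreover have "Y * (C * (C * t)) \<in> J (w + 1)"
    unfolding CI distrib_left
    using J_add[OF J_add[OF J_CC[of "Y * t"] J_I[OF ideal_mult_left[OF I D]]] J_I[OF D]] by simp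
  moreover have "Y * i \<in> J (w + 1)"
    by (rule J_I[OF ideal_mult_left[OF I *(2)]])
  ultimately show ?thesis
    unfolding *(1) distrib_left by (intro J_add)
qed

lemma J_Y_power_mult: "x \<in> J w \<Longrightarrow> Y ^ k * x \<in> J (w + k)"
proof (induct k)
  case (Suc k)
  then show ?case using J_Y_mult[of "Y ^ k * x" "w + k"] by (simp add: mult.assoc)
qed simp

text \<open>By \<open>lie_Y\<close> a bracket with one factor Y has weight 2, a gain of one. The
  induction runs over all r because the cofactors s and t have to be moved across the remaining
  power of Y.\<close>

lemma lie_Y_power: "lie r (Y ^ w) \<in> J (w + 1)"
proof (induct w arbitrary: r)
  case 0
  show ?case using J_I[OF ideal_0[OF I]] by simp
next
  case (Suc w)
  obtain s t where st: "lie r Y - (Y * Y * s + C * t) \<in> I" using lie_Y by blast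
  \<comment> \<open>The induction hypothesis for u moves the power of Y to the front.\<close>
  have left: "u * Y ^ w \<in> J w" for u
  proof -
    have "u * Y ^ w = Y ^ w * u + lie u (Y ^ w)" by simp
    moreover have "lie u (Y ^ w) \<in> J w" using Suc[of u] J_antimono[of w "w+1"] by auto
    ultimately show ?thesis by (metis J_add[OF J_Y[of w u]])
  qed
  have "lie r (Y ^ Suc w) = Y ^ 2 * (s * Y ^ w) + C * (t * Y ^ w)
      + (lie r Y - (Y * Y * s + C * t)) * Y ^ w + Y * lie r (Y ^ w)"
    by (simp add: algebra_simps power2_eq_square)
  moreover have "\<dots> \<in> J (Suc w + 1)"
  proof (intro J_add)
    show "Y ^ 2 * (s * Y ^ w) \<in> J (Suc w + 1)" using J_Y_power_mult[OF left, of 2 s] by simp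
    show "C * (t * Y ^ w) \<in> J (Suc w + 1)" using J_C_mult[OF left, of t] by simp
    show "(lie r Y - (Y * Y * s + C * t)) * Y ^ w \<in> J (Suc w + 1)"
      by (intro J_I ideal_mult_right I st)
    show "Y * lie r (Y ^ w) \<in> J (Suc w + 1)" using J_Y_mult[OF Suc[of r]] by simp
  qed
  ultimately show ?case by simp
qed

lemma lie_in_J_1: "lie r s \<in> J 1"
proof -
  obtain u v where *: "lie r s - (Y * u + C * v) \<in> I" using lie_UNIV by blast
  have "lie r s = (lie r s - (Y * u + C * v)) + (Y ^ 1 * u + C * (Y ^ 0 * v))"
    by simp
  also have "\<dots> \<in> J 1"
    by (intro J_add J_I * J_Y J_CY) simp
  finally show ?thesis .
qed

text \<open>Leibniz rule: in [y, Y^k u] the weight grows either in [y, Y^k] or because every bracket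
  [y, u] has weight 1, while C passes through brackets modulo I.\<close>

lemma lie_J:
  assumes "x \<in> J w" shows "lie y x \<in> J (w + 1)"
proof -
  obtain r s t i where *: "x = Y ^ w * r + C * (Y ^ (w - 2) * s) + C * (C * t) + i" "i \<in> I"
    using assms by (rule J_E)
  have gen: "lie y (Y ^ k * u) \<in> J (k + 1)" for k u
    using J_add[OF J_mult_right[OF lie_Y_power[of y k], of u] J_Y_power_mult[OF lie_in_J_1, of k y u, unfolded add.commute[of 1]]]
    by (simp only: lie_mult_right[of y "Y ^ k" u])
  have C: "lie y C * z \<in> J v" for z v
    using ideal_mult_right[OF I ideal_uminus[OF I C_central[of y]], of z] by (intro J_I) simp
  have "lie y x = lie y (Y ^ w * r) + lie y (C * (Y ^ (w - 2) * s)) + lie y (C * (C * t)) + lie y i"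
    unfolding *(1) by (simp add: algebra_simps)
  moreover have "lie y (C * (Y ^ (w - 2) * s)) \<in> J (w + 1)"
    using J_add[OF C subsetD[OF J_antimono J_C_mult[OF gen, of "w - 2" s]], of "w + 1" "Y ^ (w - 2) * s"] assms
    by (simp only: lie_mult_right[of y C "Y ^ (w - 2) * s"])
  moreover have "lie y (C * (C * t)) \<in> J (w + 1)"
  proof -
    have eq: "lie y (C * (C * t)) = lie y C * (C * t) + C * (lie y C * t) + C * (C * lie y t)"
      by (simp add: algebra_simps)
    have "C * (lie y C * t) \<in> J (w + 1)"
      using ideal_mult_left[OF I ideal_mult_right[OF I ideal_uminus[OF I C_central[of y]], of t], of C]
      by (intro J_I) simp
    then show ?thesis unfolding eq by (intro J_add C J_CC)
  qed
  moreover have "lie y i \<in> J (w + 1)" by (intro J_I ideal_lie' I *)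
  ultimately show ?thesis using gen[of w r] J_add by (metis (no_types))
qed

lemma J_ideal: "two_sided_ideal (J w)"
proof (rule two_sided_idealI)
  show "0 \<in> J w" by (rule J_I[OF ideal_0[OF I]])
  fix r x assume x: "x \<in> J w"
  then show "x * r \<in> J w" by (rule J_mult_right)
  have "lie r x \<in> J w" using lie_J[OF x, of r] J_antimono[of w "w+1"] by auto
  then have "x * r + lie r x \<in> J w" by (rule J_add[OF J_mult_right[OF x]])
  then show "r * x \<in> J w" by simp
next
  fix x y assume "x \<in> J w" "y \<in> J w"
  then show "x + y \<in> J w" by (rule J_add)
qed

lemma upper_lie_subset_J: "upper_lie n \<subseteq> J n"
proof (induct n)
  case 0
  show ?case using J_Y[of 0] by auto
next
  case (Suc n)
  show ?case
  proof (rule upper_lie_Suc_subset[OF J_ideal])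
    fix x y :: 'a assume "x \<in> upper_lie n"
    then have "lie y x \<in> J (Suc n)" using lie_J[of x n y] Suc by auto
    then show "lie x y \<in> J (Suc n)" using ideal_uminus[OF J_ideal] by fastforce
  qed
qed

end

subsection \<open>The nil radical\<close>

text \<open>The upper nil radical. It serves as a modulus in which a central element with vanishing
  square vanishes itself (\<open>nil_radical_central_square\<close>).\<close>

definition nil_radical :: "'a::ring_1 set" where
  "nil_radical = \<Union>{A. two_sided_ideal A \<and> (\<forall>a\<in>A. \<exists>k. a ^ k = 0)}"

lemma ideal_power_diff:
  assumes I: "two_sided_ideal I" and xy: "x - y \<in> I"
  shows "x ^ k - y ^ k \<in> I"
proof (induct k)
  case 0
  show ?case using ideal_0[OF I] by simp
next
  case (Suc k)
  have "x ^ Suc k - y ^ Suc k = x * (x ^ k - y ^ k) + (x - y) * y ^ k"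
    by (simp add: algebra_simps)
  then show ?case
    using Suc xy I by (metis ideal_add ideal_mult_left ideal_mult_right)
qed

lemma two_sided_ideal_set_add:
  assumes A: "two_sided_ideal A" and B: "two_sided_ideal B"
  shows "two_sided_ideal {a + b | a b. a \<in> A \<and> b \<in> B}"
proof (rule two_sided_idealI)
  show "0 \<in> {a + b | a b. a \<in> A \<and> b \<in> B}"
    using ideal_0[OF A] ideal_0[OF B] by force
next
  fix x y assume "x \<in> {a + b | a b. a \<in> A \<and> b \<in> B}" "y \<in> {a + b | a b. a \<in> A \<and> b \<in> B}"
  then obtain a b a' b' where "x = a + b" "y = a' + b'" "a \<in> A" "b \<in> B" "a' \<in> A" "b' \<in> B" by blast
  moreover from this have "x + y = (a + a') + (b + b')" by (simp add: algebra_simps)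
  ultimately show "x + y \<in> {a + b | a b. a \<in> A \<and> b \<in> B}"
    using ideal_add[OF A] ideal_add[OF B] by blast
next
  fix r x assume "x \<in> {a + b | a b. a \<in> A \<and> b \<in> B}"
  then show "r * x \<in> {a + b | a b. a \<in> A \<and> b \<in> B}" "x * r \<in> {a + b | a b. a \<in> A \<and> b \<in> B}"
    by (auto simp: distrib_left distrib_right)
       (use ideal_mult_left[OF A] ideal_mult_left[OF B] ideal_mult_right[OF A] ideal_mult_right[OF B] in blast)+
qed

text \<open>Modulo B, (a + b)^k agrees with a^k = 0, so this power lies in B and is
  nilpotent.\<close>

lemma nil_radical_add_nil:
  assumes A: "two_sided_ideal A" "\<forall>a\<in>A. \<exists>k. a ^ k = 0"
    and B: "two_sided_ideal B" "\<forall>a\<in>B. \<exists>k. a ^ k = 0"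
  shows "\<forall>x\<in>{a + b | a b. a \<in> A \<and> b \<in> B}. \<exists>k. x ^ k = 0"
proof
  fix x assume "x \<in> {a + b | a b. a \<in> A \<and> b \<in> B}"
  then obtain a b where *: "x = a + b" "a \<in> A" "b \<in> B" by blast
  obtain k where k: "a ^ k = 0" using A * by blast
  have "x ^ k \<in> B" using ideal_power_diff[OF B(1), of x a k] * k by simp
  then obtain l where "(x ^ k) ^ l = 0" using B by blast
  then show "\<exists>k. x ^ k = 0" by (metis power_mult)
qed

lemma nil_radical_ideal: "two_sided_ideal (nil_radical :: 'a::ring_1 set)"
proof (rule two_sided_idealI)
  have "\<forall>a\<in>{0::'a}. \<exists>k. a ^ k = 0" by (auto intro: exI[of _ 1])
  then show "0 \<in> (nil_radical :: 'a set)"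
    unfolding nil_radical_def using two_sided_ideal_zero by blast
next
  fix x y :: 'a assume "x \<in> nil_radical" "y \<in> nil_radical"
  then obtain A B where *: "two_sided_ideal A" "\<forall>a\<in>A. \<exists>k. a ^ k = 0" "two_sided_ideal B"
    "\<forall>a\<in>B. \<exists>k. a ^ k = 0" "x \<in> A" "y \<in> B"
    unfolding nil_radical_def by blast
  have "x + y \<in> {a + b | a b. a \<in> A \<and> b \<in> B}" using * by blast
  then show "x + y \<in> nil_radical"
    unfolding nil_radical_def
    using two_sided_ideal_set_add[OF *(1,3)] nil_radical_add_nil[OF *(1-4)] by blast
next
  fix r x :: 'a assume "x \<in> nil_radical"
  then show "r * x \<in> nil_radical" "x * r \<in> nil_radical"
    unfolding nil_radical_def using ideal_mult_left ideal_mult_right by blast+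
qed

lemma nil_radical_nilpotent: "x \<in> nil_radical \<Longrightarrow> \<exists>k. x ^ k = 0"
  unfolding nil_radical_def by blast

text \<open>Modulo the radical (z r + n)^2 equals z^2 r^2, which is zero there; hence the multiples
  of z together with the radical form a nil ideal.\<close>

lemma nil_radical_central_square:
  assumes z: "\<And>r. lie z r \<in> nil_radical" and zz: "z * z \<in> nil_radical"
  shows "z \<in> nil_radical"
proof -
  note N = nil_radical_ideal
  define A where "A = {z * r + n | r n. n \<in> nil_radical}"
  have A: "two_sided_ideal A"
    unfolding A_def using central_multiples_ideal[OF N two_sided_ideal_UNIV z] by simp
  have "\<exists>k. x ^ k = 0" if x: "x \<in> A" for x
  proof -
    obtain r n where *: "x = z * r + n" "n \<in> nil_radical" using x unfolding A_def by blast
    have "x ^ 2 = z * z * (r * r) - z * lie z r * r + (z * r * n + n * (z * r) + n * n)"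
      by (simp add: * algebra_simps power2_eq_square)
    also have "\<dots> \<in> nil_radical"
      by (intro ideal_add[OF N] ideal_diff[OF N] ideal_mult_right[OF N zz]
          ideal_mult_right[OF N ideal_mult_left[OF N z]] ideal_mult_left[OF N *(2)] ideal_mult_right[OF N *(2)])
    finally obtain k where "(x ^ 2) ^ k = 0" using nil_radical_nilpotent by blast
    then show ?thesis by (metis power_mult)
  qed
  moreover have "z \<in> A" unfolding A_def using ideal_0[OF N] by (intro CollectI exI[of _ 1] exI[of _ 0]) simp
  ultimately show ?thesis unfolding nil_radical_def using A by blast
qed

section \<open>Lie commutators are nil\<close>

lemma lie_gamma_generator:
  "x \<in> lie_gamma (Suc n) S \<Longrightarrow> y \<in> S \<Longrightarrow> lie x y \<in> lie_gamma (Suc (Suc n)) S"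
  unfolding lie_gamma.simps by (rule group_closure.base) blast

lemma lie_gamma_Suc_trivial:
  fixes S :: "'a::ring_1 set"
  assumes "lie_gamma (Suc n) S = {0}" shows "lie_gamma (Suc (Suc n)) S = {0}"
proof -
  have "{lie x y |x y. x \<in> lie_gamma (Suc n) S \<and> y \<in> S} \<subseteq> {0}" using assms by auto
  then have "lie_gamma (Suc (Suc n)) S \<subseteq> {0}"
    unfolding lie_gamma.simps by (intro group_closure_subset_ideal) (auto simp: two_sided_ideal_zero)
  then show ?thesis by auto
qed

lemma lie_gamma_trivial_mono:
  fixes S :: "'a::ring_1 set"
  assumes "lie_gamma (Suc n) S = {0}" "n \<le> m" shows "lie_gamma (Suc m) S = {0}"
  using assms(2) by (induct rule: dec_induct) (auto simp: assms(1) lie_gamma_Suc_trivial simp del: lie_gamma.simps)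

text \<open>Descending induction along the series: if its next term lies in the radical, then every
  z = [u, v] of the present term is central modulo the radical, and it remains to see that z^2
  vanishes there.\<close>

lemma lie_in_nil_radical:
  assumes "lie_nilpotent (UNIV :: 'a::ring_1 set)"
  shows "lie x y \<in> (nil_radical :: 'a set)"
proof -
  note N = nil_radical_ideal
  obtain n where n: "n \<ge> 1" "lie_gamma n (UNIV :: 'a set) = {0}"
    using assms unfolding lie_nilpotent_def by blast
  have step: "lie_gamma (Suc (Suc j)) (UNIV :: 'a set) \<subseteq> nil_radical"
    if IH: "lie_gamma (Suc (Suc (Suc j))) (UNIV :: 'a set) \<subseteq> nil_radical" for j
    unfolding lie_gamma.simps
  proof (rule group_closure_subset_ideal[OF N], clarify)
    fix u v :: 'a assume u: "u \<in> lie_gamma (Suc j) UNIV"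
    define z where "z = lie u v"
    have central: "lie (lie u w) r \<in> nil_radical" for w r
      using lie_gamma_generator[OF lie_gamma_generator[OF u]] IH by blast
    \<comment> \<open>Since [u, v u] = z u, one more bracket with v produces z^2 up to a multiple of
      [z, v].\<close>
    have "z * lie u v + lie z v * u = lie (lie u (v * u)) v"
      unfolding z_def by (simp add: algebra_simps)
    then have "z * lie u v + lie z v * u \<in> nil_radical" using central by metis
    moreover have "lie z v * u \<in> nil_radical"
      unfolding z_def by (rule ideal_mult_right[OF N central])
    ultimately have "z * lie u v + lie z v * u - lie z v * u \<in> nil_radical"
      by (rule ideal_diff[OF N])
    then have zz: "z * z \<in> nil_radical" by (simp only: z_def add_diff_cancel_right')
    have "lie z r \<in> nil_radical" for r unfolding z_def by (rule central)
    then have "z \<in> nil_radical" using zz by (rule nil_radical_central_square)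
    then show "lie u v \<in> nil_radical" by (simp only: z_def)
  qed
  have "lie_gamma (Suc (Suc (n - j))) (UNIV :: 'a set) \<subseteq> nil_radical" if "j \<le> n" for j
    using that
  proof (induct j)
    case 0
    show ?case using lie_gamma_trivial_mono[of "n - 1" "UNIV :: 'a set" "Suc n"] n ideal_0[OF N]
      by (simp del: lie_gamma.simps)
  next
    case (Suc j)
    then show ?case using step[of "n - Suc j"] by (simp del: lie_gamma.simps add: Suc_diff_Suc)
  qed
  from this[of n] have "lie_gamma (Suc (Suc 0)) (UNIV :: 'a set) \<subseteq> nil_radical" by (simp del: lie_gamma.simps)
  moreover have "lie x y \<in> lie_gamma (Suc (Suc 0)) (UNIV :: 'a set)"
    by (rule lie_gamma_generator) auto
  ultimately show ?thesis by blast
qed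

subsection \<open>Groups in additive notation\<close>

primrec nmul :: "nat \<Rightarrow> 'g::monoid_add \<Rightarrow> 'g" where
  "nmul 0 x = 0"
| "nmul (Suc n) x = x + nmul n x"

lemmas group_word_simps = add.assoc diff_conv_add_uminus minus_add

lemma nmul_add: "nmul (m + n) x = nmul m x + nmul n x"
  by (induct m) (simp_all add: add.assoc)

lemma nmul_commute: "nmul m x + nmul n x = nmul n x + nmul m x"
  by (metis add.commute nmul_add)

lemma nmul_1 [simp]: "nmul (Suc 0) x = x"
  by simp

lemma nmul_mult: "nmul (m * n) x = nmul m (nmul n x)"
  by (induct m) (simp_all add: nmul_add)

lemma nmul_zero [simp]: "nmul n 0 = 0"
  by (induct n) simp_all

lemma nmul_Suc2: "nmul (Suc n) x = nmul n x + x"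
  using nmul_commute[of 1 x n] by simp

lemma nmul_conj: "nmul n (- g + x + g) = - g + nmul n x + g" for x :: "'g::group_add"
  by (induct n) (simp_all add: add.assoc)

lemma nmul_central:
  assumes "\<And>g. z + g = g + z"
  shows "nmul j z + g = g + nmul j z"
proof (induct j)
  case (Suc j)
  have "nmul (Suc j) z + g = z + (nmul j z + g)" by (simp add: add.assoc)
  also have "\<dots> = (z + g) + nmul j z" unfolding Suc by (simp add: add.assoc)
  also have "\<dots> = g + nmul (Suc j) z" unfolding assms by (simp add: add.assoc)
  finally show ?case .
qed simp

definition subgrp :: "'g::group_add set \<Rightarrow> bool" where
  "subgrp H \<longleftrightarrow> 0 \<in> H \<and> (\<forall>x\<in>H. \<forall>y\<in>H. x + y \<in> H) \<and> (\<forall>x\<in>H. - x \<in> H)"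

lemma
  assumes "subgrp H"
  shows subgrp_0: "0 \<in> H"
    and subgrp_add: "x \<in> H \<Longrightarrow> y \<in> H \<Longrightarrow> x + y \<in> H"
    and subgrp_minus: "x \<in> H \<Longrightarrow> - x \<in> H"
  using assms unfolding subgrp_def by auto

lemma subgrp_diff: "subgrp H \<Longrightarrow> x \<in> H \<Longrightarrow> y \<in> H \<Longrightarrow> x - y \<in> H"
  using subgrp_add[of H x "- y"] subgrp_minus[of H y] by simp

lemma subgrp_nmul: "subgrp H \<Longrightarrow> x \<in> H \<Longrightarrow> nmul n x \<in> H"
  by (induct n) (auto intro: subgrp_0 subgrp_add)

abbreviation conj_by :: "'g::group_add \<Rightarrow> 'g \<Rightarrow> 'g" where
  "conj_by g x \<equiv> - g + x + g"

text \<open>The commutator convention of the group series. The derived subgroup is generated by the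
  elements a + b - a - b instead; replacing both arguments by their negatives passes from one form
  to the other.\<close>

definition gcomm :: "'g::group_add \<Rightarrow> 'g \<Rightarrow> 'g" where
  "gcomm x y = - x - y + x + y"

lemma add_commute_gcomm: "x + y = y + x + gcomm x y"
  by (simp add: gcomm_def group_word_simps del: add_uminus_conv_diff)

lemma conj_by_gcomm: "conj_by g x = x + gcomm x g"
  by (simp add: gcomm_def group_word_simps del: add_uminus_conv_diff)

abbreviation G' :: "'g::group_add set" where "G' \<equiv> commutator_subgroup"

lemma group_of_type_simps [simp]:
  "carrier group_of_type = UNIV" "x \<otimes>\<^bsub>group_of_type\<^esub> y = x + y" "\<one>\<^bsub>group_of_type\<^esub> = 0"
  by (simp_all add: group_of_type_def)

interpretation got: group "group_of_type :: 'g::group_add monoid"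
  by (rule groupI) (auto simp: add.assoc intro: left_minus)

lemma inv_group_of_type [simp]: "inv\<^bsub>group_of_type\<^esub> x = - x" for x :: "'g::group_add"
  by (rule got.inv_equality) auto

lemma pow_group_of_type: "x [^]\<^bsub>group_of_type\<^esub> n = nmul n x" for x :: "'g::group_add" and n :: nat
  by (induct n) (simp_all add: nmul_Suc2 del: nmul.simps(2))

lemma subgrp_iff: "subgrp H \<longleftrightarrow> subgroup H group_of_type"
  unfolding subgrp_def subgroup_def by auto

lemma subgrp_G': "subgrp (G' :: 'g::group_add set)"
  unfolding subgrp_iff commutator_subgroup_def derived_def
  by (rule got.generate_is_subgroup) simp

lemma commutator_in_G': "a + b - a - b \<in> (G' :: 'g::group_add set)"
  unfolding commutator_subgroup_def derived_def
  by (rule generate.incl) (simp, metis add_uminus_conv_diff)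

lemma gcomm_in_G': "gcomm a b \<in> (G' :: 'g::group_add set)"
  using commutator_in_G'[of "- a" "- b"] by (simp add: gcomm_def)

lemma G'_subset:
  fixes H :: "'g::group_add set"
  assumes "subgrp H" "\<And>a b. a + b - a - b \<in> H"
  shows "G' \<subseteq> H"
  unfolding commutator_subgroup_def derived_def
  by (rule got.generate_subgroup_incl) (use assms subgrp_iff in auto)

lemma G'_conj: "x \<in> G' \<Longrightarrow> conj_by g x \<in> (G' :: 'g::group_add set)"
  unfolding conj_by_gcomm by (intro subgrp_add subgrp_G' gcomm_in_G')

subsection \<open>The group algebra\<close>

abbreviation gel :: "'g \<Rightarrow> ('g::group_add \<Rightarrow>\<^sub>0 'f::field)" where
  "gel g \<equiv> Poly_Mapping.single g 1"

lemma gel_mult: "gel g * gel h = gel (g + h)"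
  by (simp add: mult_single)

lemma gel_0 [simp]: "gel 0 = 1"
  by simp

lemma gel_power: "gel g ^ n = gel (nmul n g)"
  by (induct n) (simp_all add: gel_mult)

lemma gel_inverse [simp]: "gel g * gel (- g) = 1" "gel (- g) * gel g = 1"
  by (simp_all add: gel_mult)

lemma gel_eq_iff [simp]: "(gel g :: 'g::group_add \<Rightarrow>\<^sub>0 'f::field) = gel h \<longleftrightarrow> g = h"
  by (metis inj_single[THEN injD] lookup_single_eq lookup_single_not_eq zero_neq_one)

lemma group_algebra_induct [case_names add single]:
  fixes r :: "'g::group_add \<Rightarrow>\<^sub>0 'f::field"
  assumes add: "\<And>x y. P x \<Longrightarrow> P y \<Longrightarrow> P (x + y)" and single: "\<And>g c. P (Poly_Mapping.single g c)"
  shows "P r"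
proof (induct r rule: update_induct)
  case const
  show ?case using single[of 0 0] by simp
next
  case (update f a b)
  have "Poly_Mapping.update a b f = f + Poly_Mapping.single a b"
    using update(1) by (intro poly_mapping_eqI)
      (auto simp: lookup_update lookup_add lookup_single when_def in_keys_iff)
  then show ?case using add[OF update(3) single] by simp
qed

lemma lookup_mult_single:
  fixes r :: "'g::group_add \<Rightarrow>\<^sub>0 'f::field"
  shows "Poly_Mapping.lookup (r * Poly_Mapping.single g c) k = Poly_Mapping.lookup r (k - g) * c"
proof (induct r rule: group_algebra_induct)
  case (single h d)
  show ?case by (auto simp: mult_single lookup_single when_def algebra_simps)
qed (simp add: distrib_right lookup_add)

lemma lookup_single_mult:
  fixes r :: "'g::group_add \<Rightarrow>\<^sub>0 'f::field"
  shows "Poly_Mapping.lookup (Poly_Mapping.single g c * r) k = c * Poly_Mapping.lookup r (- g + k)"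
proof (induct r rule: group_algebra_induct)
  case (single h d)
  show ?case by (auto simp: mult_single lookup_single when_def algebra_simps)
qed (simp add: distrib_left lookup_add)

lemma scalar_central: "Poly_Mapping.single 0 c * r = r * Poly_Mapping.single 0 c"
  for r :: "'g::group_add \<Rightarrow>\<^sub>0 'f::field"
  by (rule poly_mapping_eqI) (simp add: lookup_mult_single lookup_single_mult)

subsection \<open>Finiteness of the conjugacy classes\<close>

abbreviation conj_class :: "'g::group_add \<Rightarrow> 'g set" where
  "conj_class u \<equiv> range (\<lambda>g. conj_by g u)"

lemma finite_conj_class_diff:
  fixes a b :: "'g::group_add"
  assumes "finite (conj_class a)" "finite (conj_class b)"
  shows "finite (conj_class (- a + b))"
proof (rule finite_subset)
  show "conj_class (- a + b) \<subseteq> (\<lambda>(x, y). - x + y) ` (conj_class a \<times> conj_class b)"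
  proof clarify
    fix g
    have "conj_by g (- a + b) = - conj_by g a + conj_by g b"
      by (simp add: group_word_simps del: add_uminus_conv_diff)
    then show "conj_by g (- a + b) \<in> (\<lambda>(x, y). - x + y) ` (conj_class a \<times> conj_class b)"
      by (intro image_eqI[of _ _ "(conj_by g a, conj_by g b)"]) auto
  qed
qed (use assms in auto)

text \<open>If \<open>u\<close> has infinitely many conjugates, one of them is outside the support of \<open>w\<close>, and then
  the coefficient of \<open>u\<close> in \<open>w\<close> survives in a commutator of \<open>w\<close> with a group element.\<close>

lemma infinite_class_gamma:
  fixes u :: "'g::group_add"
  assumes "infinite (conj_class u)"
  shows "\<exists>w v. w \<in> lie_gamma (Suc n) (UNIV :: ('g \<Rightarrow>\<^sub>0 'f::field) set)
           \<and> infinite (conj_class v) \<and> Poly_Mapping.lookup w v \<noteq> 0"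
proof (induct n)
  case 0
  show ?case using assms by (auto intro!: exI[of _ "gel u"] exI[of _ u])
next
  case (Suc n)
  then obtain w v where w: "w \<in> lie_gamma (Suc n) (UNIV :: ('g \<Rightarrow>\<^sub>0 'f) set)"
    and v: "infinite (conj_class v)" "Poly_Mapping.lookup w v \<noteq> 0" by blast
  \<comment> \<open>If the conjugate of v by g avoids B, then the conjugates of v by g and by g + v
    both avoid the support of w.\<close>
  define B where "B = Poly_Mapping.keys w \<union> (\<lambda>k. v + k - v) ` Poly_Mapping.keys w"
  have "finite B" by (simp add: B_def)
  then have "\<not> conj_class v \<subseteq> B" using v(1) finite_subset by metis
  then obtain g where g: "conj_by g v \<notin> B" by fast
  have key: "conj_by h v \<notin> Poly_Mapping.keys w \<Longrightarrow> infinite (conj_class (v + h)) \<Longrightarrow> ?case" for h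
  proof (intro exI conjI)
    assume h: "conj_by h v \<notin> Poly_Mapping.keys w"
    show "lie w (gel h) \<in> lie_gamma (Suc (Suc n)) (UNIV :: ('g \<Rightarrow>\<^sub>0 'f) set)"
      by (rule lie_gamma_generator[OF w]) simp
    show "Poly_Mapping.lookup (lie w (gel h)) (v + h) \<noteq> 0"
      using h v(2) by (simp add: lookup_minus lookup_mult_single lookup_single_mult in_keys_iff add.assoc)
  qed
  show ?case
  proof (cases "infinite (conj_class (v + g))")
    case True
    then show ?thesis using g key[of g] unfolding B_def by blast
  next
    case False
    have 1: "conj_by (g + v) v \<notin> Poly_Mapping.keys w"
    proof
      assume *: "conj_by (g + v) v \<in> Poly_Mapping.keys w"
      have "conj_by g v = v + conj_by (g + v) v - v"
        by (simp add: group_word_simps del: add_uminus_conv_diff)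
      then show False using * g unfolding B_def by blast
    qed
    \<comment> \<open>The elements with finite class are closed under quotients; v + g has a finite
      class here, so v + g + v cannot have one, as the quotient of the two is v.\<close>
    have "infinite (conj_class (v + (g + v)))"
    proof
      assume "finite (conj_class (v + (g + v)))"
      then have "finite (conj_class (- (v + g) + (v + (g + v))))"
        using finite_conj_class_diff False by blast
      moreover have "- (v + g) + (v + (g + v)) = v"
        by (simp add: group_word_simps del: add_uminus_conv_diff)
      ultimately show False using v(1) by simp
    qed
    then show ?thesis using 1 key by blast
  qed
qed

lemma finite_conj_class:
  assumes "lie_nilpotent (UNIV :: ('g::group_add \<Rightarrow>\<^sub>0 'f::field) set)"
  shows "finite (conj_class (u :: 'g))"
proof (rule ccontr)
  assume u: "infinite (conj_class u)"
  obtain n where n: "n \<ge> 1" "lie_gamma n (UNIV :: ('g \<Rightarrow>\<^sub>0 'f) set) = {0}"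
    using assms unfolding lie_nilpotent_def by blast
  show False using infinite_class_gamma[OF u, of "n - 1", where 'f='f] n by (auto simp del: lie_gamma.simps)
qed

subsection \<open>Finiteness of the set of commutators\<close>

definition centralizer_of :: "'g::group_add set \<Rightarrow> 'g set" where
  "centralizer_of X = {g. \<forall>x\<in>X. g + x = x + g}"

text \<open>Products of commutators of independent commuting pairs: \<open>[a\<^sub>1 a\<^sub>2 \<dots> a\<^sub>n, b\<^sub>1, \<dots>, b\<^sub>n] = [a\<^sub>1, b\<^sub>1] \<dots> [a\<^sub>n, b\<^sub>n]\<close>
  if \<open>a\<^sub>i\<close> and \<open>b\<^sub>i\<close> commute with \<open>a\<^sub>j\<close> and \<open>b\<^sub>j\<close> for \<open>i \<noteq> j\<close>.\<close>

lemma infinite_commutators_gamma: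
  assumes inf: "\<And>X :: 'g::group_add set. finite X \<Longrightarrow>
    infinite {a + b - a - b | a b. a \<in> centralizer_of X \<and> b \<in> centralizer_of X}"
  shows "\<exists>(w :: 'g \<Rightarrow>\<^sub>0 'f::field) X. w \<noteq> 0 \<and> finite X \<and>
    (\<forall>a\<in>centralizer_of X. w * gel a \<in> lie_gamma (Suc n) UNIV \<and> gel a * w = w * gel a)"
proof (induct n)
  case 0
  show ?case by (rule exI[of _ 1], rule exI[of _ "{}"]) simp
next
  case (Suc n)
  then obtain w :: "'g \<Rightarrow>\<^sub>0 'f" and X where w: "w \<noteq> 0" and X: "finite X"
    and wX: "\<And>a. a \<in> centralizer_of X \<Longrightarrow> w * gel a \<in> lie_gamma (Suc n) UNIV"
    and comm: "\<And>a. a \<in> centralizer_of X \<Longrightarrow> gel a * w = w * gel a" by blast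
  obtain s where s: "Poly_Mapping.lookup w s \<noteq> 0"
    using w by (metis poly_mapping_eqI lookup_zero)
  \<comment> \<open>The commutator of a and b is chosen outside s^-1 times the support of w, so that
    the coefficient of w at s is not cancelled in w [a, b].\<close>
  have "finite ((\<lambda>t. - s + t) ` Poly_Mapping.keys w)" by simp
  then obtain a b where ab: "a \<in> centralizer_of X" "b \<in> centralizer_of X"
    "a + b - a - b \<notin> (\<lambda>t. - s + t) ` Poly_Mapping.keys w"
    using inf[OF X] finite_subset by (smt (verit) mem_Collect_eq subsetI)
  define w' where "w' = w * lie (gel a) (gel b)"
  have *: "w' = w * gel (a + b) - w * gel (b + a)"
    by (simp add: w'_def algebra_simps gel_mult)
  have "Poly_Mapping.lookup w (s + (a + b) - (b + a)) = 0"
  proof (rule ccontr)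
    assume "Poly_Mapping.lookup w (s + (a + b) - (b + a)) \<noteq> 0"
    then have "s + (a + b - a - b) \<in> Poly_Mapping.keys w"
      by (simp add: in_keys_iff group_word_simps del: add_uminus_conv_diff)
    then have "- s + (s + (a + b - a - b)) \<in> (\<lambda>t. - s + t) ` Poly_Mapping.keys w" by (rule imageI)
    then show False using ab(3) by (simp only: minus_add_cancel)
  qed
  then have "Poly_Mapping.lookup w' (s + (a + b)) \<noteq> 0"
    using s by (simp add: * lookup_minus lookup_mult_single)
  then have "w' \<noteq> 0" by auto
  moreover have "finite (X \<union> {a, b})" using X by simp
  moreover have "w' * gel c \<in> lie_gamma (Suc (Suc n)) UNIV \<and> gel c * w' = w' * gel c"
    if c: "c \<in> centralizer_of (X \<union> {a, b})" for c
  proof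
    have cX: "c \<in> centralizer_of X" and ca: "c + a = a + c" and cb: "c + b = b + c"
      using c by (auto simp: centralizer_of_def)
    have "a + c \<in> centralizer_of X"
      using cX ab(1) unfolding centralizer_of_def by (auto simp: add.assoc) (metis add.assoc)
    \<comment> \<open>The factor c commutes with a and b and passes through the bracket: [w a c, b]
      = w [a, b] c.\<close>
    then have "lie (w * gel (a + c)) (gel b) \<in> lie_gamma (Suc (Suc n)) UNIV"
      using lie_gamma_generator[OF wX] by blast
    moreover have "lie (w * gel (a + c)) (gel b) = w' * gel c"
    proof -
      have "w * gel (a + c) * gel b = w * gel (a + b) * gel c"
        using cb by (simp add: mult.assoc gel_mult add.assoc)
      moreover have "gel b * (w * gel (a + c)) = w * gel (b + a) * gel c"
        using comm[OF ab(2)] by (simp add: mult.assoc[symmetric]) (simp add: mult.assoc gel_mult add.assoc)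
      ultimately show ?thesis by (simp add: * algebra_simps)
    qed
    ultimately show "w' * gel c \<in> lie_gamma (Suc (Suc n)) UNIV" by (simp only:)
    have "c + (a + b) = a + b + c" "c + (b + a) = b + a + c"
      using ca cb by (metis add.assoc)+
    then have 1: "gel c * gel (a + b) = (gel (a + b) * gel c :: 'g \<Rightarrow>\<^sub>0 'f)"
      "gel c * gel (b + a) = (gel (b + a) * gel c :: 'g \<Rightarrow>\<^sub>0 'f)"
      by (simp_all only: gel_mult)
    have "gel c * (w * x) = w * (gel c * x)" for x
      using comm[OF cX] by (simp only: mult.assoc[symmetric])
    then show "gel c * w' = w' * gel c"
      by (simp add: * right_diff_distrib left_diff_distrib 1 mult.assoc)
  qed
  ultimately show ?case by blast
qed

lemma finite_commutators_centralizer: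
  assumes "lie_nilpotent (UNIV :: ('g::group_add \<Rightarrow>\<^sub>0 'f::field) set)"
  obtains X :: "'g::group_add set" where "finite X"
    "finite {a + b - a - b | a b. a \<in> centralizer_of X \<and> b \<in> centralizer_of X}"
proof (rule ccontr)
  assume "\<not> thesis"
  then have inf: "finite X \<Longrightarrow> infinite {a + b - a - b | a b. a \<in> centralizer_of X \<and> b \<in> centralizer_of X}"
    for X :: "'g set" using that by blast
  obtain n where n: "n \<ge> 1" "lie_gamma n (UNIV :: ('g \<Rightarrow>\<^sub>0 'f) set) = {0}"
    using assms unfolding lie_nilpotent_def by blast
  obtain w :: "'g \<Rightarrow>\<^sub>0 'f" and X where "w \<noteq> 0"
    "\<forall>a\<in>centralizer_of X. w * gel a \<in> lie_gamma (Suc (n - 1)) UNIV"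
    using infinite_commutators_gamma[OF inf, of "n - 1", where 'f='f] by blast
  moreover have "0 \<in> centralizer_of X" by (simp add: centralizer_of_def)
  ultimately show False using n by (auto simp del: lie_gamma.simps)
qed

text \<open>The centralizer of the finite set X has finite index, because conjugation moves each
  element of X within a finite class. Writing a = t + h and b = t' + h' with t, t' in a finite
  transversal T, the commutator expands into factors from finite sets.\<close>

lemma finite_commutators:
  assumes L: "lie_nilpotent (UNIV :: ('g::group_add \<Rightarrow>\<^sub>0 'f::field) set)"
  shows "finite {a + b - a - b | a b :: 'g. True}"
proof -
  note fin = finite_conj_class[OF L]
  obtain X :: "'g set" where X: "finite X" and
    K: "finite {a + b - a - b | a b. a \<in> centralizer_of X \<and> b \<in> centralizer_of X}" (is "finite ?K")
    using finite_commutators_centralizer[OF L] .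
  define \<phi> where "\<phi> g = (\<lambda>x\<in>X. g + x - g)" for g :: 'g
  have conj: "g + x - g \<in> conj_class x" for g x :: 'g
    by (rule image_eqI[of _ _ "- g"]) simp_all
  have "range \<phi> \<subseteq> PiE X conj_class"
    unfolding \<phi>_def using conj by auto
  then have fin_range: "finite (range \<phi>)"
    using X fin by (meson finite_PiE finite_subset)
  define T where "T = inv_into UNIV \<phi> ` range \<phi>"
  have T: "finite T" unfolding T_def using fin_range by simp
  have decomp: "\<exists>t\<in>T. \<exists>h\<in>centralizer_of X. g = t + h" for g
  proof -
    define t where "t = inv_into UNIV \<phi> (\<phi> g)"
    have \<phi>: "\<phi> t = \<phi> g" unfolding t_def by (rule f_inv_into_f) simp
    have "- t + g \<in> centralizer_of X"
      unfolding centralizer_of_def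
    proof clarify
      fix x assume "x \<in> X"
      then have "g + x - g = t + x - t" using \<phi> unfolding \<phi>_def by (metis restrict_apply')
      then have "- t + (g + x - g) + g = - t + (t + x - t) + g" by (simp only:)
      then show "- t + g + x = x + (- t + g)"
        by (simp add: group_word_simps del: add_uminus_conv_diff)
    qed
    moreover have "t \<in> T" unfolding T_def t_def by blast
    moreover have "g = t + (- t + g)" by simp
    ultimately show ?thesis by blast
  qed
  \<comment> \<open>A commutator with one entry in T is that entry times a conjugate of its inverse,
    so only finitely many occur.\<close>
  define F1 where "F1 = (\<Union>t\<in>T. (\<lambda>x. t + x) ` conj_class (- t))"
  have F1: "finite F1" unfolding F1_def using T fin by blast
  define F2 where "F2 = uminus ` F1"
  have F2: "finite F2" unfolding F2_def using F1 by simp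
  have inF1: "t + g - t - g \<in> F1" if "t \<in> T" for t g
  proof -
    have "t + g - t - g = t + conj_by (- g) (- t)"
      by (simp add: group_word_simps del: add_uminus_conv_diff)
    then show ?thesis unfolding F1_def using that by blast
  qed
  have inF2: "g + t - g - t \<in> F2" if "t \<in> T" for t g
    unfolding F2_def using inF1[OF that, of g]
    by (intro image_eqI[of _ _ "t + g - t - g"]) (simp_all add: group_word_simps del: add_uminus_conv_diff)
  show ?thesis
  proof (rule finite_subset)
    show "finite ((\<lambda>(t, t', f, f', k). t + (f + (t' + k - t')) - t + f') ` (T \<times> T \<times> F2 \<times> F1 \<times> ?K))"
      using T F1 F2 K by (intro finite_imageI finite_cartesian_product)
    show "{a + b - a - b | a b :: 'g. True}
        \<subseteq> (\<lambda>(t, t', f, f', k). t + (f + (t' + k - t')) - t + f') ` (T \<times> T \<times> F2 \<times> F1 \<times> ?K)"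
    proof clarify
      fix a b :: 'g
      obtain t h where a: "a = t + h" "t \<in> T" "h \<in> centralizer_of X" using decomp by blast
      obtain t' h' where b: "b = t' + h'" "t' \<in> T" "h' \<in> centralizer_of X" using decomp by blast
      \<comment> \<open>Multiplicatively, (th, b) = t (h, b) t^-1 (t, b) and (h, t'h') = (h, t') t'
        (h, h') t'^-1, for the convention (a, b) = a b a^-1 b^-1.\<close>
      have "a + b - a - b = t + ((h + t' - h - t') + (t' + (h + h' - h - h') - t')) - t + (t + b - t - b)"
        unfolding a b by (simp add: group_word_simps del: add_uminus_conv_diff)
      then show "a + b - a - b \<in> (\<lambda>(t, t', f, f', k). t + (f + (t' + k - t')) - t + f') ` (T \<times> T \<times> F2 \<times> F1 \<times> ?K)"
        using a b inF1[OF a(2), of b] inF2[OF b(2), of h]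
        by (intro image_eqI[of _ _ "(t, t', h + t' - h - t', t + b - t - b, h + h' - h - h')"]) auto
    qed
  qed
qed

subsection \<open>Binomial expansions in characteristic p\<close>

text \<open>Pascal's rule for the expansion of (f - g)^(m + 1), with T k l standing for g^k f^l
  applied to a fixed element.\<close>

lemma sum_atMost_pascal:
  fixes T :: "nat \<Rightarrow> nat \<Rightarrow> 'a::ring_1"
  shows "(\<Sum>k\<le>m. (-1)^k * of_nat (m choose k) * T k (Suc m - k))
       - (\<Sum>k\<le>m. (-1)^k * of_nat (m choose k) * T (Suc k) (m - k))
       = (\<Sum>k\<le>Suc m. (-1)^k * of_nat (Suc m choose k) * T k (Suc m - k))"
proof -
  have "(\<Sum>k\<le>Suc m. (-1)^k * of_nat (Suc m choose k) * T k (Suc m - k))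
      = T 0 (Suc m) + (\<Sum>k\<le>m. (-1)^Suc k * of_nat (Suc m choose Suc k) * T (Suc k) (m - k))"
    by (subst sum.atMost_Suc_shift) simp
  also have "\<dots> = T 0 (Suc m) + (\<Sum>k\<le>m. (-1)^Suc k * of_nat (m choose Suc k) * T (Suc k) (m - k))
       - (\<Sum>k\<le>m. (-1)^k * of_nat (m choose k) * T (Suc k) (m - k))"
    by (simp add: algebra_simps sum.distrib sum_negf sum_subtractf)
  also have "T 0 (Suc m) + (\<Sum>k\<le>m. (-1)^Suc k * of_nat (m choose Suc k) * T (Suc k) (m - k))
       = (\<Sum>k\<le>Suc m. (-1)^k * of_nat (m choose k) * T k (Suc m - k))"
    by (subst sum.atMost_Suc_shift) simp
  also have "\<dots> = (\<Sum>k\<le>m. (-1)^k * of_nat (m choose k) * T k (Suc m - k))"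
    by (simp add: binomial_eq_0)
  finally show ?thesis by simp
qed

text \<open>Stated for operators because left and right multiplication commute even when the ring
  does not; this covers both powers of x - 1 and iterated brackets with b.\<close>

locale commuting_additive =
  fixes f g :: "'a::ring_1 \<Rightarrow> 'a"
  assumes f_add: "f (x + y) = f x + f y" and g_add: "g (x + y) = g x + g y"
    and commute: "f (g x) = g (f x)"
begin

lemma additive_coeff:
  assumes add: "\<And>x y :: 'a. h (x + y) = h x + (h y :: 'a)"
  shows "h ((-1)^k * of_nat n * x) = (-1)^k * of_nat n * h x"
proof -
  have 0: "h 0 = 0" using add[of 0 0] by simp
  have neg: "h (- x) = - h x" for x using add[of x "- x"] 0 by (simp add: eq_neg_iff_add_eq_0 add.commute)
  have nat: "h (of_nat n * x) = of_nat n * h x" for x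
    by (induct n) (simp_all add: 0 add distrib_right)
  have "h ((-1)^k * x) = (-1)^k * h x" for x
    by (induct k) (simp_all add: neg)
  then show ?thesis by (simp add: mult.assoc nat)
qed

lemma f_sum: "finite A \<Longrightarrow> f (\<Sum>k\<in>A. u k) = (\<Sum>k\<in>A. f (u k))"
  by (induct rule: finite_induct) (use f_add[of 0 0] f_add in simp_all)

lemma g_sum: "finite A \<Longrightarrow> g (\<Sum>k\<in>A. u k) = (\<Sum>k\<in>A. g (u k))"
  by (induct rule: finite_induct) (use g_add[of 0 0] g_add in simp_all)

lemma f_funpow_g: "f ((g ^^ k) x) = (g ^^ k) (f x)"
  by (induct k) (simp_all add: commute)

lemma diff_funpow:
  "((\<lambda>y. f y - g y) ^^ m) a
    = (\<Sum>k\<le>m. (-1)^k * of_nat (m choose k) * (g ^^ k) ((f ^^ (m - k)) a))"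
proof (induct m)
  case (Suc m)
  let ?T = "\<lambda>k l. (g ^^ k) ((f ^^ l) a)"
  have "((\<lambda>y. f y - g y) ^^ Suc m) a
      = f (\<Sum>k\<le>m. (-1)^k * of_nat (m choose k) * ?T k (m - k))
        - g (\<Sum>k\<le>m. (-1)^k * of_nat (m choose k) * ?T k (m - k))"
    using Suc by simp
  also have "\<dots> = (\<Sum>k\<le>m. (-1)^k * of_nat (m choose k) * ?T k (Suc m - k))
       - (\<Sum>k\<le>m. (-1)^k * of_nat (m choose k) * ?T (Suc k) (m - k))"
    by (simp add: f_sum g_sum additive_coeff[of f, OF f_add] additive_coeff[of g, OF g_add]
        f_funpow_g Suc_diff_le)
  finally show ?case using sum_atMost_pascal[of m ?T] by simp
qed simp

lemma diff_funpow_prime: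
  assumes p: "prime p" "odd p" "of_nat p = (0 :: 'a)"
  shows "((\<lambda>y. f y - g y) ^^ p) a = (f ^^ p) a - (g ^^ p) a"
proof -
  have zero: "(-1)^k * of_nat (p choose k) * (g ^^ k) ((f ^^ (p - k)) a) = 0" if "0 < k" "k < p" for k
  proof -
    have "p dvd (p choose k)" using p(1) that by (intro dvd_choose_prime) auto
    then show ?thesis using p(3) by (auto elim!: dvdE)
  qed
  have "((\<lambda>y. f y - g y) ^^ p) a
      = (\<Sum>k\<in>{0, p}. (-1)^k * of_nat (p choose k) * (g ^^ k) ((f ^^ (p - k)) a))"
    unfolding diff_funpow by (rule sum.mono_neutral_right) (use zero in \<open>auto simp: le_less\<close>)
  moreover have "p > 0" using p(1) by (rule prime_gt_0_nat)
  ultimately show ?thesis using p(2) by simp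
qed

end

lemma commuting_additive_funpow:
  assumes "commuting_additive f g"
  shows "commuting_additive (f ^^ n) (g ^^ n)"
proof -
  interpret commuting_additive f g by fact
  have fn: "(f ^^ n) (x + y) = (f ^^ n) x + (f ^^ n) y" for n x y
    by (induct n) (simp_all add: f_add)
  have gn: "(g ^^ n) (x + y) = (g ^^ n) x + (g ^^ n) y" for n x y
    by (induct n) (simp_all add: g_add)
  have "(f ^^ m) ((g ^^ n) x) = (g ^^ n) ((f ^^ m) x)" for m n x
    by (induct m) (simp_all add: f_funpow_g)
  then show ?thesis by unfold_locales (auto simp: fn gn)
qed

lemma diff_funpow_prime_power:
  fixes f g :: "'a::ring_1 \<Rightarrow> 'a"
  assumes fg: "commuting_additive f g" and p: "prime p" "odd p" "of_nat p = (0 :: 'a)"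
  shows "((\<lambda>y. f y - g y) ^^ (p ^ k)) a = (f ^^ (p ^ k)) a - (g ^^ (p ^ k)) a"
proof (induct k arbitrary: a)
  case (Suc k)
  interpret commuting_additive "f ^^ (p ^ k)" "g ^^ (p ^ k)"
    by (rule commuting_additive_funpow[OF fg])
  have "((\<lambda>y. f y - g y) ^^ (p ^ Suc k)) a = (((\<lambda>y. f y - g y) ^^ (p ^ k)) ^^ p) a"
    by (simp add: funpow_mult mult.commute)
  also have "((\<lambda>y. f y - g y) ^^ (p ^ k)) = (\<lambda>y. (f ^^ (p ^ k)) y - (g ^^ (p ^ k)) y)"
    using Suc by auto
  finally show ?case
    using diff_funpow_prime[of p a] p by (simp add: funpow_mult mult.commute)
qed simp

lemma diff_one_power_prime_power:
  fixes x :: "'a::ring_1"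
  assumes p: "prime p" "odd p" "of_nat p = (0 :: 'a)"
  shows "(x - 1) ^ (p ^ k) = x ^ (p ^ k) - 1"
proof -
  have ca: "commuting_additive (\<lambda>y. x * y) (\<lambda>y. y)"
    by unfold_locales (simp_all add: distrib_left)
  have 1: "((\<lambda>y. x * y) ^^ n) 1 = x ^ n" for n by (induct n) simp_all
  have 2: "((\<lambda>y. x * y - y) ^^ n) 1 = (x - 1) ^ n" for n by (induct n) (simp_all add: left_diff_distrib)
  have 3: "((\<lambda>y :: 'a. y) ^^ n) 1 = 1" for n by (induct n) simp_all
  from diff_funpow_prime_power[of "\<lambda>y. x * y" "\<lambda>y. y" p k 1] ca p show ?thesis
    by (simp only: 1 2 3 simp_thms)
qed

lemma iterated_lie_prime_power:
  fixes b :: "'a::ring_1"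
  assumes p: "prime p" "odd p" "of_nat p = (0 :: 'a)"
  shows "((\<lambda>y. lie y b) ^^ (p ^ k)) y = lie y (b ^ (p ^ k))"
proof -
  have ca: "commuting_additive (\<lambda>y. y * b) (\<lambda>y. b * y)"
    by unfold_locales (simp_all add: distrib_left distrib_right mult.assoc)
  have 1: "((\<lambda>y. y * b) ^^ n) y = y * b ^ n" for n by (induct n) (simp_all add: mult.assoc power_commutes)
  have 2: "((\<lambda>y. b * y) ^^ n) y = b ^ n * y" for n by (induct n) (simp_all add: mult.assoc)
  from diff_funpow_prime_power[of "\<lambda>y. y * b" "\<lambda>y. b * y" p k y] ca p show ?thesis
    by (simp only: 1 2 simp_thms)
qed

subsection \<open>Dietzmann's lemma\<close>

text \<open>Moving k to the front conjugates the entries it passes. They stay in K, and the number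
  of entries is unchanged.\<close>

lemma sum_list_extract:
  fixes k :: "'g::group_add"
  assumes K: "\<And>x g. x \<in> K \<Longrightarrow> conj_by g x \<in> K" and xs: "set xs \<subseteq> K" and e: "e \<le> count_list xs k"
  shows "\<exists>ys. set ys \<subseteq> K \<and> length ys + e = length xs \<and> sum_list xs = nmul e k + sum_list ys"
  using xs e
proof (induct e arbitrary: xs)
  case (Suc e)
  then have "k \<in> set xs" by (metis count_notin le_zero_eq nat.distinct(2))
  then obtain us vs where xs: "xs = us @ k # vs" "k \<notin> set us" by (meson split_list_first)
  have "sum_list us + k = k + sum_list (map (conj_by k) us)"
  proof (induct us)
    case (Cons a us)
    have "sum_list (a # us) + k = a + (sum_list us + k)" by (simp add: add.assoc)
    also have "\<dots> = k + (conj_by k a + sum_list (map (conj_by k) us))"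
      unfolding Cons by (simp add: group_word_simps del: add_uminus_conv_diff)
    finally show ?case by simp
  qed simp
  moreover have "e \<le> count_list (map (conj_by k) us @ vs) k" using Suc(3) xs by simp
  moreover have "set (map (conj_by k) us @ vs) \<subseteq> K" using Suc(2) K xs by auto
  ultimately obtain ys where "set ys \<subseteq> K" "length ys + e = length (map (conj_by k) us @ vs)"
    "sum_list (map (conj_by k) us @ vs) = nmul e k + sum_list ys"
    using Suc(1) by blast
  moreover have "sum_list xs = k + sum_list (map (conj_by k) us @ vs)"
    using \<open>sum_list us + k = _\<close> by (simp add: xs) (metis add.assoc)
  ultimately show ?case by (intro exI[of _ ys]) (auto simp: xs add.assoc)
qed auto

text \<open>In a word of more than \<open>card K * e\<close> letters some letter occurs e times.
  Collected at the front, these occurrences cancel, so words of bounded length suffice.\<close>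

lemma finite_sum_lists:
  fixes K :: "'g::group_add set"
  assumes fin: "finite K" and K: "\<And>x g. x \<in> K \<Longrightarrow> conj_by g x \<in> K"
    and e: "e > 0" "\<And>x. x \<in> K \<Longrightarrow> nmul e x = 0"
  shows "finite (sum_list ` lists K)"
proof (rule finite_subset)
  let ?B = "{xs. set xs \<subseteq> K \<and> length xs \<le> card K * e}"
  show "finite (sum_list ` ?B)" using fin by (simp add: finite_lists_length_le)
  have "sum_list xs \<in> sum_list ` ?B" if "set xs \<subseteq> K" for xs
    using that
  proof (induct "length xs" arbitrary: xs rule: less_induct)
    case less
    show ?case
    proof (cases "length xs \<le> card K * e")
      case False
      have "\<exists>k\<in>K. e \<le> count_list xs k"
      proof (rule ccontr)
        assume "\<not> (\<exists>k\<in>K. e \<le> count_list xs k)"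
        then have "sum (count_list xs) K \<le> card K * e"
          by (intro sum_bounded_above[where K=e, simplified]) auto
        then show False using False sum_count_set[OF less(2) fin] by simp
      qed
      then obtain k where k: "k \<in> K" "e \<le> count_list xs k" by blast
      obtain ys where ys: "set ys \<subseteq> K" "length ys + e = length xs" "sum_list xs = nmul e k + sum_list ys"
        using sum_list_extract[OF K less(2) k(2)] by blast
      then show ?thesis using less(1)[of ys] e k(1) by simp
    qed (use less in auto)
  qed
  then show "sum_list ` lists K \<subseteq> sum_list ` ?B" by (auto simp: lists_eq_set)
qed

subsection \<open>Structure of the group\<close>

text \<open>The parameter \<open>ty\<close> only fixes the types of \<open>G\<close> and \<open>F\<close>.\<close>

locale lie_nilpotent_algebra =
  fixes p :: nat and ty :: "('g::group_add \<Rightarrow>\<^sub>0 'f::field) itself"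
  assumes char_p: "CHAR('f) = p" and odd_p: "odd p"
    and nilpotent: "lie_nilpotent (UNIV :: ('g \<Rightarrow>\<^sub>0 'f) set)"
begin

lemma prime_p: "prime p"
proof -
  have "CHAR('f) > 0" using char_p odd_p by (metis even_zero gr0I)
  then show ?thesis using prime_CHAR_semidom char_p by metis
qed

lemma p_ge_3: "p \<ge> 3"
  using prime_p odd_p prime_ge_2_nat[of p] by (cases "p = 2") auto

lemma p_pos [simp]: "p > 0"
  using p_ge_3 by simp

lemma of_nat_p: "of_nat p = (0 :: 'g \<Rightarrow>\<^sub>0 'f)"
proof -
  have "of_nat p = (0 :: 'f)" using char_p of_nat_CHAR by metis
  then show ?thesis by (metis single_of_nat single_zero)
qed

lemmas char_facts = prime_p odd_p of_nat_p

lemma gel_diff_one_power: "(gel g - 1 :: 'g \<Rightarrow>\<^sub>0 'f) ^ (p ^ k) = gel (nmul (p ^ k) g) - 1"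
  using diff_one_power_prime_power[OF char_facts, of "gel g" k] by (simp only: gel_power)

text \<open>The g with g - 1 in an ideal form a subgroup, and a + b - a - b belongs to it because (b
  + a) is a unit and the bracket of a and b lies in the radical.\<close>

lemma G'_nil_radical: "(g :: 'g) \<in> G' \<Longrightarrow> gel g - 1 \<in> (nil_radical :: ('g \<Rightarrow>\<^sub>0 'f) set)"
proof -
  note N = nil_radical_ideal
  define H where "H = {g :: 'g. gel g - 1 \<in> (nil_radical :: ('g \<Rightarrow>\<^sub>0 'f) set)}"
  have "G' \<subseteq> H"
  proof (rule G'_subset)
    have add: "gel (x + y) - 1 = gel x * (gel y - 1) + (gel x - 1 :: 'g \<Rightarrow>\<^sub>0 'f)" for x y :: 'g
      by (simp add: right_diff_distrib gel_mult)
    have minus: "gel (- x) - 1 = - (gel (- x) * (gel x - 1 :: 'g \<Rightarrow>\<^sub>0 'f))" for x :: 'g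
      by (simp add: right_diff_distrib gel_mult)
    have "0 \<in> H" using ideal_0[OF N] by (simp add: H_def)
    moreover have "x + y \<in> H" if "x \<in> H" "y \<in> H" for x y
      using that unfolding H_def mem_Collect_eq add by (intro ideal_add[OF N] ideal_mult_left[OF N])
    moreover have "- x \<in> H" if "x \<in> H" for x
      using that unfolding H_def mem_Collect_eq
      by (subst minus) (intro ideal_uminus[OF N] ideal_mult_left[OF N])
    ultimately show "subgrp H" unfolding subgrp_def by blast
  next
    fix a b :: 'g
    have "lie (gel a) (gel b) * gel (- a - b) \<in> (nil_radical :: ('g \<Rightarrow>\<^sub>0 'f) set)"
      by (intro ideal_mult_right[OF N] lie_in_nil_radical nilpotent)
    moreover have "lie (gel a) (gel b) * gel (- a - b) = (gel (a + b - a - b) - 1 :: 'g \<Rightarrow>\<^sub>0 'f)"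
    proof -
      have "a + b + (- a - b) = a + b - a - b" "b + a + (- a - b) = 0"
        by (simp_all add: group_word_simps del: add_uminus_conv_diff)
      then show ?thesis by (simp only: left_diff_distrib gel_mult gel_0)
    qed
    ultimately show "a + b - a - b \<in> H" by (simp add: H_def)
  qed
  then show "g \<in> G' \<Longrightarrow> gel g - 1 \<in> (nil_radical :: ('g \<Rightarrow>\<^sub>0 'f) set)" by (auto simp: H_def)
qed

text \<open>g - 1 is nilpotent, and its p^k-th power is g^(p^k) - 1.\<close>

lemma G'_torsion:
  assumes "(g :: 'g) \<in> G'" shows "\<exists>k. nmul (p ^ k) g = 0"
proof -
  obtain k where k: "(gel g - 1 :: 'g \<Rightarrow>\<^sub>0 'f) ^ k = 0"
    using nil_radical_nilpotent[OF G'_nil_radical[OF assms]] by blast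
  have "k \<le> p ^ k" using p_ge_3 by (intro less_imp_le power_gt_expt) simp
  then have "(gel g - 1 :: 'g \<Rightarrow>\<^sub>0 'f) ^ (p ^ k) = 0"
    using k by (metis le_add_diff_inverse mult_zero_left power_add)
  then have "gel (nmul (p ^ k) g) = (gel 0 :: 'g \<Rightarrow>\<^sub>0 'f)" by (simp add: gel_diff_one_power)
  then show ?thesis by (metis gel_eq_iff)
qed

text \<open>Dietzmann's lemma for the set K of commutators: it is finite, closed under conjugation
  and inverses, and the product of the orders of powers of p attached to its elements is a common
  exponent.\<close>

lemma finite_G': "finite (G' :: 'g set)"
proof -
  define K where "K = {a + b - a - b | a b :: 'g. True}"
  have K: "finite K" unfolding K_def by (rule finite_commutators[OF nilpotent])
  have "\<forall>x\<in>K. \<exists>k. nmul (p ^ k) x = 0"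
    using G'_torsion commutator_in_G' unfolding K_def by blast
  then obtain k where k: "\<And>x. x \<in> K \<Longrightarrow> nmul (p ^ k x) x = 0" by metis
  define e where "e = (\<Prod>x\<in>K. p ^ k x)"
  have "e > 0" unfolding e_def by (intro prod_pos) simp
  moreover have "nmul e x = 0" if "x \<in> K" for x
  proof -
    have "p ^ k x dvd e" unfolding e_def using K that by (rule dvd_prodI)
    then obtain d where "e = d * p ^ k x" by (metis dvdE mult.commute)
    then show ?thesis using k[OF that] by (simp add: nmul_mult)
  qed
  moreover have "conj_by g x \<in> K" if "x \<in> K" for x g
  proof -
    from that obtain a b where "x = a + b - a - b" unfolding K_def by blast
    then have "conj_by g x = conj_by g a + conj_by g b - conj_by g a - conj_by g b"
      by (simp add: group_word_simps del: add_uminus_conv_diff)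
    then show ?thesis unfolding K_def by blast
  qed
  ultimately have fin: "finite (sum_list ` lists K)" using finite_sum_lists[OF K] by blast
  have "G' \<subseteq> sum_list ` lists K"
  proof (rule G'_subset)
    have minus: "- sum_list xs \<in> sum_list ` lists K" if "xs \<in> lists K" for xs
      using that
    proof induct
      case Nil
      show ?case by (rule image_eqI[of _ _ "[]"]) auto
    next
      case (Cons x xs)
      then obtain ys where ys: "ys \<in> lists K" "- sum_list xs = sum_list ys" by auto
      obtain a b where "x = a + b - a - b" using Cons unfolding K_def by blast
      then have "- x = b + a - b - a" by (simp add: group_word_simps del: add_uminus_conv_diff)
      then have "- x \<in> K" unfolding K_def by blast
      then show ?case using ys
        by (intro image_eqI[of _ _ "ys @ [- x]"]) (auto simp: minus_add simp flip: ys(2))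
    qed
    show "subgrp (sum_list ` lists K)"
      unfolding subgrp_def
    proof (intro conjI ballI)
      show "0 \<in> sum_list ` lists K" by (rule image_eqI[of _ _ "[]"]) auto
    next
      fix x y assume "x \<in> sum_list ` lists K" "y \<in> sum_list ` lists K"
      then obtain xs ys where "x = sum_list xs" "y = sum_list ys" "xs \<in> lists K" "ys \<in> lists K" by blast
      then show "x + y \<in> sum_list ` lists K" by (intro image_eqI[of _ _ "xs @ ys"]) auto
    qed (use minus in auto)
    show "a + b - a - b \<in> sum_list ` lists K" for a b
      by (rule image_eqI[of _ _ "[a + b - a - b]"]) (auto simp: K_def)
  qed
  then show ?thesis using fin finite_subset by blast
qed

lemma prime_power_central: "\<exists>k. \<forall>g h :: 'g. nmul (p ^ k) g + h = h + nmul (p ^ k) g"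
proof -
  obtain n where n: "n \<ge> 1" "lie_gamma n (UNIV :: ('g \<Rightarrow>\<^sub>0 'f) set) = {0}"
    using nilpotent unfolding lie_nilpotent_def by blast
  have "n \<le> p ^ n" using p_ge_3 by (intro less_imp_le power_gt_expt) simp
  then have zero: "lie_gamma (Suc (p ^ n)) (UNIV :: ('g \<Rightarrow>\<^sub>0 'f) set) = {0}"
    using lie_gamma_trivial_mono[of "n - 1" "UNIV :: ('g \<Rightarrow>\<^sub>0 'f) set" "p ^ n"] n by simp
  have "nmul (p ^ n) g + h = h + nmul (p ^ n) g" for g h :: 'g
  proof -
    \<comment> \<open>The p^n-fold bracket with g lies in a vanishing term of the series, and it
      equals the single bracket with g^(p^n).\<close>
    have "((\<lambda>y. lie y (gel g)) ^^ m) (gel h) \<in> lie_gamma (Suc m) (UNIV :: ('g \<Rightarrow>\<^sub>0 'f) set)" for m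
      by (induct m) (auto intro: lie_gamma_generator simp del: lie_gamma.simps(3))
    then have "((\<lambda>y. lie y (gel g)) ^^ (p ^ n)) (gel h) = (0 :: 'g \<Rightarrow>\<^sub>0 'f)" using zero by blast
    then have "gel h * gel g ^ (p ^ n) = (gel g ^ (p ^ n) * gel h :: 'g \<Rightarrow>\<^sub>0 'f)"
      by (simp add: iterated_lie_prime_power[OF char_facts])
    then have "gel (nmul (p ^ n) g + h) = (gel (h + nmul (p ^ n) g) :: 'g \<Rightarrow>\<^sub>0 'f)"
      by (simp only: gel_power gel_mult)
    then show ?thesis by (simp only: gel_eq_iff)
  qed
  then show ?thesis by blast
qed

end

subsection \<open>Fixed points of p-groups\<close>

text \<open>Another prime r dividing the order would give, by Sylow, a subgroup of order r; its
  elements have order dividing both r and a power of p.\<close>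

lemma order_prime_power:
  fixes G (structure)
  assumes G: "group G" and fin: "finite (carrier G)" and p: "prime (p :: nat)"
    and pow: "\<And>x. x \<in> carrier G \<Longrightarrow> \<exists>k. x [^] (p ^ k) = \<one>"
  shows "\<exists>a. order G = p ^ a"
proof -
  interpret group G by fact
  have "order G > 0" using fin by (simp add: order_gt_0_iff_finite)
  then obtain m where m: "order G = p ^ multiplicity p (order G) * m" "\<not> p dvd m"
    using p multiplicity_decompose'[of "order G" p] by (metis not_prime_unit not_gr_zero)
  have "m = 1"
  proof (rule ccontr)
    assume "m \<noteq> 1"
    then obtain r where r: "prime r" "r dvd m" using prime_factor_nat by blast
    then have "r \<noteq> p" using m(2) by auto
    obtain m' where "order G = r ^ 1 * m'" using m(1) r(2) by (metis dvd_def dvd_mult power_one_right)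
    then obtain H where H: "subgroup H G" "card H = r"
      using sylow_thm[OF r(1) G _ fin, of 1 m'] by auto
    have "H \<noteq> {\<one>}" using H(2) prime_gt_1_nat[OF r(1)] by auto
    then obtain h where h: "h \<in> H" "h \<noteq> \<one>" using subgroup.one_closed[OF H(1)] by blast
    then have hG: "h \<in> carrier G" using subgroup.mem_carrier[OF H(1)] by blast
    interpret HG: group "G\<lparr>carrier := H\<rparr>" using subgroup.subgroup_is_group[OF H(1) G] .
    have "h [^]\<^bsub>G\<lparr>carrier := H\<rparr>\<^esub> order (G\<lparr>carrier := H\<rparr>) = \<one>\<^bsub>G\<lparr>carrier := H\<rparr>\<^esub>"
      using h H fin by (intro HG.pow_order_eq_1) (auto simp: order_def)
    then have "h [^] r = \<one>"
      by (simp add: order_def H(2) nat_pow_consistent[symmetric])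
    then have "ord h dvd r" using pow_eq_id[OF hG] by blast
    obtain k where "h [^] (p ^ k) = \<one>" using pow[OF hG] by blast
    then have "ord h dvd p ^ k" using pow_eq_id[OF hG] by blast
    have "coprime r (p ^ k)" using \<open>r \<noteq> p\<close> r(1) p by (simp add: primes_coprime)
    then have "ord h = 1" using \<open>ord h dvd r\<close> \<open>ord h dvd p ^ k\<close>
      by (rule coprime_common_divisor_nat)
    then have "h = \<one>" using pow_ord_eq_1[OF hG] hG by simp
    then show False using h by blast
  qed
  then show ?thesis using m by auto
qed

text \<open>G may be infinite, so orbits are counted for its image in the bijections of E, a finite
  group of p-power order. Orbits other than fixed points have size divisible by p; a unique fixed
  point would make \<open>card E\<close> congruent to 1.\<close>

lemma second_fixed_point:
  fixes G (structure)
  assumes act: "group_action G E \<phi>" and fin: "finite E" and p: "prime (p :: nat)"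
    and pow: "\<And>g. g \<in> carrier G \<Longrightarrow> \<exists>k. \<phi> (g [^] (p ^ k)) = \<phi> \<one>"
    and dvd: "p dvd card E" and e: "e \<in> E" "\<And>g. g \<in> carrier G \<Longrightarrow> \<phi> g e = e"
  shows "\<exists>e'\<in>E. e' \<noteq> e \<and> (\<forall>g\<in>carrier G. \<phi> g e' = e')"
proof (rule ccontr)
  assume no: "\<not> ?thesis"
  interpret act: group_action G E \<phi> by fact
  interpret hom: group_hom G "BijGroup E" \<phi> by (rule act.group_hom)
  define \<Gamma> where "\<Gamma> = \<phi> ` carrier G"
  define H where "H = (BijGroup E)\<lparr>carrier := \<Gamma>\<rparr>"
  have sub: "subgroup \<Gamma> (BijGroup E)" unfolding \<Gamma>_def by (rule hom.img_is_subgroup)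
  then have H: "group H" unfolding H_def by (rule subgroup.subgroup_is_group) (rule group_BijGroup)
  have "carrier (BijGroup E) \<subseteq> E \<rightarrow>\<^sub>E E"
    by (auto simp: BijGroup_def Bij_def bij_betw_def PiE_def Pi_def)
  then have finH: "finite (carrier H)"
    unfolding H_def using subgroup.subset[OF sub] fin by (simp, meson finite_PiE finite_subset)
  have "\<exists>a. order H = p ^ a"
  proof (rule order_prime_power[OF H finH p])
    fix x assume "x \<in> carrier H"
    then obtain g where g: "g \<in> carrier G" "x = \<phi> g" unfolding H_def \<Gamma>_def by auto
    obtain k where "\<phi> (g [^] (p ^ k)) = \<phi> \<one>" using pow[OF g(1)] by blast
    then have "x [^]\<^bsub>BijGroup E\<^esub> (p ^ k) = \<one>\<^bsub>BijGroup E\<^esub>" using g by (simp add: hom.hom_nat_pow)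
    moreover have "x [^]\<^bsub>BijGroup E\<^esub> (p ^ k) = x [^]\<^bsub>H\<^esub> (p ^ k)"
      unfolding H_def by (rule monoid.nat_pow_consistent[OF group.is_monoid[OF group_BijGroup]])
    ultimately show "\<exists>k. x [^]\<^bsub>H\<^esub> (p ^ k) = \<one>\<^bsub>H\<^esub>" by (intro exI[of _ k]) (simp add: H_def)
  qed
  then obtain a where a: "order H = p ^ a" by blast
  have "group_hom H (BijGroup E) id"
    unfolding H_def by (rule group.canonical_inj_is_hom[OF group_BijGroup sub])
  then interpret HE: group_action H E id by (rule group_action.intro)
  have e_orbit: "orbit H id e = {e}"
    using e(2) HE.orbit_refl[OF e(1)] by (auto simp: orbit_def H_def \<Gamma>_def)
  have orbit_card: "p dvd card (orbit H id x)" if x: "x \<in> E" "x \<noteq> e" for x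
  proof -
    have "card (orbit H id x) dvd p ^ a"
      using HE.orbit_stabilizer_theorem[OF x(1)] a by (metis dvd_triv_left)
    moreover have "card (orbit H id x) \<noteq> 1"
    proof
      assume "card (orbit H id x) = 1"
      then obtain y where "orbit H id x = {y}" by (meson card_1_singletonE)
      then have "orbit H id x = {x}" using HE.orbit_refl[OF x(1)] by simp
      then have "\<phi> g x = x" if "g \<in> carrier G" for g
        using that by (auto simp: orbit_def H_def \<Gamma>_def)
      then show False using no x by blast
    qed
    ultimately show ?thesis using p by (metis divides_primepow_nat dvd_power gr0I power_0)
  qed
  have fin_orbits: "finite (orbits H E id)" unfolding orbits_def using fin by simp
  have e_in: "{e} \<in> orbits H E id" unfolding orbits_def using e(1) e_orbit by blast
  have "card E = (\<Sum>orb\<in>orbits H E id. card orb)"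
    using HE.disjoint_sum[OF fin, of "\<lambda>_. 1 :: nat"] by simp
  also have "\<dots> = 1 + (\<Sum>orb\<in>orbits H E id - {{e}}. card orb)"
    using fin_orbits e_in by (simp add: sum.remove)
  finally have "card E = 1 + (\<Sum>orb\<in>orbits H E id - {{e}}. card orb)" .
  moreover have "p dvd (\<Sum>orb\<in>orbits H E id - {{e}}. card orb)"
  proof (rule dvd_sum)
    fix orb assume "orb \<in> orbits H E id - {{e}}"
    then obtain x where "x \<in> E" "orb = orbit H id x" "x \<noteq> e" unfolding orbits_def using e_orbit by blast
    then show "p dvd card orb" using orbit_card by blast
  qed
  ultimately have "p dvd 1" using dvd by (metis dvd_add_left_iff)
  then show False using p not_prime_unit by blast
qed

definition normal_subgrp :: "'g::group_add set \<Rightarrow> bool" where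
  "normal_subgrp M \<longleftrightarrow> subgrp M \<and> (\<forall>x\<in>M. \<forall>g. conj_by g x \<in> M)"

lemma normal_conj: "normal_subgrp M \<Longrightarrow> x \<in> M \<Longrightarrow> conj_by g x \<in> M"
  by (simp add: normal_subgrp_def)

lemma normal_conj': "normal_subgrp M \<Longrightarrow> x \<in> M \<Longrightarrow> g + x - g \<in> M"
  using normal_conj[of M x "- g"] by simp

lemma gcomm_add_left: "gcomm (c + d) g = conj_by d (gcomm c g) + gcomm d g"
  by (simp add: gcomm_def group_word_simps del: add_uminus_conv_diff)

section \<open>Elements central modulo a normal subgroup\<close>

context lie_nilpotent_algebra
begin

lemma group_G': "group (group_of_type\<lparr>carrier := G'\<rparr> :: 'g monoid)"
  using subgroup.subgroup_is_group[of G' group_of_type] subgrp_G' got.is_group by (simp add: subgrp_iff)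

lemma pow_G': "x [^]\<^bsub>group_of_type\<lparr>carrier := G'\<rparr>\<^esub> n = nmul n x" for x :: 'g and n :: nat
  using got.nat_pow_consistent[of x n G'] by (simp add: pow_group_of_type)

lemma card_G': "\<exists>a. card (G' :: 'g set) = p ^ a"
proof -
  have "\<exists>a. order (group_of_type\<lparr>carrier := G'\<rparr> :: 'g monoid) = p ^ a"
    by (rule order_prime_power[OF group_G' _ prime_p])
       (use finite_G' G'_torsion in \<open>auto simp: pow_G'\<close>)
  then show ?thesis by (simp add: order_def)
qed

text \<open>G acts by conjugation on the cosets of M in G', whose number is a power of p greater
  than 1. Some p^k-th power of every element is central and acts trivially, and M is fixed. A second
  fixed coset M + x yields c = x.\<close>

lemma central_coset:
  fixes M :: "'g set"
  assumes M: "normal_subgrp M" "M \<subseteq> G'" "M \<noteq> G'"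
  shows "\<exists>c\<in>G'. c \<notin> M \<and> (\<forall>g. gcomm c g \<in> M)"
proof -
  have sM: "subgrp M" using M(1) by (simp add: normal_subgrp_def)
  let ?K = "group_of_type\<lparr>carrier := G'\<rparr> :: 'g monoid"
  have sub: "subgroup M ?K"
  proof (rule group.subgroupI[OF group_G'])
    fix x assume "x \<in> M"
    moreover from this have "x \<in> G'" using M(2) by blast
    then have "inv\<^bsub>?K\<^esub> x = - x"
      using group.m_inv_consistent[OF got.is_group subgrp_G'[unfolded subgrp_iff]] inv_group_of_type by metis
    ultimately show "inv\<^bsub>?K\<^esub> x \<in> M"
      using subgrp_minus[OF sM] by metis
  qed (use M(2) subgrp_0[OF sM] subgrp_add[OF sM] in auto)
  define E where "E = (\<lambda>x. (\<lambda>m. m + x) ` M) ` (G' :: 'g set)"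
  have E: "E = rcosets\<^bsub>?K\<^esub> M"
    unfolding E_def RCOSETS_def r_coset_def by auto
  have finE: "finite E" unfolding E_def using finite_G' by simp
  have finM: "finite M" using M(2) finite_G' finite_subset by blast
  have lag: "card E * card M = card (G' :: 'g set)"
    using group.lagrange[OF group_G' sub] by (simp add: E order_def)
  have "card E \<noteq> 1"
  proof
    assume "card E = 1"
    then have "card M = card (G' :: 'g set)" using lag by simp
    then show False using M finite_G' card_subset_eq by blast
  qed
  moreover obtain a where "card (G' :: 'g set) = p ^ a" using card_G' by blast
  ultimately have dvd: "p dvd card E"
    using lag prime_p by (metis divides_primepow_nat dvd_power dvd_triv_left gr0I power_0)
  define \<phi> where "\<phi> g = (\<lambda>S\<in>E. (\<lambda>s. g + s - g) ` S)" for g :: 'g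
  have coset_image: "(\<lambda>s. g + s - g) ` ((\<lambda>m. m + x) ` M) = (\<lambda>m. m + (g + x - g)) ` M" for g x
  proof (intro equalityI subsetI; clarify)
    fix m assume m: "m \<in> M"
    have "g + (m + x) - g = (g + m - g) + (g + x - g)"
      by (simp add: group_word_simps del: add_uminus_conv_diff)
    then show "g + (m + x) - g \<in> (\<lambda>m. m + (g + x - g)) ` M"
      using normal_conj'[OF M(1) m] by (metis image_eqI)
    have "m + (g + x - g) = g + (conj_by g m + x) - g"
      by (simp add: group_word_simps del: add_uminus_conv_diff)
    then show "m + (g + x - g) \<in> (\<lambda>s. g + s - g) ` (\<lambda>m. m + x) ` M"
      using normal_conj[OF M(1) m, of g] by blast
  qed
  have mem: "\<phi> g S \<in> E" if S: "S \<in> E" for g S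
  proof -
    obtain x where x: "x \<in> G'" "S = (\<lambda>m. m + x) ` M" using S unfolding E_def by blast
    have "g + x - g \<in> G'" using G'_conj[OF x(1), of "- g"] by simp
    then show ?thesis using S unfolding \<phi>_def by (simp add: x(2) coset_image) (auto simp: E_def)
  qed
  have comp: "\<phi> (g + h) S = \<phi> g (\<phi> h S)" if S: "S \<in> E" for g h S
  proof -
    have "\<phi> h S \<in> E" by (rule mem[OF S])
    then show ?thesis using S unfolding \<phi>_def
      by (simp add: image_image group_word_simps del: add_uminus_conv_diff)
  qed
  have one: "\<phi> 0 S = S" if "S \<in> E" for S using that unfolding \<phi>_def by simp
  have bij: "\<phi> g \<in> Bij E" for g
  proof -
    have "bij_betw (\<phi> g) E E"
    proof (rule bij_betw_byWitness[of _ "\<phi> (- g)"])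
      show "\<forall>S\<in>E. \<phi> (- g) (\<phi> g S) = S" "\<forall>S\<in>E. \<phi> g (\<phi> (- g) S) = S"
        using comp[of _ "- g" g] comp[of _ g "- g"] one by auto
    qed (use mem in auto)
    then show ?thesis by (simp add: Bij_def \<phi>_def)
  qed
  have "\<phi> \<in> hom group_of_type (BijGroup E)"
  proof (rule homI)
    show "\<phi> g \<in> carrier (BijGroup E)" for g using bij by (simp add: BijGroup_def)
    show "\<phi> (g \<otimes>\<^bsub>group_of_type\<^esub> h) = \<phi> g \<otimes>\<^bsub>BijGroup E\<^esub> \<phi> h" for g h
      using bij comp by (intro ext) (simp add: BijGroup_def compose_def restrict_def \<phi>_def)
  qed
  then have act: "group_action group_of_type E \<phi>"
    unfolding group_action_def group_hom_def group_hom_axioms_def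
    using got.is_group group_BijGroup by blast
  have ME: "M \<in> E" unfolding E_def using subgrp_0[OF subgrp_G'] by (intro image_eqI[of _ _ 0]) auto
  have Mfix: "\<phi> g M = M" for g
    using ME coset_image[of g 0] unfolding \<phi>_def by simp
  obtain k where k: "\<And>g h :: 'g. nmul (p ^ k) g + h = h + nmul (p ^ k) g"
    using prime_power_central by blast
  have "\<phi> (g [^]\<^bsub>group_of_type\<^esub> (p ^ k)) = \<phi> \<one>\<^bsub>group_of_type\<^esub>" for g
  proof -
    have "nmul (p ^ k) g + s - nmul (p ^ k) g = s" for s by (simp add: k)
    then show ?thesis unfolding \<phi>_def by (simp add: pow_group_of_type)
  qed
  then obtain S where S: "S \<in> E" "S \<noteq> M" "\<And>g. \<phi> g S = S"
    using second_fixed_point[OF act finE prime_p _ dvd ME] Mfix by (metis UNIV_I group_of_type_simps(1))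
  then obtain x where x: "x \<in> G'" "S = (\<lambda>m. m + x) ` M" unfolding E_def by blast
  have "x \<notin> M"
  proof
    assume xM: "x \<in> M"
    have "(\<lambda>m. m + x) ` M = M"
    proof (intro equalityI subsetI)
      fix m assume "m \<in> M"
      then have "m - x \<in> M" "m = (m - x) + x" using xM sM by (auto intro: subgrp_diff)
      then show "m \<in> (\<lambda>m. m + x) ` M" by blast
    qed (use xM sM in \<open>auto intro: subgrp_add\<close>)
    then show False using S(2) x(2) by simp
  qed
  moreover have "gcomm x g \<in> M" for g
  proof -
    have "(\<lambda>m. m + (- g + x - - g)) ` M = (\<lambda>m. m + x) ` M"
      using S(3)[of "- g"] S(1) coset_image[of "- g" x] unfolding \<phi>_def x(2) by simp
    moreover have "0 + (- g + x - - g) \<in> (\<lambda>m. m + (- g + x - - g)) ` M" using subgrp_0[OF sM] by blast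
    ultimately obtain m where m: "m \<in> M" "- g + x + g = m + x" by auto
    have "gcomm x g = - x + (- g + x + g)" by (simp add: gcomm_def group_word_simps del: add_uminus_conv_diff)
    also have "\<dots> = conj_by x m" unfolding m(2) by (simp add: add.assoc)
    finally show ?thesis using normal_conj[OF M(1) m(1)] by simp
  qed
  ultimately show ?thesis using x(1) by blast
qed

text \<open>Among the p^l-th powers of an element central modulo M, the last one outside M has order
  p modulo M.\<close>

lemma central_element_mod:
  fixes M :: "'g set"
  assumes M: "normal_subgrp M" "M \<subseteq> G'" "M \<noteq> G'"
  obtains c where "c \<in> G'" "c \<notin> M" "\<And>g. gcomm c g \<in> M" "nmul p c \<in> M"
proof -
  have sM: "subgrp M" using M(1) by (simp add: normal_subgrp_def)
  obtain d where d: "d \<in> G'" "d \<notin> M" "\<And>g. gcomm d g \<in> M" using central_coset[OF M] by blast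
  obtain l where "nmul (p ^ l) d = 0" using G'_torsion[OF d(1)] by blast
  then have ex: "\<exists>l. nmul (p ^ l) d \<in> M" using subgrp_0[OF sM] by metis
  define l where "l = (LEAST l. nmul (p ^ l) d \<in> M)"
  have l: "nmul (p ^ l) d \<in> M" unfolding l_def using ex by (rule LeastI_ex)
  have "l \<noteq> 0" using l d(2) by (cases l) auto
  then obtain l' where l': "l = Suc l'" by (cases l) auto
  define c where "c = nmul (p ^ l') d"
  have "c \<notin> M" using not_less_Least[of l' "\<lambda>l. nmul (p ^ l) d \<in> M"] l' unfolding c_def l_def by simp
  moreover have "c \<in> G'" unfolding c_def by (rule subgrp_nmul[OF subgrp_G' d(1)])
  moreover have "gcomm (nmul n d) g \<in> M" for n g
  proof (induct n)
    case 0
    show ?case using subgrp_0[OF sM] by (simp add: gcomm_def)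
  next
    case (Suc n)
    show ?case unfolding nmul.simps gcomm_add_left
      by (rule subgrp_add[OF sM normal_conj[OF M(1) d(3)] Suc])
  qed
  moreover have "nmul p c \<in> M" using l unfolding c_def l' by (simp add: nmul_mult)
  ultimately show thesis using that unfolding c_def by blast
qed

end

lemma power_diff_one_factor: "x ^ t - 1 = (x - 1) * (\<Sum>j<t. x ^ j)" for x :: "'a::ring_1"
proof (induct t)
  case (Suc t)
  have "(x - 1) * (\<Sum>j<Suc t. x ^ j) = (x ^ t - 1) + (x - 1) * x ^ t"
    unfolding Suc by (simp add: distrib_left)
  then show ?case by (simp add: left_diff_distrib)
qed simp

lemma upper_lie_gain_factors:
  assumes I: "two_sided_ideal I" and C: "\<And>r. lie C r \<in> I"
    and w: "upper_lie w \<subseteq> {C ^ k * r + i | r i. i \<in> I}"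
    and v: "upper_lie v \<subseteq> {C * r + i | r i. i \<in> I}"
  shows "upper_lie (w + n * v) \<subseteq> {C ^ (k + n) * r + i | r i. i \<in> I}"
proof (induct n)
  case (Suc n)
  show ?case using upper_lie_gain_factor[OF I C Suc v] by (simp add: add.commute add.left_commute)
qed (use w in simp)

subsection \<open>Congruence modulo a normal subgroup\<close>

definition cong_mod :: "'g::group_add set \<Rightarrow> 'g \<Rightarrow> 'g \<Rightarrow> bool" where
  "cong_mod M g h \<longleftrightarrow> - g + h \<in> M"

lemma normal_subgrp: "normal_subgrp M \<Longrightarrow> subgrp M"
  by (simp add: normal_subgrp_def)

lemma cong_mod_refl: "normal_subgrp M \<Longrightarrow> cong_mod M g g"
  using subgrp_0[OF normal_subgrp] by (simp add: cong_mod_def)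

lemma cong_mod_0: "cong_mod M 0 g \<longleftrightarrow> g \<in> M"
  by (simp add: cong_mod_def)

lemma cong_mod_sym: "normal_subgrp M \<Longrightarrow> cong_mod M g h \<Longrightarrow> cong_mod M h g"
  using subgrp_minus[OF normal_subgrp, of M "- g + h"] by (simp add: cong_mod_def minus_add)

lemma cong_mod_trans:
  assumes "normal_subgrp M" "cong_mod M g h" "cong_mod M h k" shows "cong_mod M g k"
proof -
  have "- g + k = (- g + h) + (- h + k)" by (simp add: group_word_simps del: add_uminus_conv_diff)
  then show ?thesis using assms subgrp_add[OF normal_subgrp] unfolding cong_mod_def by metis
qed

lemma cong_mod_add:
  assumes M: "normal_subgrp M" and "cong_mod M g h" "cong_mod M g' h'"
  shows "cong_mod M (g + g') (h + h')"
proof -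
  have "- (g + g') + (h + h') = conj_by g' (- g + h) + (- g' + h')"
    by (simp add: group_word_simps del: add_uminus_conv_diff)
  then show ?thesis
    using assms subgrp_add[OF normal_subgrp[OF M]] normal_conj[OF M] unfolding cong_mod_def by metis
qed

lemma cong_mod_nmul:
  assumes M: "normal_subgrp M" and "cong_mod M g h" shows "cong_mod M (nmul n g) (nmul n h)"
  by (induct n) (simp_all add: cong_mod_refl[OF M] cong_mod_add[OF M assms(2)])

lemma cong_mod_mult_right: "m \<in> M \<Longrightarrow> cong_mod M g (g + m)"
  by (simp add: cong_mod_def)

lemma subgrp_coprime:
  assumes H: "subgrp H" and a: "nmul a x \<in> H" and b: "nmul b x \<in> H" and "coprime a b"
  shows "x \<in> H"
proof (cases "a = 0")
  case True
  then have "b = 1" using assms(4) by simp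
  then show ?thesis using b by simp
next
  case False
  obtain u v where uv: "a * u = b * v + 1" using bezout_nat[OF False, of b] assms(4) by auto
  have "nmul (u * a) x = nmul (v * b) x + x"
    using uv by (metis mult.commute nmul_1 nmul_add One_nat_def)
  then have "x = - nmul (v * b) x + nmul (u * a) x" by simp
  moreover have "nmul (u * a) x \<in> H" "nmul (v * b) x \<in> H"
    using subgrp_nmul[OF H a] subgrp_nmul[OF H b] by (simp_all add: nmul_mult)
  ultimately show ?thesis using subgrp_add[OF H] subgrp_minus[OF H] by metis
qed

subsection \<open>Ideals attached to normal subgroups\<close>

text \<open>For normal M this is the kernel of the map from FG to F(G/M); lying in it means
  vanishing over G/M.\<close>

definition aug_ideal :: "'g::group_add set \<Rightarrow> ('g \<Rightarrow>\<^sub>0 'f::field) set" where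
  "aug_ideal M = ideal_gen {gel m - 1 | m. m \<in> M}"

lemma aug_ideal: "two_sided_ideal (aug_ideal M)"
  unfolding aug_ideal_def by (rule two_sided_ideal_gen)

lemma gel_diff_one_in_aug_ideal: "m \<in> M \<Longrightarrow> gel m - 1 \<in> aug_ideal M"
  unfolding aug_ideal_def by (rule ideal_gen_base) blast

lemma aug_ideal_subset:
  "two_sided_ideal I \<Longrightarrow> (\<And>m. m \<in> M \<Longrightarrow> gel m - 1 \<in> I) \<Longrightarrow> aug_ideal M \<subseteq> I"
  unfolding aug_ideal_def by (rule ideal_gen_subset) auto

lemma aug_ideal_trivial: "aug_ideal {0} = {0}"
  using aug_ideal_subset[OF two_sided_ideal_zero, of "{0}"] ideal_0[OF aug_ideal] by auto

lemma lie_gel: "lie (gel a) (gel b) = gel (b + a) * (gel (gcomm a b) - 1)"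
proof -
  have "b + a + gcomm a b = a + b" by (rule add_commute_gcomm[symmetric])
  then show ?thesis by (simp only: right_diff_distrib gel_mult mult_1_right)
qed

lemma lie_single:
  "lie (Poly_Mapping.single g c) r = lie (gel g) r * Poly_Mapping.single 0 c"
  for r :: "'g::group_add \<Rightarrow>\<^sub>0 'f::field"
proof -
  have 1: "Poly_Mapping.single g c = gel g * (Poly_Mapping.single 0 c :: 'g \<Rightarrow>\<^sub>0 'f)"
    by (simp add: mult_single)
  have "gel g * Poly_Mapping.single 0 c * r = gel g * r * (Poly_Mapping.single 0 c :: 'g \<Rightarrow>\<^sub>0 'f)"
    by (simp only: mult.assoc scalar_central[of c r])
  then show ?thesis by (simp only: 1 left_diff_distrib mult.assoc)
qed

lemma lie_single':
  "lie r (Poly_Mapping.single g c) = lie r (gel g) * Poly_Mapping.single 0 c"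
  for r :: "'g::group_add \<Rightarrow>\<^sub>0 'f::field"
  using lie_single[of g c r] by (metis minus_diff_eq mult_minus_left)

text \<open>V is assumed closed under right multiplication only, since it is applied to sets of
  right multiples that are not yet known to be two-sided ideals.\<close>

lemma lie_closed_left:
  fixes V :: "('g::group_add \<Rightarrow>\<^sub>0 'f::field) set"
  assumes add: "\<And>x y. x \<in> V \<Longrightarrow> y \<in> V \<Longrightarrow> x + y \<in> V" and mult: "\<And>x z. x \<in> V \<Longrightarrow> x * z \<in> V"
    and gel: "\<And>g. lie (gel g) s \<in> V"
  shows "lie r s \<in> V"
proof (induct r rule: group_algebra_induct)
  case (add x y)
  then show ?case unfolding lie_add_left by (rule assms(1))
next
  case (single g c)
  show ?case unfolding lie_single[of g c] by (rule mult[OF gel])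
qed

lemma lie_closed:
  fixes V :: "('g::group_add \<Rightarrow>\<^sub>0 'f::field) set"
  assumes add: "\<And>x y. x \<in> V \<Longrightarrow> y \<in> V \<Longrightarrow> x + y \<in> V" and mult: "\<And>x z. x \<in> V \<Longrightarrow> x * z \<in> V"
    and gel: "\<And>g h. lie (gel g) (gel h) \<in> V"
  shows "lie r s \<in> V"
proof (rule lie_closed_left[OF add mult])
  fix g
  show "lie (gel g) s \<in> V"
  proof (induct s rule: group_algebra_induct)
    case (add x y)
    have "lie (gel g) (x + y) = lie (gel g) x + lie (gel g) y" by (simp add: algebra_simps)
    then show ?case using assms(1)[OF add] by (simp only:)
  next
    case (single h c)
    show ?case unfolding lie_single'[of "gel g" h c] by (rule mult[OF gel])
  qed
qed

lemma lie_gel_in_ideal: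
  fixes I :: "('g::group_add \<Rightarrow>\<^sub>0 'f::field) set"
  assumes I: "two_sided_ideal I" and x: "\<And>g. lie x (gel g) \<in> I"
  shows "lie x r \<in> I"
proof (induct r rule: group_algebra_induct)
  case (add r s)
  have "lie x (r + s) = lie x r + lie x s" by (simp add: algebra_simps)
  then show ?case using ideal_add[OF I add] by simp
next
  case (single g c)
  show ?case unfolding lie_single'[of x g c] by (rule ideal_mult_right[OF I x])
qed

context lie_nilpotent_algebra
begin

abbreviation aug :: "'g set \<Rightarrow> ('g \<Rightarrow>\<^sub>0 'f) set" where "aug \<equiv> aug_ideal"

text \<open>G'/M is generated by y with y^(p^i) trivial, and G acts trivially on it modulo p-th
  powers. The last clause puts brackets with Y = y - 1 into weight at least p, apart from
  contributions of M, and is carried along the descent.\<close>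

definition cyclic_mod :: "'g set \<Rightarrow> nat \<Rightarrow> bool" where
  "cyclic_mod M i \<longleftrightarrow> (\<exists>y\<in>G'. nmul (p ^ i) y \<in> M \<and> (\<forall>h\<in>G'. \<exists>t. cong_mod M (nmul t y) h)
     \<and> (\<forall>g. \<exists>t. cong_mod M (nmul (p * t) y) (gcomm y g)))"

text \<open>y^(p t) - 1 is a multiple of y^p - 1 = (y - 1)^p.\<close>

lemma gel_p_multiple:
  "\<exists>s. gel (nmul (p * t) y) - 1 = (gel y - 1 :: 'g \<Rightarrow>\<^sub>0 'f) ^ p * s"
proof -
  have "gel (nmul (p * t) y) - 1 = ((gel y :: 'g \<Rightarrow>\<^sub>0 'f) ^ p) ^ t - 1"
    by (simp add: gel_power mult.commute[of p] flip: nmul_mult)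
  also have "\<dots> = (gel y ^ p - 1) * (\<Sum>j<t. (gel y ^ p) ^ j)" by (rule power_diff_one_factor)
  also have "gel y ^ p - 1 = (gel y - 1 :: 'g \<Rightarrow>\<^sub>0 'f) ^ p"
    using gel_diff_one_power[of y 1] by (simp add: gel_power)
  finally show ?thesis by blast
qed

end

text \<open>One step down a central series: \<open>N = \<langle>c\<rangle>M\<close> where \<open>c\<close> has order \<open>p\<close> and is central modulo \<open>M\<close>.\<close>

locale central_step = lie_nilpotent_algebra p ty
  for p :: nat and ty :: "('g::group_add \<Rightarrow>\<^sub>0 'f::field) itself" +
  fixes M :: "'g set" and c :: 'g
  assumes M: "normal_subgrp M" and M_G': "M \<subseteq> G'"
    and c_G': "c \<in> G'" and c_M: "c \<notin> M" and c_central: "gcomm c g \<in> M" and pc: "nmul p c \<in> M"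
begin

lemmas sM = normal_subgrp[OF M]

definition N :: "'g set" where "N = {nmul t c + m | t m. m \<in> M}"

lemma N_cong: "n \<in> N \<longleftrightarrow> (\<exists>t. cong_mod M (nmul t c) n)"
proof
  assume "\<exists>t. cong_mod M (nmul t c) n"
  then obtain t where "- nmul t c + n \<in> M" unfolding cong_mod_def by blast
  moreover have "n = nmul t c + (- nmul t c + n)" by simp
  ultimately show "n \<in> N" unfolding N_def by blast
next
  assume "n \<in> N"
  then obtain t m where "n = nmul t c + m" "m \<in> M" unfolding N_def by blast
  then show "\<exists>t. cong_mod M (nmul t c) n" by (intro exI[of _ t]) (simp add: cong_mod_def)
qed

lemma gcomm_nmul_c: "gcomm (nmul t c) g \<in> M"
proof (induct t)
  case 0
  show ?case using subgrp_0[OF sM] by (simp add: gcomm_def)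
next
  case (Suc t)
  show ?case unfolding nmul.simps gcomm_add_left
    by (rule subgrp_add[OF sM normal_conj[OF M c_central] Suc])
qed

lemma nmul_p_c: "cong_mod M (nmul (p * t) c) 0"
  using subgrp_minus[OF sM subgrp_nmul[OF sM pc, of t]]
  by (simp add: cong_mod_def mult.commute[of p] nmul_mult)

lemma N_normal: "normal_subgrp N"
  unfolding normal_subgrp_def subgrp_def
proof (intro conjI ballI allI)
  show "0 \<in> N" unfolding N_cong using cong_mod_refl[OF M] by (intro exI[of _ 0]) simp
next
  fix x y assume "x \<in> N" "y \<in> N"
  then obtain t s where "cong_mod M (nmul t c) x" "cong_mod M (nmul s c) y" unfolding N_cong by blast
  then have "cong_mod M (nmul (t + s) c) (x + y)" using cong_mod_add[OF M] by (simp add: nmul_add)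
  then show "x + y \<in> N" unfolding N_cong by blast
next
  fix x assume "x \<in> N"
  then obtain t where t: "cong_mod M (nmul t c) x" unfolding N_cong by blast
  have "cong_mod M (nmul ((p - 1) * t) c + nmul t c) 0"
  proof -
    have "(p - 1) * t + t = p * t" using p_pos by (cases p) simp_all
    then show ?thesis using nmul_p_c[of t] by (simp flip: nmul_add)
  qed
  moreover have "cong_mod M (nmul ((p - 1) * t) c + x) (nmul ((p - 1) * t) c + nmul t c)"
    by (rule cong_mod_add[OF M cong_mod_refl[OF M] cong_mod_sym[OF M t]])
  ultimately have "cong_mod M (nmul ((p - 1) * t) c + x) 0" using cong_mod_trans[OF M] by blast
  from cong_mod_add[OF M this cong_mod_refl[OF M, of "- x"]]
  have "cong_mod M (nmul ((p - 1) * t) c) (- x)" by (simp add: add.assoc)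
  then show "- x \<in> N" unfolding N_cong by blast
next
  fix x g assume "x \<in> N"
  then obtain t where t: "cong_mod M (nmul t c) x" unfolding N_cong by blast
  have "cong_mod M (conj_by g (nmul t c)) (conj_by g x)"
    by (intro cong_mod_add[OF M] cong_mod_refl[OF M] t)
  moreover have "cong_mod M (nmul t c) (conj_by g (nmul t c))"
    unfolding conj_by_gcomm by (rule cong_mod_mult_right[OF gcomm_nmul_c])
  ultimately show "conj_by g x \<in> N" unfolding N_cong using cong_mod_trans[OF M] by blast
qed

lemma N_G': "N \<subseteq> G'"
  unfolding N_def using subgrp_add[OF subgrp_G'] subgrp_nmul[OF subgrp_G' c_G'] M_G' by blast

lemma nmul_c_in_M: assumes "nmul d c \<in> M" shows "p dvd d"
proof (rule ccontr)
  assume "\<not> p dvd d"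
  then have "coprime p d" using prime_p by (simp add: prime_imp_coprime)
  then show False using subgrp_coprime[OF sM pc assms] c_M by blast
qed

lemma card_N: "card N = p * card M"
proof -
  have inj: "inj_on (\<lambda>(t, m). nmul t c + m) ({..<p} \<times> M)"
  proof -
    have key: "t = t' \<and> m = m'"
      if *: "t \<le> t'" "t' < p" "m \<in> M" "m' \<in> M" "nmul t c + m = nmul t' c + m'" for t t' m m'
    proof -
      have "nmul t' c = nmul t c + nmul (t' - t) c" using *(1) by (simp flip: nmul_add)
      then have "m = nmul (t' - t) c + m'" using *(5) by (simp add: add.assoc)
      then have "nmul (t' - t) c = m - m'" by (simp add: eq_diff_eq)
      then have "nmul (t' - t) c \<in> M" using * subgrp_diff[OF sM] by metis
      then have "p dvd t' - t" by (rule nmul_c_in_M)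
      then have "t' - t = 0" using *(2) by (metis dvd_imp_le less_imp_diff_less not_le gr0I)
      then show ?thesis using * by simp
    qed
    show ?thesis
    proof (rule inj_onI)
      fix x x' assume x: "x \<in> {..<p} \<times> M" "x' \<in> {..<p} \<times> M"
        "(case x of (t, m) \<Rightarrow> nmul t c + m) = (case x' of (t, m) \<Rightarrow> nmul t c + m)"
      obtain t m t' m' where xx: "x = (t, m)" "x' = (t', m')" by (metis surj_pair)
      then have *: "t < p" "m \<in> M" "t' < p" "m' \<in> M" "nmul t c + m = nmul t' c + m'"
        using x by auto
      have "t = t' \<and> m = m'"
      proof (cases "t \<le> t'")
        case True
        then show ?thesis using key[OF True _ *(2,4,5)] *(3) by blast
      next
        case False
        then have "t' \<le> t" by simp
        then show ?thesis using key[OF _ _ *(4,2) *(5)[symmetric]] *(1) by blast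
      qed
      then show "x = x'" by (simp add: xx)
    qed
  qed
  have "N = (\<lambda>(t, m). nmul t c + m) ` ({..<p} \<times> M)"
  proof (intro equalityI subsetI)
    fix n assume "n \<in> N"
    then obtain t m where n: "n = nmul t c + m" "m \<in> M" unfolding N_def by blast
    have "nmul t c = nmul (t mod p + t div p * p) c" by simp
    also have "\<dots> = nmul (t mod p) c + nmul (t div p) (nmul p c)" by (simp only: nmul_add nmul_mult)
    finally have "n = nmul (t mod p) c + (nmul (t div p) (nmul p c) + m)" by (simp add: n add.assoc)
    moreover have "nmul (t div p) (nmul p c) + m \<in> M"
      by (intro subgrp_add[OF sM] subgrp_nmul[OF sM] pc n)
    ultimately show "n \<in> (\<lambda>(t, m). nmul t c + m) ` ({..<p} \<times> M)"
      by (intro image_eqI[of _ _ "(t mod p, nmul (t div p) (nmul p c) + m)"]) auto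
  qed (auto simp: N_def)
  then show ?thesis using card_image[OF inj] by (simp add: card_cartesian_product)
qed

definition C :: "'g \<Rightarrow>\<^sub>0 'f" where "C = gel c - 1"

lemmas I = aug_ideal[where 'a='g and 'b='f]

lemma C_central: "lie C r \<in> aug M"
proof (rule lie_gel_in_ideal[OF I])
  fix g
  have "lie C (gel g) = lie (gel c) (gel g)" unfolding C_def by (simp add: algebra_simps)
  also have "\<dots> \<in> aug M" unfolding lie_gel
    by (intro ideal_mult_left[OF I] gel_diff_one_in_aug_ideal c_central)
  finally show "lie C (gel g) \<in> aug M" .
qed

lemma C_power_p: "C ^ p \<in> aug M"
  using gel_diff_one_power[of c 1] gel_diff_one_in_aug_ideal[OF pc] by (simp add: C_def)

abbreviation CR :: "('g \<Rightarrow>\<^sub>0 'f) set" where "CR \<equiv> {C * r + i | r i. i \<in> aug M}"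

lemma CR_ideal: "two_sided_ideal CR"
  using central_multiples_ideal[OF I two_sided_ideal_UNIV C_central] by simp

lemma gel_nmul_c: "gel (nmul t c) - 1 \<in> CR"
proof -
  have "gel (nmul t c) - 1 = C * (\<Sum>j<t. gel c ^ j) + 0"
    unfolding C_def gel_power[symmetric] power_diff_one_factor by simp
  then show ?thesis using ideal_0[OF I] by blast
qed

lemma M_in_CR: "m \<in> M \<Longrightarrow> gel m - 1 \<in> CR"
  using gel_diff_one_in_aug_ideal[of m M] by (intro CollectI exI[of _ 0] exI[of _ "gel m - 1"]) auto

lemma gel_N: assumes "n \<in> N" shows "gel n - 1 \<in> CR"
proof -
  obtain t m where n: "n = nmul t c + m" "m \<in> M" using assms unfolding N_def by blast
  have "gel n - 1 = gel (nmul t c) * (gel m - 1) + (gel (nmul t c) - 1 :: 'g \<Rightarrow>\<^sub>0 'f)"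
    by (simp add: n right_diff_distrib gel_mult)
  also have "\<dots> \<in> CR"
    by (intro ideal_add[OF CR_ideal] ideal_mult_left[OF CR_ideal] gel_nmul_c M_in_CR n)
  finally show ?thesis .
qed

lemma power_p_in_aug:
  assumes "upper_lie w \<subseteq> {C ^ p * r + i | r i. i \<in> aug M}"
  shows "upper_lie w \<subseteq> aug M"
  using assms ideal_add[OF I ideal_mult_right[OF I C_power_p]] by fastforce

text \<open>Each block of p^i - 1 brackets brings out a factor C, and C^p vanishes modulo
  \<open>aug M\<close>. The p (p^i - 1) brackets spent are no more than p^(i+1) - 1, so the saving
  is kept.\<close>

lemma step_noncyclic:
  assumes "upper_lie (p ^ i - 1) \<subseteq> aug N"
  shows "upper_lie (p ^ Suc i - 1) \<subseteq> aug M"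
proof -
  have sub: "upper_lie (p ^ i - 1) \<subseteq> CR"
    using assms aug_ideal_subset[OF CR_ideal gel_N] by blast
  have "upper_lie (0 + p * (p ^ i - 1)) \<subseteq> {C ^ (0 + p) * r + i | r i. i \<in> aug M}"
  proof (rule upper_lie_gain_factors[OF I C_central _ sub], rule subsetI)
    show "x \<in> {C ^ 0 * r + i | r i. i \<in> aug M}" for x
      by (intro CollectI exI[of _ x] exI[of _ 0]) (simp add: ideal_0[OF I])
  qed
  then have "upper_lie (p * (p ^ i - 1)) \<subseteq> aug M"
    using power_p_in_aug[of "p * (p ^ i - 1)"] by simp
  moreover have "p * (p ^ i - 1) \<le> p ^ Suc i - 1"
    using p_ge_3 by (simp add: diff_mult_distrib2 diff_le_mono2)
  ultimately show ?thesis using upper_lie_antimono by blast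
qed

lemma step_cyclic_bottom:
  assumes "N = G'" shows "cyclic_mod M 1"
  unfolding cyclic_mod_def
proof (intro bexI[of _ c] conjI ballI allI)
  fix h :: 'g assume "h \<in> G'"
  then show "\<exists>t. cong_mod M (nmul t c) h" using assms N_cong by blast
next
  fix g
  show "\<exists>t. cong_mod M (nmul (p * t) c) (gcomm c g)"
    using c_central by (intro exI[of _ 0]) (simp add: cong_mod_0)
qed (use pc c_G' in auto)

text \<open>If y^(p^i) is not in M, it generates N modulo M. Then c is a power of it modulo M, and
  every correction by a power of c is a power of y.\<close>

lemma step_cyclic:
  assumes i: "i \<noteq> 0" and y: "y \<in> G'" and py: "nmul (p ^ i) y \<in> N" "nmul (p ^ i) y \<notin> M"
    and gen: "\<And>h. h \<in> G' \<Longrightarrow> \<exists>t. cong_mod N (nmul t y) h"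
    and com: "\<And>g. \<exists>t. cong_mod N (nmul (p * t) y) (gcomm y g)"
  shows "cyclic_mod M (Suc i)"
proof -
  obtain l where l: "cong_mod M (nmul l c) (nmul (p ^ i) y)" using py(1) N_cong by blast
  have "\<not> p dvd l"
  proof
    assume "p dvd l"
    then obtain l' where "l = p * l'" by blast
    then have "cong_mod M 0 (nmul (p ^ i) y)"
      using cong_mod_trans[OF M cong_mod_sym[OF M nmul_p_c] l[unfolded \<open>l = p * l'\<close>]] by simp
    then show False using py(2) by (simp add: cong_mod_0)
  qed
  then have "coprime l p" using prime_p by (metis prime_imp_coprime coprime_commute)
  moreover have "l \<noteq> 0" using \<open>\<not> p dvd l\<close> by (metis dvd_0_right)
  \<comment> \<open>u inverts l modulo p, so that c is the u-th power of y^(p^i) modulo M.\<close>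
  ultimately obtain u v where uv: "l * u = p * v + 1" using bezout_nat[of l p] by auto
  have "cong_mod M (nmul u (nmul l c)) (nmul u (nmul (p ^ i) y))" by (rule cong_mod_nmul[OF M l])
  moreover have "cong_mod M c (nmul u (nmul l c))"
  proof -
    have "nmul u (nmul l c) = nmul (p * v) c + c"
      using uv by (metis mult.commute nmul_1 nmul_add nmul_mult One_nat_def)
    then show ?thesis
      using cong_mod_sym[OF M cong_mod_add[OF M nmul_p_c[of v] cong_mod_refl[OF M, of c]]] by simp
  qed
  ultimately have cu: "cong_mod M c (nmul (u * p ^ i) y)"
    using cong_mod_trans[OF M] by (simp add: nmul_mult)
  have lift: "\<exists>s. cong_mod M (nmul (t + s * (u * p ^ i)) y) h" if th: "cong_mod N (nmul t y) h" for t h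
  proof -
    have "- nmul t y + h \<in> N" using th by (simp add: cong_mod_def)
    then obtain s where s: "cong_mod M (nmul s c) (- nmul t y + h)" using N_cong by blast
    have "cong_mod M (nmul s (nmul (u * p ^ i) y)) (- nmul t y + h)"
      by (rule cong_mod_trans[OF M cong_mod_sym[OF M cong_mod_nmul[OF M cu]] s])
    from cong_mod_add[OF M cong_mod_refl[OF M, of "nmul t y"] this]
    show ?thesis by (intro exI[of _ s]) (simp add: nmul_add nmul_mult)
  qed
  show ?thesis
    unfolding cyclic_mod_def
  proof (intro bexI[of _ y] conjI ballI allI)
    have "cong_mod M (nmul p (nmul l c)) (nmul p (nmul (p ^ i) y))" by (rule cong_mod_nmul[OF M l])
    moreover have "cong_mod M 0 (nmul p (nmul l c))"
      using cong_mod_sym[OF M nmul_p_c[of l]] by (simp add: nmul_mult)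
    ultimately have "cong_mod M 0 (nmul (p ^ Suc i) y)"
      using cong_mod_trans[OF M] by (simp add: nmul_mult)
    then show "nmul (p ^ Suc i) y \<in> M" by (simp add: cong_mod_0)
  next
    fix h :: 'g assume "h \<in> G'"
    then show "\<exists>t. cong_mod M (nmul t y) h" using gen lift by blast
  next
    fix g
    obtain t s where "cong_mod M (nmul (p * t + s * (u * p ^ i)) y) (gcomm y g)"
      using com lift by blast
    \<comment> \<open>The correction has an exponent divisible by p^i, hence by p because i is
      positive.\<close>
    moreover have "p * t + s * (u * p ^ i) = p * (t + s * (u * p ^ (i - 1)))"
      using i by (cases i) (simp_all add: algebra_simps)
    ultimately show "\<exists>t. cong_mod M (nmul (p * t) y) (gcomm y g)" by metis
  qed (rule y)
qed

text \<open>Now Y^(p^i) vanishes modulo \<open>aug M\<close>, so C no longer comes from a power of Y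
  and only has weight 2. Weight p^i forces one factor C, and weight 2 p^i - 1 forces two.\<close>

lemma step_becomes_noncyclic:
  assumes i: "i \<noteq> 0" and y: "y \<in> G'" and py: "nmul (p ^ i) y \<in> M"
    and gen: "\<And>h. h \<in> G' \<Longrightarrow> \<exists>t. cong_mod N (nmul t y) h"
    and com: "\<And>g. \<exists>t. cong_mod N (nmul (p * t) y) (gcomm y g)"
  shows "upper_lie (p ^ Suc i - 1) \<subseteq> aug M"
proof -
  define Y :: "'g \<Rightarrow>\<^sub>0 'f" where "Y = gel y - 1"
  have Yy: "gel y * Y = Y * gel y" unfolding Y_def by (simp add: algebra_simps)
  have CR_form: "\<exists>r. x - C * r \<in> aug M" if "x \<in> CR" for x
  proof -
    from that obtain r i where "x = C * r + i" "i \<in> aug M" by blast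
    then show ?thesis by (intro exI[of _ r]) simp
  qed
  have N_factor: "\<exists>n\<in>N. h = nmul t y + n" if "cong_mod N (nmul t y) h" for t h
    using that by (intro bexI[of _ "- nmul t y + h"]) (auto simp: cong_mod_def)
  \<comment> \<open>The parameter A is instantiated with Y Y for \<open>lie_Y\<close> and with Y for
    \<open>lie_UNIV\<close>.\<close>
  have pair_closed: "x + x' \<in> {x. \<exists>u v. x - (A * u + C * v) \<in> aug M}"
    if xx: "x \<in> {x. \<exists>u v. x - (A * u + C * v) \<in> aug M}" "x' \<in> {x. \<exists>u v. x - (A * u + C * v) \<in> aug M}" for A x x'
  proof -
    obtain u v u' v' where 1: "x - (A * u + C * v) \<in> aug M" "x' - (A * u' + C * v') \<in> aug M"
      using xx by blast
    have "x + x' - (A * (u + u') + C * (v + v')) = (x - (A * u + C * v)) + (x' - (A * u' + C * v'))"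
      by (simp add: algebra_simps)
    then have "x + x' - (A * (u + u') + C * (v + v')) \<in> aug M" using ideal_add[OF I 1] by (simp only:)
    then show ?thesis by blast
  qed
  have mult_closed: "x * z \<in> {x. \<exists>u v. x - (A * u + C * v) \<in> aug M}"
    if x: "x \<in> {x. \<exists>u v. x - (A * u + C * v) \<in> aug M}" for A x z
  proof -
    obtain u v where 1: "x - (A * u + C * v) \<in> aug M" using x by blast
    have "x * z - (A * (u * z) + C * (v * z)) = (x - (A * u + C * v)) * z"
      by (simp add: algebra_simps)
    then have "x * z - (A * (u * z) + C * (v * z)) \<in> aug M" using ideal_mult_right[OF I 1] by (simp only:)
    then show ?thesis by blast
  qed
  have lie_Y: "lie r Y \<in> {x. \<exists>s t. x - (Y * Y * s + C * t) \<in> aug M}" for r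
  proof (rule lie_closed_left[OF pair_closed mult_closed])
    fix g
    obtain t where "cong_mod N (nmul (p * t) y) (gcomm y (- g))" using com by blast
    then obtain n where n: "n \<in> N" "gcomm y (- g) = nmul (p * t) y + n" using N_factor by blast
    obtain s where s: "gel (nmul (p * t) y) - 1 = Y ^ p * s" using gel_p_multiple unfolding Y_def by blast
    have "g + y = y + gcomm y (- g) + g"
      by (simp add: gcomm_def group_word_simps del: add_uminus_conv_diff)
    then have "gel g * gel y = (gel y * (gel (nmul (p * t) y) * gel n) * gel g :: 'g \<Rightarrow>\<^sub>0 'f)"
      by (simp only: gel_mult n(2))
    then have "lie (gel g) Y = gel y * (gel (nmul (p * t) y) * gel n) * gel g - gel y * gel g"
      unfolding Y_def by (simp add: algebra_simps)
    also have "\<dots> = gel y * (gel (nmul (p * t) y) - 1) * gel g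
        + gel y * gel (nmul (p * t) y) * (gel n - 1) * gel g"
      by (simp add: algebra_simps)
    also have "gel y * (gel (nmul (p * t) y) - 1) * gel g = Y * Y * (Y ^ (p - 2) * (gel y * s * gel g))"
    proof -
      have "gel y * Y ^ k = Y ^ k * gel y" for k
      proof (induct k)
        case (Suc k)
        have "gel y * Y ^ Suc k = Y * (gel y * Y ^ k)" by (simp add: Yy flip: mult.assoc)
        then show ?case by (simp add: Suc mult.assoc)
      qed simp
      then have "gel y * (Y ^ p * s) * gel g = Y ^ p * (gel y * s * gel g)"
        by (simp only: mult.assoc[symmetric])
      moreover have "Y ^ (2 + (p - 2)) = Y * Y * Y ^ (p - 2)"
        by (simp only: power_add power2_eq_square)
      moreover have "2 + (p - 2) = p" using p_ge_3 by simp
      ultimately show ?thesis unfolding s by (simp only: mult.assoc)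
    qed
    finally have *: "lie (gel g) Y - Y * Y * (Y ^ (p - 2) * (gel y * s * gel g))
        = gel y * gel (nmul (p * t) y) * (gel n - 1) * gel g" by simp
    have "gel y * gel (nmul (p * t) y) * (gel n - 1) * gel g \<in> CR"
      by (intro ideal_mult_left[OF CR_ideal] ideal_mult_right[OF CR_ideal] gel_N n)
    then obtain r where r: "gel y * gel (nmul (p * t) y) * (gel n - 1) * gel g - C * r \<in> aug M"
      using CR_form by blast
    define S where "S = Y ^ (p - 2) * (gel y * s * gel g)"
    have "lie (gel g) Y - (Y * Y * S + C * r) \<in> aug M"
      unfolding diff_diff_add[symmetric] S_def * by (rule r)
    then show "lie (gel g) Y \<in> {x. \<exists>s t. x - (Y * Y * s + C * t) \<in> aug M}" by blast
  qed
  have lie_UNIV: "lie r s \<in> {x. \<exists>u v. x - (Y * u + C * v) \<in> aug M}" for r s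
  proof -
    define V where "V = {x. \<exists>u v. x - (Y * u + C * v) \<in> aug M}"
    note V_add = pair_closed[of _ Y, folded V_def] and V_mult = mult_closed[of _ Y, folded V_def]
    have gels: "lie (gel a) (gel b) \<in> V" for a b
    proof -
      obtain t where "cong_mod N (nmul t y) (a + b - a - b)" using gen commutator_in_G' by blast
      then obtain n where n: "n \<in> N" "a + b - a - b = nmul t y + n" using N_factor by blast
      have "a + b = (a + b - a - b) + (b + a)" by (simp add: group_word_simps del: add_uminus_conv_diff)
      then have "gel a * gel b = (gel (nmul t y) * gel n * gel (b + a) :: 'g \<Rightarrow>\<^sub>0 'f)"
        by (simp only: gel_mult n(2))
      then have "lie (gel a) (gel b) = (gel (nmul t y) - 1) * gel (b + a)
          + gel (nmul t y) * (gel n - 1) * (gel (b + a) :: 'g \<Rightarrow>\<^sub>0 'f)"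
        by (simp add: algebra_simps gel_mult)
      moreover have "gel (nmul t y) - 1 = Y * (\<Sum>j<t. gel y ^ j)"
        unfolding Y_def gel_power[symmetric] by (rule power_diff_one_factor)
      then have "gel (nmul t y) - 1 \<in> V"
        unfolding V_def using ideal_0[OF I] by (intro CollectI exI[of _ "\<Sum>j<t. gel y ^ j"] exI[of _ 0]) simp
      moreover have "gel (nmul t y) * (gel n - 1) \<in> V"
      proof -
        have "gel (nmul t y) * (gel n - 1) \<in> CR" by (intro ideal_mult_left[OF CR_ideal] gel_N n)
        then obtain r where "gel (nmul t y) * (gel n - 1) - C * r \<in> aug M" using CR_form by blast
        then show ?thesis unfolding V_def by (intro CollectI exI[of _ 0] exI[of _ r]) simp
      qed
      ultimately show ?thesis using V_add V_mult by metis
    qed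
    show ?thesis unfolding V_def[symmetric] by (rule lie_closed[OF V_add V_mult gels])
  qed
  interpret W: weighted_filtration "aug M" Y C
    by unfold_locales (rule I C_central lie_Y[simplified] lie_UNIV[simplified])+
  have Y_pow: "Y ^ k \<in> aug M" if "p ^ i \<le> k" for k
  proof -
    have "Y ^ (p ^ i) \<in> aug M"
      unfolding Y_def gel_diff_one_power by (rule gel_diff_one_in_aug_ideal[OF py])
    then have "Y ^ (p ^ i) * Y ^ (k - p ^ i) \<in> aug M" by (rule ideal_mult_right[OF I])
    then show ?thesis using that by (simp flip: power_add)
  qed
  \<comment> \<open>This gives 2 p^i - 3 >= p^i, which kills the term of J that is linear in
    C.\<close>
  have pi: "3 \<le> p ^ i" using p_ge_3 i by (metis less_eq_Suc_le order_trans self_le_power neq0_conv p_pos One_nat_def)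
  have v: "upper_lie (p ^ i) \<subseteq> CR"
  proof
    fix x :: "'g \<Rightarrow>\<^sub>0 'f" assume "x \<in> upper_lie (p ^ i)"
    then have "x \<in> W.J (p ^ i)" using W.upper_lie_subset_J by blast
    then obtain r s t j where x: "x = Y ^ (p ^ i) * r + C * (Y ^ (p ^ i - 2) * s) + C * (C * t) + j" "j \<in> aug M"
      by (rule W.J_E)
    then have "x = C * (Y ^ (p ^ i - 2) * s + C * t) + (Y ^ (p ^ i) * r + j)"
      by (simp add: algebra_simps)
    moreover have "Y ^ (p ^ i) * r + j \<in> aug M"
      by (intro ideal_add[OF I] ideal_mult_right[OF I] Y_pow x(2)) simp
    ultimately show "x \<in> CR" by blast
  qed
  have w: "upper_lie (2 * p ^ i - 1) \<subseteq> {C ^ 2 * r + i | r i. i \<in> aug M}"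
  proof
    fix x :: "'g \<Rightarrow>\<^sub>0 'f" assume "x \<in> upper_lie (2 * p ^ i - 1)"
    then have "x \<in> W.J (2 * p ^ i - 1)" using W.upper_lie_subset_J by blast
    then obtain r s t j where x: "x = Y ^ (2 * p ^ i - 1) * r + C * (Y ^ (2 * p ^ i - 1 - 2) * s) + C * (C * t) + j"
      "j \<in> aug M" by (rule W.J_E)
    then have "x = C ^ 2 * t + (Y ^ (2 * p ^ i - 1) * r + C * (Y ^ (2 * p ^ i - 1 - 2) * s) + j)"
      by (simp add: algebra_simps power2_eq_square)
    moreover have "Y ^ (2 * p ^ i - 1) * r + C * (Y ^ (2 * p ^ i - 1 - 2) * s) + j \<in> aug M"
      using pi by (intro ideal_add[OF I] ideal_mult_right[OF I] ideal_mult_left[OF I] Y_pow x(2)) auto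
    ultimately show "x \<in> {C ^ 2 * r + i | r i. i \<in> aug M}" by blast
  qed
  \<comment> \<open>Two factors C cost 2 p^i - 1 brackets and each of the other p - 2 costs p^i: one
    less than p^(i+1) in total.\<close>
  have "upper_lie (2 * p ^ i - 1 + (p - 2) * p ^ i) \<subseteq> {C ^ (2 + (p - 2)) * r + i | r i. i \<in> aug M}"
    by (rule upper_lie_gain_factors[OF I C_central w v])
  moreover have "2 * p ^ i - 1 + (p - 2) * p ^ i = p ^ Suc i - 1"
  proof -
    have "2 * p ^ i + (p - 2) * p ^ i = (2 + (p - 2)) * p ^ i" by (rule distrib_right[symmetric])
    moreover have "2 + (p - 2) = p" using p_ge_3 by simp
    ultimately have "2 * p ^ i + (p - 2) * p ^ i = p ^ Suc i" by (simp only: power_Suc)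
    then show ?thesis using pi by linarith
  qed
  moreover have "2 + (p - 2) = p" using p_ge_3 by simp
  ultimately show ?thesis using power_p_in_aug[of "p ^ Suc i - 1"] by (simp only:)
qed

end

section \<open>Descent along the central series\<close>

context lie_nilpotent_algebra
begin

text \<open>The induction goes from M = G' downwards, as N is p times larger than M. For i = 0 the
  quotient G'/N is trivial, so c itself becomes the generator; otherwise the step depends on whether
  y^(p^i) lies in M.\<close>

theorem cyclic_or_small_upper_lie:
  fixes M :: "'g set"
  assumes "normal_subgrp M" "M \<subseteq> G'"
  shows "\<exists>i. card (G' :: 'g set) = p ^ i * card M \<and> (cyclic_mod M i \<or> upper_lie (p ^ i - 1) \<subseteq> aug M)"
  using assms
proof (induct "card (G' :: 'g set) - card M" arbitrary: M rule: less_induct)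
  case less
  note Mn = less(2) and MG = less(3)
  show ?case
  proof (cases "M = G'")
    case True
    have "cyclic_mod M 0"
      unfolding cyclic_mod_def True using subgrp_0[OF subgrp_G'] gcomm_in_G'
      by (intro bexI[of _ 0]) (auto simp: cong_mod_0)
    then show ?thesis using True by (intro exI[of _ 0]) simp
  next
    case False
    obtain c where c: "c \<in> G'" "c \<notin> M" "\<And>g. gcomm c g \<in> M" "nmul p c \<in> M"
      using central_element_mod[OF Mn MG False] by blast
    interpret central_step p ty M c
      by unfold_locales (use Mn MG c in auto)
    have finM: "finite M" using MG finite_G' finite_subset by blast
    have "card M > 0" using finM subgrp_0[OF sM] by (auto simp: card_gt_0_iff)
    then have "card M < card N" using card_N p_ge_3 by simp
    moreover have "card N \<le> card (G' :: 'g set)" using N_G' finite_G' card_mono by blast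
    ultimately have "card (G' :: 'g set) - card N < card (G' :: 'g set) - card M" by linarith
    then obtain i where i: "card (G' :: 'g set) = p ^ i * card N"
      "cyclic_mod N i \<or> upper_lie (p ^ i - 1) \<subseteq> aug N"
      using less(1)[of N] N_normal N_G' by blast
    have card: "card (G' :: 'g set) = p ^ Suc i * card M" using i(1) card_N by simp
    have "cyclic_mod M (Suc i) \<or> upper_lie (p ^ Suc i - 1) \<subseteq> aug M"
    proof (cases "cyclic_mod N i")
      case False
      then show ?thesis using i(2) step_noncyclic by blast
    next
      case True
      then obtain y where y: "y \<in> G'" "nmul (p ^ i) y \<in> N" "\<And>h. h \<in> G' \<Longrightarrow> \<exists>t. cong_mod N (nmul t y) h"
        "\<And>g. \<exists>t. cong_mod N (nmul (p * t) y) (gcomm y g)" unfolding cyclic_mod_def by blast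
      show ?thesis
      proof (cases "i = 0")
        case True
        then have "N = G'" using i(1) N_G' finite_G' by (intro card_subset_eq) auto
        then show ?thesis using step_cyclic_bottom True by simp
      next
        case False
        then show ?thesis
          using step_cyclic[OF False y(1,2) _ y(3,4)] step_becomes_noncyclic[OF False y(1) _ y(3,4)] by blast
      qed
    qed
    then show ?thesis using card by blast
  qed
qed

end

subsection \<open>Cyclic derived subgroup\<close>

lemma minus_nmul:
  fixes x :: "'g::group_add"
  assumes "nmul q x = 0" "q > 0"
  shows "- nmul t x = nmul ((q - 1) * t) x"
proof -
  have "(q - 1) * t + t = q * t" using assms(2) by (cases q) simp_all
  then have "nmul ((q - 1) * t) x + nmul t x = nmul t (nmul q x)"
    by (simp add: mult.commute flip: nmul_add nmul_mult)
  then have "nmul ((q - 1) * t) x + nmul t x = 0" using assms(1) by simp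
  then show ?thesis by (metis add_eq_0_iff2 minus_minus)
qed

lemma subgrp_zero: "subgrp {0}"
  by (simp add: subgrp_def)

lemma normal_subgrp_zero: "normal_subgrp {0}"
  by (simp add: normal_subgrp_def subgrp_zero)

context lie_nilpotent_algebra
begin

lemma card_G'_nmul: "(x :: 'g) \<in> G' \<Longrightarrow> nmul (card (G' :: 'g set)) x = 0"
  using group.pow_order_eq_1[OF group_G', of x] finite_G' by (simp add: pow_G' order_def)

text \<open>The order of x is a power of p, hence coprime to p t - 1.\<close>

lemma not_p_multiple:
  assumes x: "(x :: 'g) \<in> G'" and eq: "x = nmul (p * t) x"
  shows "x = 0"
proof (cases t)
  case 0
  then show ?thesis using eq by simp
next
  case (Suc t')
  obtain k where k: "nmul (p ^ k) x = 0" using G'_torsion[OF x] by blast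
  have pt: "p * t = Suc (p * t - 1)" using Suc p_pos by simp
  have "x = nmul (Suc (p * t - 1)) x" unfolding pt[symmetric] by (rule eq)
  then have "x = x + nmul (p * t - 1) x" by simp
  then have "x + nmul (p * t - 1) x = x + 0" by simp
  then have "nmul (p * t - 1) x = 0" by (simp only: add_left_cancel)
  moreover have "coprime (p ^ k) (p * t - 1)"
  proof -
    have "coprime (p * t - 1) (p * t)" using Suc p_pos by (intro coprime_diff_one_left_nat) simp
    then have "coprime (p * t) (p * t - 1)" by (rule coprime_imp_coprime) auto
    then have "coprime p (p * t - 1)" by (simp only: coprime_mult_left_iff)
    then show ?thesis by simp
  qed
  ultimately show ?thesis using subgrp_coprime[OF subgrp_zero, of "p ^ k" x "p * t - 1"] k by simp
qed

lemma p_multiples_subgrp: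
  assumes k: "nmul (p ^ k) (x :: 'g) = 0"
  shows "subgrp {nmul (p * t) x | t. True}" (is "subgrp ?M")
unfolding subgrp_def
proof (intro conjI ballI)
  show "0 \<in> ?M"  by (intro CollectI exI[of _ 0]) simp
next
  fix u v assume "u \<in> ?M" "v \<in> ?M"
  then obtain s t where "u = nmul (p * s) x" "v = nmul (p * t) x"  by blast
  then have "u + v = nmul (p * (s + t)) x" by (simp add: distrib_left nmul_add)
  then show "u + v \<in> ?M"  by blast
next
  fix u assume "u \<in> ?M"
  then obtain s where "u = nmul (p * s) x"  by blast
  then have "- u = nmul ((p ^ k - 1) * (p * s)) x" using minus_nmul[OF k] by simp
  also have "(p ^ k - 1) * (p * s) = p * ((p ^ k - 1) * s)" by simp
  finally show "- u \<in> ?M"  by blast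
qed

text \<open>The p-th powers form a proper normal subgroup M of G', so some c = x^e outside M is
  central modulo M. As e is invertible modulo p, x is central modulo M as well.\<close>

lemma cyclic_gcomm:
  assumes x: "(x :: 'g) \<in> G'" and gen: "\<And>h :: 'g. h \<in> G' \<Longrightarrow> \<exists>t. h = nmul t x"
  shows "\<exists>t. gcomm x g = nmul (p * t) x"
proof (cases "x = 0")
  case True
  then show ?thesis by (simp add: gcomm_def)
next
  case False
  obtain k where k: "nmul (p ^ k) x = 0" using G'_torsion[OF x] by blast
  define M where "M = {nmul (p * t) x | t. True}"
  have sM: "subgrp M"
    unfolding M_def by (rule p_multiples_subgrp[OF k])
  have M: "normal_subgrp M"
    unfolding normal_subgrp_def
  proof (intro conjI ballI allI sM)
    fix u g assume "u \<in> M"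
    then obtain s where u: "u = nmul (p * s) x" unfolding M_def by blast
    obtain j where "conj_by g x = nmul j x" using gen[OF G'_conj[OF x]] by blast
    then have "conj_by g u = nmul (p * (s * j)) x" unfolding u nmul_conj[symmetric]
      by (simp flip: nmul_mult add: mult.assoc)
    then show "conj_by g u \<in> M" unfolding M_def by blast
  qed
  have "M \<subseteq> G'" unfolding M_def using subgrp_nmul[OF subgrp_G' x] by blast
  moreover have "x \<notin> M" unfolding M_def using not_p_multiple[OF x] False by blast
  then have "M \<noteq> G'" using x by blast
  ultimately obtain c where c: "c \<in> G'" "c \<notin> M" "\<And>g. gcomm c g \<in> M"
    using central_element_mod[OF M] by blast
  obtain e where e: "c = nmul e x" using gen[OF c(1)] by blast
  have "\<not> p dvd e" using c(2) unfolding M_def e by auto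
  then have cop: "coprime p e" using prime_p by (simp add: prime_imp_coprime)
  obtain j where j: "conj_by g x = nmul j x" using gen[OF G'_conj[OF x]] by blast
  obtain n where n: "gcomm x g = nmul n x" using gen[OF gcomm_in_G'] by blast
  have "nmul j x = x + nmul n x" using j n conj_by_gcomm by metis
  then have jn: "nmul j x = nmul (Suc n) x" by simp
  have "c + gcomm c g = conj_by g c" by (simp only: conj_by_gcomm)
  also have "\<dots> = nmul e (nmul j x)" unfolding e nmul_conj[symmetric] j ..
  also have "\<dots> = c + nmul (e * n) x"
    unfolding jn e by (simp only: nmul_mult[symmetric] mult_Suc_right nmul_add)
  finally have "nmul (e * n) x \<in> M" using c(3)[of g] by simp
  then have "nmul e (nmul n x) \<in> M" by (simp add: nmul_mult)
  moreover have "nmul p (nmul n x) \<in> M" unfolding M_def nmul_mult[symmetric] by blast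
  ultimately have "nmul n x \<in> M" using subgrp_coprime[OF sM _ _ cop] by blast
  then show ?thesis unfolding n M_def by blast
qed

lemma noncyclic_upper_lie:
  assumes "\<nexists>x :: 'g. x \<in> G' \<and> (\<forall>h\<in>G'. \<exists>t. h = nmul t x)"
  shows "upper_lie (card (G' :: 'g set) - 1) = ({0} :: ('g \<Rightarrow>\<^sub>0 'f) set)"
proof -
  obtain i where i: "card (G' :: 'g set) = p ^ i * card {0 :: 'g}"
    "cyclic_mod {0} i \<or> upper_lie (p ^ i - 1) \<subseteq> aug {0}"
    using cyclic_or_small_upper_lie[OF normal_subgrp_zero] subgrp_0[OF subgrp_G'] by blast
  have "\<not> cyclic_mod {0} i"
  proof
    assume "cyclic_mod {0} i"
    then obtain y :: 'g where "y \<in> G'" "\<And>h. h \<in> G' \<Longrightarrow> \<exists>t. cong_mod {0} (nmul t y) h"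
      unfolding cyclic_mod_def by blast
    then show False using assms by (auto simp: cong_mod_def) (metis add_eq_0_iff2 minus_minus)
  qed
  then have "upper_lie (card (G' :: 'g set) - 1) \<subseteq> ({0} :: ('g \<Rightarrow>\<^sub>0 'f) set)"
    using i by (simp add: aug_ideal_trivial)
  then show ?thesis using ideal_0[OF upper_lie_ideal] by blast
qed

end

section \<open>Binomial coefficients modulo p\<close>

lemma prime_dvd_prime_power_choose:
  fixes p :: nat
  assumes p: "prime p" and k: "0 < k" "k < p ^ e"
  shows "p dvd (p ^ e choose k)"
proof (rule ccontr)
  assume "\<not> p dvd (p ^ e choose k)"
  then have cop: "coprime (p ^ e) (p ^ e choose k)" using p by (simp add: prime_imp_coprime)
  obtain k' where k': "k = Suc k'" using k(1) by (cases k) auto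
  have "p ^ e = Suc (p ^ e - 1)" using k by simp
  then have "k * (p ^ e choose k) = p ^ e * ((p ^ e - 1) choose k')"
    using Suc_times_binomial_eq[of "p ^ e - 1" k'] k' by (metis mult.commute)
  then have "p ^ e dvd k * (p ^ e choose k)" by simp
  then have "p ^ e dvd k" using cop by (simp add: coprime_dvd_mult_left_iff)
  then show False using k by (meson dvd_imp_le not_le)
qed

text \<open>By Pascal's rule two consecutive coefficients for p^e - 1 add up to one for p^e, which
  vanishes modulo p.\<close>

lemma of_nat_choose_prime_power_minus_one:
  assumes p: "prime p" and char: "of_nat p = (0 :: 'a::ring_1)" and k: "k < p ^ e"
  shows "(-1) ^ k * of_nat ((p ^ e - 1) choose k) = (1 :: 'a)"
  using k
proof (induct k)
  case (Suc k)
  obtain m where m: "p ^ e = Suc m" using Suc(2) by (cases "p ^ e") auto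
  have "p dvd (p ^ e choose Suc k)" using p Suc(2) by (intro prime_dvd_prime_power_choose) auto
  then have "of_nat (p ^ e choose Suc k) = (0 :: 'a)" using char by (auto elim!: dvdE)
  then have "of_nat (m choose Suc k) = - (of_nat (m choose k) :: 'a)"
    unfolding m binomial_Suc_Suc of_nat_add by (simp add: eq_neg_iff_add_eq_0 add.commute)
  then show ?case using Suc by (simp add: m)
qed simp

subsection \<open>Linear functionals on the group algebra\<close>

definition lin :: "('g \<Rightarrow> 'f) \<Rightarrow> ('g::group_add \<Rightarrow>\<^sub>0 'f::field) \<Rightarrow> 'f" where
  "lin f r = (\<Sum>k\<in>Poly_Mapping.keys r. f k * Poly_Mapping.lookup r k)"

text \<open>Gives additivity of both \<open>lin\<close> and the involution. The support of r + s can
  be smaller than the union of the supports, so all three sums are extended to that union.\<close>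

lemma sum_keys_add:
  fixes h :: "'g \<Rightarrow> 'f::field \<Rightarrow> 'b::comm_monoid_add"
  assumes "\<And>k. h k 0 = 0" "\<And>k c d. h k (c + d) = h k c + h k d"
  shows "(\<Sum>k\<in>Poly_Mapping.keys (r + s). h k (Poly_Mapping.lookup (r + s) k))
    = (\<Sum>k\<in>Poly_Mapping.keys r. h k (Poly_Mapping.lookup r k))
    + (\<Sum>k\<in>Poly_Mapping.keys s. h k (Poly_Mapping.lookup s k))"
proof -
  let ?K = "Poly_Mapping.keys r \<union> Poly_Mapping.keys s"
  have ext: "(\<Sum>k\<in>Poly_Mapping.keys t. h k (Poly_Mapping.lookup t k)) = (\<Sum>k\<in>?K. h k (Poly_Mapping.lookup t k))"
    if "Poly_Mapping.keys t \<subseteq> ?K" for t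
    using that assms(1) by (intro sum.mono_neutral_left) (auto simp: in_keys_iff)
  show ?thesis
    by (simp only: ext[OF Poly_Mapping.keys_add] ext[OF Un_upper1] ext[OF Un_upper2])
      (simp only: lookup_add assms(2) sum.distrib)
qed

lemma lin_add: "lin f (r + s) = lin f r + lin f s"
  unfolding lin_def by (rule sum_keys_add) (simp_all add: distrib_left)

lemma lin_single [simp]: "lin f (Poly_Mapping.single g c) = f g * c"
  by (cases "c = 0") (simp_all add: lin_def)

lemma lin_0 [simp]: "lin f 0 = 0"
  by (simp add: lin_def)

lemma lin_sum: "finite A \<Longrightarrow> lin f (\<Sum>k\<in>A. u k) = (\<Sum>k\<in>A. lin f (u k))"
  by (induct rule: finite_induct) (simp_all add: lin_add)

abbreviation aug_map :: "('g::group_add \<Rightarrow>\<^sub>0 'f::field) \<Rightarrow> 'f" where "aug_map \<equiv> lin (\<lambda>_. 1)"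

lemma aug_map_mult: "aug_map (r * s) = aug_map r * aug_map s"
proof (induct r rule: group_algebra_induct)
  case (single g c)
  show ?case
    by (induct s rule: group_algebra_induct) (simp_all add: distrib_left lin_add mult_single)
qed (simp add: distrib_right lin_add)

lemma aug_map_1 [simp]: "aug_map 1 = 1"
  using lin_single[of "\<lambda>_. 1" 0 1] by simp

lemma aug_map_power: "aug_map (r ^ n) = aug_map r ^ n"
  by (induct n) (simp_all add: aug_map_mult)

section \<open>The adic filtration for cyclic G'\<close>

locale cyclic_derived = lie_nilpotent_algebra p ty
  for p :: nat and ty :: "('g::group_add \<Rightarrow>\<^sub>0 'f::field) itself" +
  fixes x :: 'g and e :: nat
  assumes x_G': "x \<in> G'" and gen: "\<And>h :: 'g. h \<in> G' \<Longrightarrow> \<exists>t. h = nmul t x"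
    and card_eq: "card (G' :: 'g set) = p ^ e"
begin

abbreviation q :: nat where "q \<equiv> p ^ e"

lemma q_pos [simp]: "q > 0"
  by simp

lemma qx: "nmul q x = 0"
  using card_G'_nmul[OF x_G'] card_eq by simp

lemma nmul_mod: "nmul (t mod q) x = nmul t x"
proof -
  have "nmul t x = nmul (t mod q + t div q * q) x" by (simp only: mod_div_mult_eq)
  also have "\<dots> = nmul (t mod q) x" by (simp only: nmul_add nmul_mult qx) simp
  finally show ?thesis ..
qed

lemma G'_eq: "G' = (\<lambda>j. nmul j x) ` {..<q}"
proof (intro equalityI subsetI)
  fix h :: 'g assume "h \<in> G'"
  then obtain t where "h = nmul t x" using gen by blast
  then show "h \<in> (\<lambda>j. nmul j x) ` {..<q}"
    by (intro image_eqI[of _ _ "t mod q"]) (simp_all add: nmul_mod)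
qed (use subgrp_nmul[OF subgrp_G' x_G'] in auto)

lemma nmul_inj: "inj_on (\<lambda>j. nmul j x) {..<q}"
  by (rule eq_card_imp_inj_on) (simp_all flip: G'_eq add: card_eq)

lemma minus_nmul_x: "- nmul t x = nmul ((q - 1) * t) x"
  by (rule minus_nmul[OF qx]) simp

definition Y :: "'g \<Rightarrow>\<^sub>0 'f" where "Y = gel x - 1"

lemma Yx: "gel x * Y = Y * gel x"
  unfolding Y_def by (simp add: algebra_simps)

lemma Yx_power: "gel x * Y ^ k = Y ^ k * gel x"
proof (induct k)
  case (Suc k)
  have "gel x * Y ^ Suc k = Y * (gel x * Y ^ k)" by (simp add: Yx flip: mult.assoc)
  then show ?case by (simp add: Suc mult.assoc)
qed simp

lemma multiples_closed:
  fixes A :: "'g \<Rightarrow>\<^sub>0 'f"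
  shows "u \<in> range ((*) A) \<Longrightarrow> v \<in> range ((*) A) \<Longrightarrow> u + v \<in> range ((*) A)"
    and "u \<in> range ((*) A) \<Longrightarrow> u * s \<in> range ((*) A)"
  by (auto simp: mult.assoc simp flip: distrib_left)

text \<open>By \<open>cyclic_gcomm\<close> the bracket is a multiple of Y^p, and p >= 3. The gain of
  two weights makes Y central to first order, so multiplying by Y does not disturb the eigenvalues
  used below.\<close>

lemma lie_Y3: "lie r Y \<in> range ((*) (Y ^ 3))"
proof (rule lie_closed_left[OF multiples_closed])
  fix g
  obtain t where t: "gcomm x (- g) = nmul (p * t) x" using cyclic_gcomm[OF x_G' gen] by blast
  obtain s where s: "gel (nmul (p * t) x) - 1 = Y ^ p * s" using gel_p_multiple unfolding Y_def by blast
  have "g + x = x + gcomm x (- g) + g"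
    by (simp add: gcomm_def group_word_simps del: add_uminus_conv_diff)
  then have "gel g * gel x = (gel x * gel (nmul (p * t) x) * gel g :: 'g \<Rightarrow>\<^sub>0 'f)"
    by (simp only: gel_mult t)
  then have "lie (gel g) Y = gel x * (gel (nmul (p * t) x) - 1) * gel g"
    unfolding Y_def by (simp add: algebra_simps)
  also have "\<dots> = Y ^ p * (gel x * s * gel g)"
    unfolding s using Yx_power[of p] by (simp only: mult.assoc[symmetric])
  also have "\<dots> = Y ^ (3 + (p - 3)) * (gel x * s * gel g)" using p_ge_3 by simp
  finally have "lie (gel g) Y = Y ^ 3 * (Y ^ (p - 3) * (gel x * s * gel g))"
    by (simp only: power_add mult.assoc)
  then show "lie (gel g) Y \<in> range ((*) (Y ^ 3))" by blast
qed

lemma lie_UNIV_Y: "lie r s \<in> range ((*) Y)"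
proof (rule lie_closed[OF multiples_closed])
  fix a b
  obtain t where t: "a + b - a - b = nmul t x" using gen commutator_in_G' by blast
    have "a + b = (a + b - a - b) + (b + a)" by (simp add: group_word_simps del: add_uminus_conv_diff)
    then have "gel a * gel b = (gel (nmul t x) * gel (b + a) :: 'g \<Rightarrow>\<^sub>0 'f)"
      by (simp only: gel_mult t)
    then have "lie (gel a) (gel b) = (gel (nmul t x) - 1) * (gel (b + a) :: 'g \<Rightarrow>\<^sub>0 'f)"
      by (simp add: algebra_simps gel_mult)
    also have "gel (nmul t x) - 1 = Y * (\<Sum>j<t. gel x ^ j)"
      unfolding Y_def gel_power[symmetric] by (rule power_diff_one_factor)
    finally have "lie (gel a) (gel b) = Y * ((\<Sum>j<t. gel x ^ j) * gel (b + a))"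
      by (simp only: mult.assoc)
    then show "lie (gel a) (gel b) \<in> range ((*) Y)" by blast
qed

text \<open>With C = 0 and zero modulus, J k is the set of multiples of Y^k.\<close>

sublocale W: weighted_filtration "{0}" Y 0
proof unfold_locales
  fix r s
  obtain u where "lie r Y = Y ^ 3 * u" using lie_Y3 by blast
  then show "\<exists>s t. lie r Y - (Y * Y * s + 0 * t) \<in> {0}"
    by (intro exI[of _ "Y * u"]) (simp add: power3_eq_cube mult.assoc)
  obtain v where "lie r s = Y * v" using lie_UNIV_Y by blast
  then show "\<exists>u v. lie r s - (Y * u + 0 * v) \<in> {0}" by (intro exI[of _ v]) simp
qed (simp_all add: two_sided_ideal_zero)

lemma J_iff: "u \<in> W.J k \<longleftrightarrow> (\<exists>r. u = Y ^ k * r)"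
  unfolding W.J_def by simp

lemma J_mult: assumes "u \<in> W.J i" "v \<in> W.J k" shows "u * v \<in> W.J (i + k)"
proof -
  obtain r where r: "u = Y ^ i * r" using assms(1) J_iff by blast
  have "r * v \<in> W.J k" by (rule ideal_mult_left[OF W.J_ideal assms(2)])
  then show ?thesis using W.J_Y_power_mult[of "r * v" k i] by (simp add: r mult.assoc add.commute)
qed

lemma Y_power_q: "Y ^ q = 0"
  unfolding Y_def gel_diff_one_power qx by simp

lemma J_q: "W.J q = {0}"
  by (auto simp: J_iff Y_power_q)

lemma upper_lie_q: "upper_lie q = ({0} :: ('g \<Rightarrow>\<^sub>0 'f) set)"
  using W.upper_lie_subset_J[of q] J_q ideal_0[OF upper_lie_ideal] by blast

lemma lie_Y_power3: "lie r (Y ^ k) \<in> W.J (k + 2)"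
proof (induct k arbitrary: r)
  case 0
  show ?case using ideal_0[OF W.J_ideal] by simp
next
  case (Suc k)
  obtain s where s: "lie r Y = Y ^ 3 * s" using lie_Y3 by blast
  have "lie r (Y ^ Suc k) = lie r Y * Y ^ k + Y * lie r (Y ^ k)"
    by (simp add: algebra_simps)
  moreover have "lie r Y * Y ^ k \<in> W.J (3 + k)"
    by (rule J_mult) (auto simp: J_iff s intro: exI[of _ 1])
  moreover have "Y * lie r (Y ^ k) \<in> W.J (3 + k)"
    using W.J_Y_mult[OF Suc[of r]] by (simp add: numeral_3_eq_3)
  ultimately show ?case using W.J_add by (simp add: numeral_3_eq_3)
qed

text \<open>In characteristic p all signed binomial coefficients in the expansion of (x - 1)^(q - 1)
  equal 1.\<close>

lemma Y_power_sum: "Y ^ (q - 1) = (\<Sum>j<q. gel (nmul j x))"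
proof -
  have ca: "commuting_additive (\<lambda>y. gel x * y) (\<lambda>y :: 'g \<Rightarrow>\<^sub>0 'f. y)"
    by unfold_locales (simp_all add: distrib_left)
  have 1: "((\<lambda>y. gel x * y) ^^ n) 1 = (gel (nmul n x) :: 'g \<Rightarrow>\<^sub>0 'f)" for n
    by (induct n) (simp_all add: gel_mult)
  have 2: "((\<lambda>y. gel x * y - y) ^^ n) 1 = Y ^ n" for n
    by (induct n) (simp_all add: left_diff_distrib Y_def)
  have 3: "((\<lambda>y :: 'g \<Rightarrow>\<^sub>0 'f. y) ^^ n) u = u" for n u by (induct n) simp_all
  have "Y ^ (q - 1) = (\<Sum>k\<le>q - 1. (-1)^k * of_nat ((q - 1) choose k) * gel (nmul (q - 1 - k) x))"
    using commuting_additive.diff_funpow[of "\<lambda>y :: 'g \<Rightarrow>\<^sub>0 'f. gel x * y" "\<lambda>y. y" "q - 1" 1] ca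
    by (simp only: 1 2 3 simp_thms)
  also have "\<dots> = (\<Sum>k\<le>q - 1. gel (nmul (q - 1 - k) x))"
  proof (rule sum.cong[OF refl])
    fix k assume "k \<in> {..q - 1}"
    moreover have "q - 1 < q" by (rule diff_less) simp_all
    ultimately have "k < q" unfolding atMost_iff by (rule le_less_trans)
    then have "(-1)^k * of_nat ((q - 1) choose k) = (1 :: 'g \<Rightarrow>\<^sub>0 'f)"
      by (rule of_nat_choose_prime_power_minus_one[OF prime_p of_nat_p])
    then show "(-1)^k * of_nat ((q - 1) choose k) * gel (nmul (q - 1 - k) x) = (gel (nmul (q - 1 - k) x) :: 'g \<Rightarrow>\<^sub>0 'f)"
      by simp
  qed
  also have "\<dots> = (\<Sum>j\<le>q - 1. gel (nmul j x))"
    by (rule sum.reindex_bij_witness[of _ "\<lambda>k. q - 1 - k" "\<lambda>k. q - 1 - k"]) auto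
  also have "{..q - 1} = {..<Suc (q - 1)}" by (rule lessThan_Suc_atMost[symmetric])
  also have "Suc (q - 1) = q" using q_pos by simp
  finally show ?thesis .
qed

text \<open>The choice is made from the coset as a set, which makes the result the same for all its
  elements (\<open>coset_rep_shift\<close>).\<close>

definition coset_rep :: "'g \<Rightarrow> 'g" where
  "coset_rep g = (SOME h. h \<in> range (\<lambda>j. g + nmul j x))"

lemma coset_rep_shift: "coset_rep (g + nmul i x) = coset_rep g"
proof -
  have "range (\<lambda>j. g + nmul i x + nmul j x) = range (\<lambda>j. g + nmul j x)"
  proof (intro equalityI subsetI)
    fix h assume "h \<in> range (\<lambda>j. g + nmul j x)"
    then obtain j where "h = g + nmul j x" by blast
    then have "h = g + nmul i x + (- nmul i x + nmul j x)"
      by (simp add: group_word_simps del: add_uminus_conv_diff)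
    also have "\<dots> = g + nmul i x + nmul ((q - 1) * i + j) x"
      by (simp only: minus_nmul_x nmul_add)
    finally have "h = g + nmul i x + nmul ((q - 1) * i + j) x" .
    then show "h \<in> range (\<lambda>j. g + nmul i x + nmul j x)" by blast
  next
    fix h assume "h \<in> range (\<lambda>j. g + nmul i x + nmul j x)"
    then show "h \<in> range (\<lambda>j. g + nmul j x)" by (auto simp: add.assoc simp flip: nmul_add)
  qed
  then show ?thesis unfolding coset_rep_def by simp
qed

lemma coset_rep: "\<exists>j<q. coset_rep g = g + nmul j x"
proof -
  have "coset_rep g \<in> range (\<lambda>j. g + nmul j x)" unfolding coset_rep_def by (rule someI_ex) blast
  then obtain j where "coset_rep g = g + nmul j x" by blast
  then show ?thesis by (intro exI[of _ "j mod q"]) (simp add: nmul_mod)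
qed

text \<open>\<open>Y\<^sup>q\<^sup>-\<^sup>1\<close> is the sum of the elements of \<open>G'\<close>, so the sum of the coefficients of \<open>r\<close> over \<open>S\<close> is
  obtained by evaluating \<open>r Y\<^sup>q\<^sup>-\<^sup>1\<close> at one representative of each coset of \<open>G'\<close> in \<open>S\<close>.\<close>

lemma annihilator_Y_power:
  fixes S :: "'g set"
  assumes S: "\<And>g i. g + nmul i x \<in> S \<longleftrightarrow> g \<in> S" and zero: "r * Y ^ (q - 1) = 0"
  shows "lin (\<lambda>g. if g \<in> S then 1 else 0) r = (0 :: 'f)"
proof -
  define f0 where "f0 k = (if k \<in> S \<and> coset_rep k = k then 1 else 0 :: 'f)" for k
  have "lin f0 (r * Y ^ (q - 1)) = lin (\<lambda>g. if g \<in> S then 1 else 0) r" for r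
  proof (induct r rule: group_algebra_induct)
    case (add r s)
    then show ?case by (simp add: distrib_right lin_add)
  next
    case (single g c)
    obtain j0 where j0: "j0 < q" "coset_rep g = g + nmul j0 x" using coset_rep by blast
    have f0: "f0 (g + nmul j x) = (if j = j0 then (if g \<in> S then 1 else 0) else 0)" if "j < q" for j
      using that j0 nmul_inj by (auto simp: f0_def coset_rep_shift S inj_on_def)
    have "lin f0 (Poly_Mapping.single g c * Y ^ (q - 1)) = (\<Sum>j<q. f0 (g + nmul j x) * c)"
      unfolding Y_power_sum by (simp add: sum_distrib_left mult_single lin_sum)
    also have "\<dots> = (\<Sum>j<q. if j = j0 then (if g \<in> S then 1 else 0) * c else 0)"
      by (rule sum.cong) (auto simp: f0)
    also have "\<dots> = (if g \<in> S then 1 else 0) * c" using j0 by simp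
    finally show ?case by simp
  qed
  from this[of r] show ?thesis unfolding zero by simp
qed

lemma x_nonzero: assumes "q > 1" shows "x \<noteq> 0"
proof
  assume "x = 0"
  then have "G' \<subseteq> {0 :: 'g}" using gen by auto
  then have "q \<le> 1" using card_mono[of "{0 :: 'g}" G'] card_eq by simp
  then show False using assms by simp
qed

lemma of_nat_nonzero: "\<not> p dvd n \<Longrightarrow> of_nat n \<noteq> (0 :: 'f)"
  using of_nat_eq_0_iff_char_dvd[where 'a='f] char_p by simp

text \<open>Otherwise all commutators are p-th powers of elements of G'; these form a subgroup,
  which would then contain x.\<close>

lemma noncommuting_pair:
  assumes "q > 1"
  obtains a b :: 'g and n where "gcomm a b = nmul n x" "\<not> p dvd n"
proof (rule ccontr)
  assume no: "\<not> thesis"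
  define H where "H = {nmul (p * t) x | t. True}"
  have "subgrp H" unfolding H_def by (rule p_multiples_subgrp[OF qx])
  moreover have "a + b - a - b \<in> H" for a b
  proof -
    obtain n where n: "gcomm (- a) (- b) = nmul n x" using gen[OF gcomm_in_G'] by blast
    then have "p dvd n" using no that by blast
    then show ?thesis using n unfolding H_def gcomm_def by (auto elim!: dvdE)
  qed
  ultimately have "G' \<subseteq> H" by (rule G'_subset)
  then have "x \<in> H" using x_G' by blast
  then have "x = 0" unfolding H_def using not_p_multiple[OF x_G'] by blast
  then show False using x_nonzero[OF assms] by blast
qed

end

subsection \<open>Commutation with a group element\<close>

definition twist :: "'g \<Rightarrow> ('g::group_add \<Rightarrow>\<^sub>0 'f::field) \<Rightarrow> ('g \<Rightarrow>\<^sub>0 'f)" where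
  "twist b r = gel (- b) * lie r (gel b)"

lemma twist_conj: "twist b r = gel (- b) * r * gel b - r"
  by (simp add: twist_def right_diff_distrib flip: mult.assoc)

lemma twist_add: "twist b (r + s) = twist b r + twist b s"
  by (simp add: twist_def algebra_simps)

lemma twist_diff: "twist b (r - s) = twist b r - twist b s"
  by (simp add: twist_def algebra_simps)

lemma twist_1 [simp]: "twist b 1 = 0"
  by (simp add: twist_def)

lemma twist_single_mult: "twist b (Poly_Mapping.single 0 c * r) = Poly_Mapping.single 0 c * twist b r"
proof -
  have "gel (- b) * (Poly_Mapping.single 0 c * r) = Poly_Mapping.single 0 c * (gel (- b) * r)"
    by (simp only: mult.assoc[symmetric] scalar_central[of c "gel (- b)"])
  then show ?thesis by (simp only: twist_conj right_diff_distrib mult.assoc)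
qed

text \<open>\<open>twist b\<close> is conjugation by b minus the identity, and conjugation is
  multiplicative.\<close>

lemma twist_mult: "twist b (u * v) = twist b u * v + u * twist b v + twist b u * twist b v"
  for u v :: "'g::group_add \<Rightarrow>\<^sub>0 'f::field"
proof -
  have "gel (- b) * (u * v) * gel b = (gel (- b) * u * gel b) * (gel (- b) * v * gel b)"
  proof -
    have "gel b * (gel (- b) * w) = w" for w :: "'g \<Rightarrow>\<^sub>0 'f" by (simp flip: mult.assoc)
    then show ?thesis by (simp add: mult.assoc)
  qed
  then show ?thesis unfolding twist_conj by (simp add: algebra_simps)
qed

lemma iterated_lie_twist:
  "((\<lambda>y. lie y (gel b)) ^^ m) r = gel b ^ m * (twist b ^^ m) r"
proof (induct m)
  case (Suc m)
  let ?w = "(twist b ^^ m) r"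
  have "lie (gel b ^ m * ?w) (gel b) = gel b ^ m * lie ?w (gel b)"
    by (simp add: right_diff_distrib mult.assoc) (simp add: power_commutes flip: mult.assoc)
  also have "lie ?w (gel b) = gel b * twist b ?w"
    by (simp add: twist_def flip: mult.assoc)
  finally show ?case using Suc by (simp add: power_commutes flip: mult.assoc)
qed simp

lemma single_power: "Poly_Mapping.single 0 c ^ n = (Poly_Mapping.single 0 (c ^ n) :: 'g::group_add \<Rightarrow>\<^sub>0 'f::field)"
  by (induct n) (simp_all add: mult_single)

context cyclic_derived
begin

abbreviation sc :: "'f \<Rightarrow> ('g \<Rightarrow>\<^sub>0 'f)" where "sc c \<equiv> Poly_Mapping.single 0 c"

lemma twist_J: assumes "r \<in> W.J k" shows "twist b r \<in> W.J (k + 1)"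
proof -
  have "- lie (gel b) r \<in> W.J (k + 1)" by (rule ideal_uminus[OF W.J_ideal W.lie_J[OF assms]])
  then show ?thesis unfolding twist_def by (simp add: ideal_mult_left[OF W.J_ideal])
qed

lemma twist_iter_J: "r \<in> W.J k \<Longrightarrow> (twist b ^^ m) r \<in> W.J (k + m)"
  by (induct m) (use twist_J in auto)

lemma J_0: "r \<in> W.J 0"
  by (simp add: J_iff)

lemma J_le: "r \<in> W.J k \<Longrightarrow> i \<le> k \<Longrightarrow> r \<in> W.J i"
  using W.J_antimono by blast

text \<open>\<open>u\<close> is an eigenvector of \<open>twist b\<close> in the first graded layer; the eigenvalue is in \<open>F\<^sub>p\<close>.\<close>

definition eig :: "'g \<Rightarrow> nat \<Rightarrow> ('g \<Rightarrow>\<^sub>0 'f) \<Rightarrow> bool" where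
  "eig b c u \<longleftrightarrow> twist b u - sc (of_nat c) * u * Y \<in> W.J 2"

text \<open>First-order expansion of x^n = (1 + Y)^n.\<close>

lemma gel_linear: "gel (nmul n x) - 1 - sc (of_nat n) * Y \<in> W.J 2"
proof (induct n)
  case 0
  show ?case using ideal_0[OF W.J_ideal] by simp
next
  case (Suc n)
  have "gel (nmul (Suc n) x) - 1 - sc (of_nat (Suc n)) * Y
      = gel x * (gel (nmul n x) - 1 - sc (of_nat n) * Y) + sc (of_nat n) * (Y * Y)"
  proof -
    have 1: "gel (nmul (Suc n) x) = gel x * (gel (nmul n x) :: 'g \<Rightarrow>\<^sub>0 'f)" by (simp add: gel_mult)
    have 2: "sc (of_nat (Suc n)) = 1 + sc (of_nat n)" by (simp add: single_add)
    have 3: "gel x * (sc (of_nat n) * Y) = sc (of_nat n) * (gel x * Y)"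
      by (simp only: mult.assoc[symmetric] scalar_central[of "of_nat n" "gel x"])
    have 4: "gel x = 1 + Y" by (simp add: Y_def)
    show ?thesis unfolding 1 2 right_diff_distrib 3 unfolding 4 by (simp add: algebra_simps)
  qed
  also have "\<dots> \<in> W.J 2"
  proof (rule ideal_add[OF W.J_ideal ideal_mult_left[OF W.J_ideal Suc] ideal_mult_left[OF W.J_ideal]])
    show "Y * Y \<in> W.J 2" using W.J_Y[of 2 1] by (simp add: power2_eq_square)
  qed
  finally show ?case .
qed

lemma eig_gel:
  assumes "gcomm h b = nmul n x" shows "eig b n (gel h)"
proof -
  have "- b + h + b = h + nmul n x" using conj_by_gcomm[of b h] assms by simp
  then have 1: "twist b (gel h) = gel h * (gel (nmul n x) - 1)"
    unfolding twist_conj by (simp add: gel_mult right_diff_distrib)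
  have 2: "sc (of_nat n) * gel h * Y = gel h * (sc (of_nat n) * Y)"
    by (simp only: mult.assoc[symmetric] scalar_central[of "of_nat n" "gel h"])
  have "twist b (gel h) - sc (of_nat n) * gel h * Y
      = gel h * (gel (nmul n x) - 1 - sc (of_nat n) * Y)"
    unfolding 1 2 by (simp only: right_diff_distrib)
  then show ?thesis unfolding eig_def using ideal_mult_left[OF W.J_ideal gel_linear] by simp
qed

text \<open>Up to weight 2 \<open>twist b\<close> is a derivation, and Y may be moved across
  v.\<close>

lemma eig_mult:
  assumes u: "eig b c u" and v: "eig b d v"
  shows "eig b (c + d) (u * v)"
proof -
  note I = W.J_ideal[of 2]
  have 1: "sc (of_nat (c + d)) = sc (of_nat c) + sc (of_nat d)" by (simp add: single_add)
  have 2: "sc (of_nat d) * (u * v) * Y = u * (sc (of_nat d) * v * Y)"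
    by (simp only: mult.assoc[symmetric] scalar_central[of "of_nat d" u])
  have "twist b (u * v) - sc (of_nat (c + d)) * (u * v) * Y
     = (twist b u - sc (of_nat c) * u * Y) * v + sc (of_nat c) * u * - lie v (Y ^ 1)
       + u * (twist b v - sc (of_nat d) * v * Y) + twist b u * twist b v"
    unfolding twist_mult 1 distrib_right 2 by (simp add: algebra_simps)
  also have "\<dots> \<in> W.J 2"
  proof (intro ideal_add[OF I])
    show "(twist b u - sc (of_nat c) * u * Y) * v \<in> W.J 2"
      using u unfolding eig_def by (rule ideal_mult_right[OF I])
    show "u * (twist b v - sc (of_nat d) * v * Y) \<in> W.J 2"
      using v unfolding eig_def by (rule ideal_mult_left[OF I])
    show "sc (of_nat c) * u * - lie v (Y ^ 1) \<in> W.J 2"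
      by (intro ideal_mult_left[OF I] ideal_uminus[OF I] J_le[OF lie_Y_power3]) simp
    show "twist b u * twist b v \<in> W.J 2"
      using J_mult[OF twist_J[OF J_0, of b u] twist_J[OF J_0, of b v]] by (simp add: numeral_2_eq_2)
  qed
  finally show ?thesis unfolding eig_def .
qed

lemma eig_zero_1: "eig b 0 1"
  using ideal_0[OF W.J_ideal] by (simp add: eig_def)

lemma eig_power: "eig b c u \<Longrightarrow> eig b (i * c) (u ^ i)"
  by (induct i) (simp_all add: eig_mult eig_zero_1 del: One_nat_def)

lemma eig_shift:
  assumes u: "eig b c u"
  shows "twist b (u * Y ^ k) - sc (of_nat c) * u * Y ^ (k + 1) \<in> W.J (k + 2)"
proof -
  note I = W.J_ideal[of "k + 2"]
  have "- lie (gel b) (Y ^ k) \<in> W.J (k + 2)" by (rule ideal_uminus[OF I lie_Y_power3])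
  then have "gel (- b) * - lie (gel b) (Y ^ k) \<in> W.J (k + 2)" by (rule ideal_mult_left[OF I])
  then have tY: "twist b (Y ^ k) \<in> W.J (k + 2)" by (simp add: twist_def)
  have "twist b (u * Y ^ k) - sc (of_nat c) * u * Y ^ (k + 1)
     = (twist b u - sc (of_nat c) * u * Y) * Y ^ k + u * twist b (Y ^ k) + twist b u * twist b (Y ^ k)"
    unfolding twist_mult by (simp add: algebra_simps)
  also have "\<dots> \<in> W.J (k + 2)"
  proof (intro ideal_add[OF I])
    have "Y ^ k \<in> W.J k" using W.J_Y[of k 1] by simp
    from J_mult[OF u[unfolded eig_def] this]
    show "(twist b u - sc (of_nat c) * u * Y) * Y ^ k \<in> W.J (k + 2)" by (simp only: add.commute)
    show "u * twist b (Y ^ k) \<in> W.J (k + 2)" "twist b u * twist b (Y ^ k) \<in> W.J (k + 2)"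
      by (rule ideal_mult_left[OF I tY])+
  qed
  finally show ?thesis .
qed

text \<open>It is applied with k + m + 1 = q, where the error term is zero and the iterate is known
  exactly.\<close>

lemma eig_iter:
  assumes u: "eig b c u"
  shows "(twist b ^^ m) (u * Y ^ k) - sc (of_nat c ^ m) * u * Y ^ (k + m) \<in> W.J (k + m + 1)"
proof (induct m)
  case 0
  show ?case using ideal_0[OF W.J_ideal] by simp
next
  case (Suc m)
  note I = W.J_ideal[of "k + m + 2"]
  let ?T = "(twist b ^^ m) (u * Y ^ k)" and ?s = "sc (of_nat c ^ m)"
  have 1: "sc (of_nat c ^ Suc m) = ?s * sc (of_nat c)"
    by (simp only: mult_single power_Suc2 add_0_left)
  have "twist b ?T - sc (of_nat c ^ Suc m) * u * Y ^ (k + m + 1)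
      = twist b (?T - ?s * (u * Y ^ (k + m)))
        + ?s * (twist b (u * Y ^ (k + m)) - sc (of_nat c) * u * Y ^ (k + m + 1))"
    unfolding twist_diff twist_single_mult 1 right_diff_distrib by (simp add: mult.assoc)
  also have "\<dots> \<in> W.J (k + m + 2)"
    using twist_J[OF Suc, of b] ideal_mult_left[OF I eig_shift[OF u, of "k + m"], of ?s]
    by (intro ideal_add[OF I]) (simp_all add: mult.assoc)
  finally show ?case by simp
qed

text \<open>Substituting Y = Y^2 s into itself drives Y into every J k, hence to 0.\<close>

lemma Y_notin_J2: assumes "q > 1" shows "Y \<notin> W.J 2"
proof
  assume Y: "Y \<in> W.J 2"
  then obtain s where s: "Y = Y ^ 2 * s" unfolding J_iff by blast
  have "Y \<in> W.J (2 + k)" for k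
  proof (induct k)
    case (Suc k)
    have "Y = Y * (Y * s)" using s by (simp add: power2_eq_square mult.assoc)
    moreover have "Y * (Y * s) \<in> W.J (Suc (2 + k))"
      using W.J_Y_mult[OF ideal_mult_right[OF W.J_ideal Suc, of s]] by simp
    ultimately show ?case by simp
  qed (use Y in simp)
  from this[of q] have "Y \<in> W.J q" by (rule J_le) simp
  then have "gel x = (gel 0 :: 'g \<Rightarrow>\<^sub>0 'f)" using J_q by (simp add: Y_def)
  then have "x = 0" by (simp only: gel_eq_iff)
  then show False using x_nonzero[OF assms] by blast
qed

text \<open>Two eigenvalues would put a nonzero scalar multiple of h Y into J 2, and h and the
  scalar can be cancelled.\<close>

lemma eig_gel_unique:
  assumes q: "q > 1" and c: "eig b c (gel h)"
  shows "eig b d (gel h) \<longleftrightarrow> of_nat c = (of_nat d :: 'f)"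
proof
  assume "of_nat c = (of_nat d :: 'f)"
  then show "eig b d (gel h)" using c unfolding eig_def by simp
next
  note I = W.J_ideal[of 2]
  assume d: "eig b d (gel h)"
  show "of_nat c = (of_nat d :: 'f)"
  proof (rule ccontr)
    assume ne: "of_nat c \<noteq> (of_nat d :: 'f)"
    define k where "k = of_nat c - (of_nat d :: 'f)"
    have "sc (of_nat c) * gel h * Y - sc (of_nat d) * gel h * Y \<in> W.J 2"
      using ideal_diff[OF I d[unfolded eig_def] c[unfolded eig_def]] by simp
    then have "sc k * gel h * Y \<in> W.J 2" unfolding k_def by (simp add: single_diff left_diff_distrib)
    then have mem: "gel (- h) * (sc (inverse k) * (sc k * gel h * Y)) \<in> W.J 2"
      by (rule ideal_mult_left[OF I ideal_mult_left[OF I]])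
    have "sc (inverse k) * sc k = 1"
      using ne by (simp add: k_def mult_single)
    then have "gel (- h) * (sc (inverse k) * sc k) * gel h * Y = Y" by simp
    then have "Y \<in> W.J 2" using mem by (simp only: mult.assoc)
    then show False using Y_notin_J2[OF q] by simp
  qed
qed

lemma eig_cong: "of_nat c = (of_nat d :: 'f) \<Longrightarrow> eig b c u \<longleftrightarrow> eig b d u"
  unfolding eig_def by simp

lemma eig_nmul_x: "eig b 0 (gel (nmul i x))"
proof -
  obtain t where t: "gcomm x b = nmul (p * t) x" using cyclic_gcomm[OF x_G' gen] by blast
  have "of_nat (p * t) = (of_nat 0 :: 'f)" using char_p of_nat_CHAR[where 'a='f] by simp
  then have "eig b 0 (gel x)" using eig_gel[OF t] eig_cong by metis
  from eig_power[OF this, of i] show ?thesis by (simp add: gel_power)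
qed

text \<open>The elements of G' have eigenvalue 0. So the set of h with a given eigenvalue is a union
  of cosets, as \<open>annihilator_Y_power\<close> requires.\<close>

lemma eig_translate: "eig b n (gel (g + nmul i x)) \<longleftrightarrow> eig b n (gel g)"
proof -
  have step: "eig b n (gel g) \<Longrightarrow> eig b n (gel (g + nmul i x))" for g i
    using eig_mult[OF _ eig_nmul_x[of b i], of n "gel g"] by (simp add: gel_mult)
  have "g + nmul i x + nmul ((q - 1) * i) x = g"
    unfolding minus_nmul_x[symmetric] by (simp add: group_word_simps del: add_uminus_conv_diff)
  then show ?thesis using step[of g i] step[of "g + nmul i x" "(q - 1) * i"] by (auto simp only:)
qed

end

subsection \<open>The involution\<close>

locale oriented_group =
  fixes \<sigma> :: "'g::group_add \<Rightarrow> int"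
  assumes orientation: "orientation \<sigma>"
begin

lemma \<sigma>_values: "\<sigma> g = 1 \<or> \<sigma> g = -1"
  using orientation unfolding orientation_def hom_def sign_img_def by auto

lemma \<sigma>_add: "\<sigma> (g + h) = \<sigma> g * \<sigma> h"
  using orientation unfolding orientation_def hom_def sign_img_def by auto

lemma \<sigma>_sq [simp]: "\<sigma> g * \<sigma> g = 1"
  using \<sigma>_values[of g] by auto

lemma \<sigma>_0 [simp]: "\<sigma> 0 = 1"
  using \<sigma>_add[of 0 0] \<sigma>_values[of 0] by auto

lemma \<sigma>_minus [simp]: "\<sigma> (- g) = \<sigma> g"
  using \<sigma>_add[of g "- g"] \<sigma>_values[of g] \<sigma>_values[of "- g"] by auto

lemma \<sigma>_nmul: "\<sigma> (nmul n g) = \<sigma> g ^ n"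
  by (induct n) (simp_all add: \<sigma>_add)

abbreviation cinv :: "('g \<Rightarrow>\<^sub>0 'f::field) \<Rightarrow> ('g \<Rightarrow>\<^sub>0 'f)" where "cinv \<equiv> classical_involution \<sigma>"

lemma cinv_add: "cinv (r + s) = cinv r + cinv s"
  unfolding classical_involution_def
  by (rule sum_keys_add) (simp_all add: distrib_right single_add)

lemma cinv_single [simp]: "cinv (Poly_Mapping.single g c) = Poly_Mapping.single (- g) (c * of_int (\<sigma> g))"
  by (cases "c = 0") (simp_all add: classical_involution_def)

lemma cinv_0 [simp]: "cinv 0 = 0"
  by (simp add: classical_involution_def)

lemma cinv_1 [simp]: "cinv 1 = 1"
  using cinv_single[of 0 1] by (simp del: cinv_single)

lemma cinv_uminus: "cinv (- r) = - cinv r"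
  using cinv_add[of r "- r"] by (simp add: eq_neg_iff_add_eq_0 add.commute)

lemma cinv_diff: "cinv (r - s) = cinv r - cinv s"
  using cinv_add[of r "- s"] by (simp add: cinv_uminus)

lemma cinv_mult: "cinv (r * s) = cinv s * cinv r"
proof (induct r rule: group_algebra_induct)
  case (single g c)
  show ?case
    by (induct s rule: group_algebra_induct)
      (simp_all add: distrib_left distrib_right cinv_add mult_single minus_add \<sigma>_add mult_ac)
qed (simp add: distrib_right distrib_left cinv_add)

lemma cinv_cinv [simp]: "cinv (cinv r) = r" for r :: "'g \<Rightarrow>\<^sub>0 'f::field"
proof (induct r rule: group_algebra_induct)
  case (single g c)
  have "of_int (\<sigma> g) * of_int (\<sigma> g) = (1 :: 'f)"
    by (metis \<sigma>_sq of_int_1 of_int_mult)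
  then show ?case by (simp add: mult.assoc)
qed (simp add: cinv_add)

lemma symmetric_gel:
  "gel g + Poly_Mapping.single (- g) (of_int (\<sigma> g)) \<in> (symmetric_elements \<sigma> :: ('g \<Rightarrow>\<^sub>0 'f::field) set)"
proof -
  have "of_int (\<sigma> g) * of_int (\<sigma> g) = (1 :: 'f)"
    by (metis \<sigma>_sq of_int_1 of_int_mult)
  then show ?thesis by (simp add: symmetric_elements_def cinv_add)
qed

end

subsection \<open>The Lie nilpotency index of the symmetric elements\<close>

text \<open>The module over the center spanned by T. Central coefficients can be pulled out of both
  entries of a bracket, so brackets of spans stay in the span of brackets.\<close>

definition central_span :: "'a::ring_1 set \<Rightarrow> 'a set" where
  "central_span T = group_closure {\<zeta> * s | \<zeta> s. (\<forall>r. \<zeta> * r = r * \<zeta>) \<and> s \<in> T}"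

lemma central_span_base: "(\<And>r. \<zeta> * r = r * \<zeta>) \<Longrightarrow> s \<in> T \<Longrightarrow> \<zeta> * s \<in> central_span T"
  unfolding central_span_def by (rule group_closure.base) blast

lemma central_span_lie_gamma:
  assumes u: "u \<in> central_span (lie_gamma (Suc n) S)" and v: "v \<in> central_span S"
  shows "lie u v \<in> central_span (lie_gamma (Suc (Suc n)) S)"
  using u[unfolded central_span_def]
proof induct
  case (base u)
  show ?case
  \<comment> \<open>The base rule of \<open>group_closure\<close> admits 0 besides the
    generators.\<close>
  proof (cases "u = 0")
    case True
    then show ?thesis by (simp add: central_span_def)
  next
    case False
    then obtain \<zeta> s where u: "u = \<zeta> * s" "\<And>r. \<zeta> * r = r * \<zeta>" "s \<in> lie_gamma (Suc n) S" using base by auto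
    show ?thesis
      using v[unfolded central_span_def]
    proof induct
      case (base v)
      show ?case
      proof (cases "v = 0")
        case True
        then show ?thesis by (simp add: central_span_def)
      next
        case False
        then obtain \<eta> t where v: "v = \<eta> * t" "\<And>r. \<eta> * r = r * \<eta>" "t \<in> S" using base by auto
        have "\<zeta> * s * (\<eta> * t) = \<zeta> * (s * \<eta>) * t" by (simp only: mult.assoc)
        also have "s * \<eta> = \<eta> * s" by (rule v(2)[symmetric])
        finally have 1: "\<zeta> * s * (\<eta> * t) = \<zeta> * \<eta> * (s * t)" by (simp only: mult.assoc)
        have "\<eta> * t * (\<zeta> * s) = (\<eta> * t * \<zeta>) * s" by (simp only: mult.assoc)
        also have "\<eta> * t * \<zeta> = \<zeta> * (\<eta> * t)" by (rule u(2)[symmetric])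
        finally have 2: "\<eta> * t * (\<zeta> * s) = \<zeta> * \<eta> * (t * s)" by (simp only: mult.assoc)
        have eq: "lie u v = (\<zeta> * \<eta>) * lie s t" by (simp only: u(1) v(1) 1 2 right_diff_distrib)
        have "\<zeta> * \<eta> * r = r * (\<zeta> * \<eta>)" for r
        proof -
          have "\<zeta> * \<eta> * r = \<zeta> * r * \<eta>" by (simp only: mult.assoc v(2)[of r])
          then show ?thesis by (simp only: u(2)[of r] mult.assoc)
        qed
        then show ?thesis unfolding eq by (rule central_span_base) (rule lie_gamma_generator[OF u(3) v(3)])
      qed
    next
      case (diff v v')
      have "lie u (v - v') = lie u v - lie u v'" by (simp add: algebra_simps)
      then show ?case using diff unfolding central_span_def by (simp add: group_closure.diff)
    qed
  qed
next
  case (diff u u')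
  have "lie (u - u') v = lie u v - lie u' v" by (simp add: algebra_simps)
  then show ?case using diff unfolding central_span_def by (simp add: group_closure.diff)
qed

lemma gel_central:
  fixes z :: "'g::group_add" and r :: "'g \<Rightarrow>\<^sub>0 'f::field"
  assumes "\<And>g. z + g = g + z"
  shows "gel z * r = r * gel z"
proof (induct r rule: group_algebra_induct)
  case (add x y)
  then show ?case by (simp add: distrib_left distrib_right)
next
  case (single g c)
  show ?case by (simp add: mult_single assms)
qed

locale oriented_cyclic = cyclic_derived p ty x e + oriented_group \<sigma>
  for p :: nat and ty :: "('g::group_add \<Rightarrow>\<^sub>0 'f::field) itself" and x :: 'g and e :: nat
    and \<sigma> :: "'g \<Rightarrow> int" +
  assumes nontrivial: "\<exists>g. \<sigma> g \<noteq> 1"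
begin

lemma two_nonzero: "(2 :: 'f) \<noteq> 0"
proof -
  have "\<not> p dvd 2" using p_ge_3 by (auto dest: dvd_imp_le)
  then show ?thesis using of_nat_nonzero[of 2] by simp
qed

lemma central_odd_element: obtains z :: 'g where "\<And>g. z + g = g + z" "\<sigma> z = -1"
proof -
  obtain g where g: "\<sigma> g = -1" using nontrivial \<sigma>_values by blast
  obtain k where k: "\<And>g h :: 'g. nmul (p ^ k) g + h = h + nmul (p ^ k) g"
    using prime_power_central by blast
  show thesis
  proof (rule that[of "nmul (p ^ k) g"])
    show "nmul (p ^ k) g + h = h + nmul (p ^ k) g" for h by (rule k)
    show "\<sigma> (nmul (p ^ k) g) = -1" using odd_p by (simp add: \<sigma>_nmul g)
  qed
qed

text \<open>\<open>(z + z\<^sup>-\<^sup>1) g\<close> is a combination of symmetric elements with coefficients in \<open>{1, z\<^sup>-\<^sup>1}\<close>, and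
  \<open>z + z\<^sup>-\<^sup>1\<close> has augmentation 2.\<close>

lemma lie_gamma_symmetric_nontrivial:
  assumes q1: "q > 1"
  shows "lie_gamma q (symmetric_elements \<sigma> :: ('g \<Rightarrow>\<^sub>0 'f) set) \<noteq> {0}"
proof
  let ?S = "symmetric_elements \<sigma> :: ('g \<Rightarrow>\<^sub>0 'f) set"
  assume zero: "lie_gamma q ?S = {0}"
  obtain z :: 'g where z: "\<And>g. z + g = g + z" "\<sigma> z = -1"
    using central_odd_element by blast
  have z': "- z + g = g + - z" for g
  proof -
    have "- z + g = - z + (g + z) + - z"
      by (simp add: group_word_simps del: add_uminus_conv_diff)
    also have "g + z = z + g" by (rule z(1)[symmetric])
    finally show ?thesis by (simp only: minus_add_cancel)
  qed
  define \<theta> :: "'g \<Rightarrow>\<^sub>0 'f" where "\<theta> = gel z + gel (- z)"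
  have \<theta>: "\<theta> * r = r * \<theta>" for r
    unfolding \<theta>_def by (simp add: distrib_left distrib_right gel_central[OF z(1)] gel_central[OF z'])
  have span: "\<theta> * gel g \<in> central_span ?S" for g
  proof -
    \<comment> \<open>The terms in z^-1 g^-1 cancel, because \<sigma> (z + g) = - \<sigma>
      g.\<close>
    have "- (z + g) = - z + - g" using z'[of "- g"] by (simp add: minus_add)
    then have eq: "\<theta> * gel g = gel (- z) * (gel g + Poly_Mapping.single (- g) (of_int (\<sigma> g)))
        + 1 * (gel (z + g) + Poly_Mapping.single (- (z + g)) (of_int (\<sigma> (z + g))))"
      by (simp add: \<theta>_def distrib_left distrib_right mult_single \<sigma>_add z(2) single_uminus)
    have 1: "gel (- z) * (gel g + Poly_Mapping.single (- g) (of_int (\<sigma> g))) \<in> central_span ?S"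
      by (rule central_span_base) (rule gel_central[OF z'], rule symmetric_gel)
    have 2: "1 * (gel (z + g) + Poly_Mapping.single (- (z + g)) (of_int (\<sigma> (z + g)))) \<in> central_span ?S"
      by (rule central_span_base) (simp, rule symmetric_gel)
    show ?thesis using group_closure_add[OF 1[unfolded central_span_def] 2[unfolded central_span_def]]
      unfolding eq central_span_def by simp
  qed
  obtain a b :: 'g and n where ab: "gcomm a b = nmul n x" "\<not> p dvd n" using noncommuting_pair[OF q1] .
  \<comment> \<open>Every entry of the bracket contributes one central factor \<theta>.\<close>
  have iter: "\<theta> ^ Suc m * ((\<lambda>y. lie y (gel b)) ^^ m) (gel a) \<in> central_span (lie_gamma (Suc m) ?S)" for m
  proof (induct m)
    case 0
    show ?case using span[of a] by simp
  next
    case (Suc m)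
    let ?w = "((\<lambda>y. lie y (gel b)) ^^ m) (gel a)"
    have "lie (\<theta> ^ Suc m * ?w) (\<theta> * gel b) \<in> central_span (lie_gamma (Suc (Suc m)) ?S)"
      by (rule central_span_lie_gamma[OF Suc span])
    moreover have "\<theta> ^ Suc m * ?w * (\<theta> * gel b) = \<theta> ^ Suc (Suc m) * (?w * gel b)"
      using \<theta>[of "\<theta> ^ Suc m * ?w"] by (simp only: mult.assoc[symmetric]) (simp only: power_Suc mult.assoc)
    moreover have "\<theta> * gel b * (\<theta> ^ Suc m * ?w) = \<theta> ^ Suc (Suc m) * (gel b * ?w)"
    proof -
      have "gel b * \<theta> ^ k = \<theta> ^ k * gel b" for k
      proof (induct k)
        case (Suc k)
        have "gel b * \<theta> ^ Suc k = (gel b * \<theta>) * \<theta> ^ k" by (simp only: power_Suc mult.assoc)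
        also have "\<dots> = \<theta> * (gel b * \<theta> ^ k)" by (simp only: \<theta>[of "gel b", symmetric] mult.assoc)
        finally show ?case by (simp only: Suc power_Suc mult.assoc)
      qed simp
      note comm = this[of "Suc m"]
      have "\<theta> * gel b * (\<theta> ^ Suc m * ?w) = \<theta> * (gel b * \<theta> ^ Suc m) * ?w"
        by (simp only: mult.assoc)
      then show ?thesis unfolding comm by (simp only: power_Suc mult.assoc)
    qed
    ultimately show ?case by (simp add: right_diff_distrib)
  qed
  have qs: "Suc (q - 1) = q" using q1 by simp
  have "central_span (lie_gamma q ?S) \<subseteq> {0}"
    unfolding central_span_def zero
    by (rule group_closure_subset_ideal[OF two_sided_ideal_zero]) auto
  then have "\<theta> ^ q * (gel b ^ (q - 1) * (twist b ^^ (q - 1)) (gel a)) = 0"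
    using iter[of "q - 1"] unfolding iterated_lie_twist qs by blast
  moreover have "(twist b ^^ (q - 1)) (gel a) = sc (of_nat n ^ (q - 1)) * gel a * Y ^ (q - 1)"
    using eig_iter[OF eig_gel[OF ab(1)], of "q - 1" 0] J_q qs by simp
  ultimately have "(\<theta> ^ q * gel b ^ (q - 1) * sc (of_nat n ^ (q - 1)) * gel a) * Y ^ (q - 1) = 0"
    by (simp only: mult.assoc)
  \<comment> \<open>The augmentation is 2^q n^(q - 1), which is nonzero in F.\<close>
  then have "aug_map (\<theta> ^ q * gel b ^ (q - 1) * sc (of_nat n ^ (q - 1)) * gel a) = 0"
    using annihilator_Y_power[of UNIV] by simp
  then show False
    using of_nat_nonzero[OF ab(2)] two_nonzero by (simp add: aug_map_mult aug_map_power \<theta>_def lin_add)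
qed

end

subsection \<open>The unit group\<close>

lemma monoid_of_type: "Group.monoid \<lparr>carrier = UNIV :: 'a::monoid_mult set, monoid.mult = (*), one = 1\<rparr>"
  by (rule Group.monoid.intro) (auto simp: mult.assoc)

interpretation ug: group "unit_group :: 'a::monoid_mult monoid"
  unfolding unit_group_def by (rule monoid.units_group[OF monoid_of_type])

lemma unit_group_simps [simp]:
  "x \<otimes>\<^bsub>unit_group\<^esub> y = x * y" "\<one>\<^bsub>unit_group\<^esub> = 1"
  by (simp_all add: unit_group_def units_of_def)

lemma carrier_unit_group: "u \<in> carrier unit_group \<longleftrightarrow> (\<exists>v. v * u = 1 \<and> u * v = 1)"
  by (simp add: unit_group_def units_of_def Units_def)

lemma inv_unit_group:
  assumes "u * v = 1" "v * u = 1" shows "inv\<^bsub>unit_group\<^esub> u = v"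
  by (rule ug.inv_equality) (use assms carrier_unit_group in auto)

abbreviation group_commutator :: "('a, 'b) monoid_scheme \<Rightarrow> 'a \<Rightarrow> 'a \<Rightarrow> 'a" where
  "group_commutator G u v \<equiv> inv\<^bsub>G\<^esub> u \<otimes>\<^bsub>G\<^esub> inv\<^bsub>G\<^esub> v \<otimes>\<^bsub>G\<^esub> u \<otimes>\<^bsub>G\<^esub> v"

lemma group_gamma_generator:
  "u \<in> group_gamma G (Suc n) H \<Longrightarrow> v \<in> H \<Longrightarrow> group_commutator G u v \<in> group_gamma G (Suc (Suc n)) H"
  unfolding group_gamma.simps by (rule generate.incl) blast

lemma group_gamma_Suc_trivial:
  assumes G: "group G" and H: "H \<subseteq> carrier G" and "group_gamma G (Suc n) H = {\<one>\<^bsub>G\<^esub>}"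
  shows "group_gamma G (Suc (Suc n)) H = {\<one>\<^bsub>G\<^esub>}"
proof -
  interpret group G by fact
  have "{group_commutator G u v | u v. u \<in> group_gamma G (Suc n) H \<and> v \<in> H} \<subseteq> {\<one>\<^bsub>G\<^esub>}"
    unfolding assms(3) using H by auto
  then have "group_gamma G (Suc (Suc n)) H \<subseteq> {\<one>\<^bsub>G\<^esub>}"
    unfolding group_gamma.simps by (rule generate_subgroup_incl) (rule triv_subgroup)
  moreover have "\<one>\<^bsub>G\<^esub> \<in> group_gamma G (Suc (Suc n)) H"
    unfolding group_gamma.simps by (rule generate.one)
  ultimately show ?thesis by blast
qed

lemma group_gamma_trivial_mono:
  assumes "group G" "H \<subseteq> carrier G" "group_gamma G (Suc n) H = {\<one>\<^bsub>G\<^esub>}" "n \<le> m"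
  shows "group_gamma G (Suc m) H = {\<one>\<^bsub>G\<^esub>}"
  using assms(4)
  by (induct rule: dec_induct) (auto simp: assms(3) group_gamma_Suc_trivial[OF assms(1,2)] simp del: group_gamma.simps)

lemma upper_lie_units_subgroup:
  "subgroup {u \<in> carrier unit_group. u - 1 \<in> upper_lie n} (unit_group :: 'a::ring_1 monoid)"
proof (rule ug.subgroupI)
  note I = upper_lie_ideal[of n]
  let ?U = "{u \<in> carrier unit_group. u - 1 \<in> upper_lie n} :: 'a set"
  have "1 \<in> ?U" using ug.one_closed ideal_0[OF I] by simp
  then show "?U \<noteq> {}" by blast
  fix u :: 'a assume u: "u \<in> ?U"
  then obtain v where v: "v * u = 1" "u * v = 1" using carrier_unit_group by blast
  have "v - 1 = - (v * (u - 1))" by (simp add: right_diff_distrib v)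
  then have "v - 1 \<in> upper_lie n" using u ideal_uminus[OF I ideal_mult_left[OF I]] by auto
  then show "inv\<^bsub>unit_group\<^esub> u \<in> ?U"
    unfolding inv_unit_group[OF v(2,1)] using v carrier_unit_group by auto
  fix w :: 'a assume w: "w \<in> ?U"
  have "u * (w - 1) + (u - 1) \<in> upper_lie n"
    using u w by (intro ideal_add[OF I] ideal_mult_left[OF I]) auto
  then have "u * w - 1 \<in> upper_lie n" by (simp add: right_diff_distrib)
  moreover have "u * w \<in> carrier unit_group" using ug.m_closed[of u w] u w by simp
  ultimately show "u \<otimes>\<^bsub>unit_group\<^esub> w \<in> ?U" by simp
qed auto

text \<open>(u, v) - 1 = u^-1 v^-1 [u - 1, v], so a group commutator costs one Lie bracket.\<close>

lemma group_gamma_subset_upper_lie: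
  fixes H :: "'a::ring_1 set"
  assumes H: "H \<subseteq> carrier unit_group"
  shows "group_gamma unit_group (Suc n) H \<subseteq> {u \<in> carrier unit_group. u - 1 \<in> upper_lie n}"
proof (induct n)
  case (Suc n)
  note I = upper_lie_ideal[of "Suc n"]
  show ?case unfolding group_gamma.simps(3)
  proof (rule ug.generate_subgroup_incl[OF _ upper_lie_units_subgroup], rule subsetI)
    fix c :: 'a assume "c \<in> {group_commutator unit_group u v | u v. u \<in> group_gamma unit_group (Suc n) H \<and> v \<in> H}"
    then obtain u v where c: "c = group_commutator unit_group u v"
      and u: "u \<in> group_gamma unit_group (Suc n) H" and v: "v \<in> H" by blast
    have uc: "u \<in> carrier unit_group" and un: "u - 1 \<in> upper_lie n" using Suc u by blast+
    have vc: "v \<in> carrier unit_group" using v H by blast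
    obtain u' where u': "u' * u = 1" "u * u' = 1" using uc carrier_unit_group by blast
    obtain v' where v': "v' * v = 1" "v * v' = 1" using vc carrier_unit_group by blast
    have "c = u' * v' * u * v" unfolding c by (simp add: inv_unit_group[OF u'(2,1)] inv_unit_group[OF v'(2,1)])
    moreover have "u' * v' * (v * u) = 1"
    proof -
      have "u' * v' * (v * u) = u' * (v' * v) * u" by (simp only: mult.assoc)
      then show ?thesis by (simp add: u' v')
    qed
    ultimately have "c - 1 = u' * v' * lie (u - 1) v" by (simp add: algebra_simps)
    then have "c - 1 \<in> upper_lie (Suc n)"
      using ideal_mult_left[OF I lie_in_upper_lie[OF un]] by simp
    moreover have "c \<in> carrier unit_group" unfolding c using uc vc by (intro ug.m_closed ug.inv_closed)
    ultimately show "c \<in> {u \<in> carrier unit_group. u - 1 \<in> upper_lie (Suc n)}" by blast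
  qed
qed (use H in auto)

text \<open>1 - f - f', f and f' are orthogonal central idempotents with sum 1, so the product is
  formed in each component separately.\<close>

lemma central_idempotents_inverse:
  fixes f f' v w v' w' :: "'a::ring_1"
  assumes f: "f * f = f" "\<And>r. f * r = r * f" and f': "f' * f' = f'" "\<And>r. f' * r = r * f'"
    and ff': "f * f' = 0" and v: "v * w = 1" and v': "v' * w' = 1"
  shows "((1 - f - f') + f * v + f' * v') * ((1 - f - f') + f * w + f' * w') = 1"
proof -
  define h where "h = 1 - f - f'"
  have f'f: "f' * f = 0" using ff' f(2)[of f'] by simp
  have h: "h * h = h" "h * f = 0" "h * f' = 0" "f * h = 0" "f' * h = 0"
    unfolding h_def by (simp_all add: algebra_simps f(1) f'(1) ff' f'f)
  have hc: "r * h = h * r" for r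
    unfolding h_def right_diff_distrib left_diff_distrib f(2)[of r] f'(2)[of r] by simp
  have swap: "(a * r) * (c * s) = (a * c) * (r * s)" if "c * r = r * c" for a c r s :: 'a
  proof -
    have "(a * r) * (c * s) = a * (r * c) * s" by (simp only: mult.assoc)
    then show ?thesis unfolding that[symmetric] by (simp only: mult.assoc)
  qed
  have "(f * v) * (f * w) = f" "(f * v) * (f' * w') = 0" "(f' * v') * (f * w) = 0" "(f' * v') * (f' * w') = f'"
    "(f * v) * h = 0" "(f' * v') * h = 0" "h * (f * w) = 0" "h * (f' * w') = 0"
    using swap[OF f(2), of f v w] swap[OF f'(2), of f v w'] swap[OF f(2), of f' v' w] swap[OF f'(2), of f' v' w']
      swap[OF hc[symmetric], of f v 1] swap[OF hc[symmetric], of f' v' 1]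
    by (simp_all add: f(1) f'(1) ff' f'f v v' h flip: mult.assoc)
  then have "(h + f * v + f' * v') * (h + f * w + f' * w') = h + f + f'"
    by (simp add: distrib_left distrib_right h(1))
  then show ?thesis by (simp add: h_def)
qed

lemma inverse_of_commutator:
  fixes v w :: "'g::group_add \<Rightarrow>\<^sub>0 'f::field"
  assumes vw: "v * w = 1" "w * v = 1"
  shows "(w * gel (- b) * v * gel b) * (gel (- b) * w * gel b * v) = 1"
    and "(gel (- b) * w * gel b * v) * (w * gel (- b) * v * gel b) = 1"
proof -
  have "v * (w * r) = r" "w * (v * r) = r" for r
    by (simp_all add: vw flip: mult.assoc)
  moreover have "gel b * (gel (- b) * r) = r" "gel (- b) * (gel b * r) = r" for r :: "'g \<Rightarrow>\<^sub>0 'f"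
    by (simp_all flip: mult.assoc)
  ultimately show "(w * gel (- b) * v * gel b) * (gel (- b) * w * gel b * v) = 1"
    "(gel (- b) * w * gel b * v) * (w * gel (- b) * v * gel b) = 1"
    by (simp_all only: mult.assoc vw gel_inverse mult_1_right)
qed

lemma odd_part: assumes "(n :: nat) > 0" obtains s r where "n = 2 ^ s * r" "odd r"
proof -
  obtain y where "n = 2 ^ multiplicity 2 n * y" "odd y"
    using multiplicity_decompose'[of n 2] assms by (metis not_gr_zero odd_one)
  then show thesis by (rule that)
qed

lemma sum_prime_multiples:
  fixes g :: "nat \<Rightarrow> 'b::comm_monoid_add"
  assumes "k > 0"
  shows "(\<Sum>i<l * k. if k dvd i then g i else 0) = (\<Sum>m<l. g (m * k))"
proof -
  have "(\<Sum>i\<in>{m * k..<m * k + k}. if k dvd i then g i else 0) = g (m * k)" for m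
  proof -
    have "(\<Sum>i\<in>{m * k..<m * k + k}. if k dvd i then g i else 0)
        = (\<Sum>i\<in>{m * k..<m * k + k}. if i = m * k then g i else 0)"
    proof (rule sum.cong[OF refl])
      fix i assume i: "i \<in> {m * k..<m * k + k}"
      have "k dvd i \<longleftrightarrow> i = m * k"
      proof
        assume "k dvd i"
        then have "k dvd i - m * k" by simp
        then have "i - m * k = 0" using i by (auto dest: dvd_imp_le)
        then show "i = m * k" using i by simp
      qed simp
      then show "(if k dvd i then g i else 0) = (if i = m * k then g i else 0)" by simp
    qed
    then show ?thesis using assms by simp
  qed
  then show ?thesis by (simp flip: sum.nat_group)
qed

lemma alternating_sum_odd: "odd l \<Longrightarrow> (\<Sum>m<l. (-1) ^ m) = (1 :: 'a::ring_1)"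
proof -
  have "(\<Sum>m<2 * k + 1. (-1) ^ m) = (1 :: 'a)" for k by (induct k) simp_all
  then show "odd l \<Longrightarrow> (\<Sum>m<l. (-1) ^ m) = (1 :: 'a)" by (auto elim!: oddE)
qed

context cyclic_derived
begin

lemma twist_iter_sum:
  "finite A \<Longrightarrow> (twist b ^^ m) (\<Sum>i\<in>A. sc (c i) * r i) = (\<Sum>i\<in>A. sc (c i) * (twist b ^^ m) (r i))"
proof (induct m)
  case (Suc m)
  have "twist b (\<Sum>i\<in>A. u i) = (\<Sum>i\<in>A. twist b (u i))" for u :: "_ \<Rightarrow> 'g \<Rightarrow>\<^sub>0 'f"
    using Suc(2) by (induct rule: finite_induct) (simp_all add: twist_add twist_def[of b 0])
  then show ?case using Suc by (simp add: twist_single_mult)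
qed simp

lemma twist_iter_add: "(twist b ^^ m) (r + s) = (twist b ^^ m) r + (twist b ^^ m) s"
  by (induct m) (simp_all add: twist_add)

text \<open>Conjugation fixes x modulo p-th powers, hence the exponent of the commutator is additive
  in i modulo p. Only its residue matters for eigenvalues.\<close>

lemma gcomm_nmul_left:
  assumes "gcomm a b = nmul n x"
  shows "\<exists>t. gcomm (nmul i a) b = nmul (i * n + p * t) x"
proof (induct i)
  case 0
  show ?case by (intro exI[of _ 0]) (simp add: gcomm_def)
next
  case (Suc i)
  then obtain t where t: "gcomm (nmul i a) b = nmul (i * n + p * t) x" by blast
  obtain s where s: "gcomm x (nmul i a) = nmul (p * s) x" using cyclic_gcomm[OF x_G' gen] by blast
  have "conj_by (nmul i a) (nmul n x) = nmul n (nmul (Suc (p * s)) x)"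
  proof -
    have "conj_by (nmul i a) x = nmul (Suc (p * s)) x" unfolding conj_by_gcomm s by simp
    then show ?thesis by (simp only: nmul_conj[symmetric])
  qed
  then have "gcomm (nmul (Suc i) a) b = nmul n (nmul (Suc (p * s)) x) + nmul (i * n + p * t) x"
    by (simp only: nmul.simps(2)[of i a] gcomm_add_left assms t)
  also have "\<dots> = nmul (n * Suc (p * s) + (i * n + p * t)) x"
    by (simp only: nmul_add[of "n * Suc (p * s)"] nmul_mult[of n])
  also have "n * Suc (p * s) + (i * n + p * t) = Suc i * n + p * (n * s + t)"
    by (simp add: algebra_simps)
  finally show ?case by blast
qed

text \<open>Along the chain \<open>v\<^sub>m\<^sub>+\<^sub>1 = (v\<^sub>m, b)\<close> the leading term of \<open>v\<^sub>m - 1\<close> is transformed by \<open>twist b\<close>: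
  \<open>(v, b) - 1 = v\<^sup>-\<^sup>1 twist b (v - 1)\<close>, and \<open>v\<^sup>-\<^sup>1 \<equiv> 1\<close>.\<close>

lemma group_commutator_leading_term:
  assumes vw: "v * w = 1" "w * v = 1" and m: "m > 0" and T: "T \<in> W.J m" and v: "v - 1 - T \<in> W.J (m + 1)"
  shows "w * gel (- b) * v * gel b - 1 - twist b T \<in> W.J (m + 2)"
proof -
  have "(v - 1 - T) + T \<in> W.J m" by (intro W.J_add J_le[OF v] T) simp
  then have e: "v - 1 \<in> W.J m" by simp
  have "- (w * (v - 1)) \<in> W.J m" by (intro ideal_uminus[OF W.J_ideal] ideal_mult_left[OF W.J_ideal e])
  then have we: "w - 1 \<in> W.J m" by (simp add: right_diff_distrib vw)
  have 1: "w * gel (- b) * v * gel b = 1 + w * twist b v"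
    by (simp add: twist_conj right_diff_distrib vw mult.assoc)
  have 2: "twist b v = twist b (v - 1)" by (simp add: twist_diff)
  have "w * gel (- b) * v * gel b - 1 - twist b T
      = (w - 1) * twist b (v - 1) + twist b (v - 1 - T)"
    unfolding 1 unfolding 2 unfolding twist_diff by (simp add: algebra_simps)
  \<comment> \<open>The product has weight m + (m + 1), which reaches m + 2 because m is
    positive.\<close>
  moreover have "(w - 1) * twist b (v - 1) \<in> W.J (m + 2)"
    using J_le[OF J_mult[OF we twist_J[OF e, of b]], of "m + 2"] m by simp
  moreover have "twist b (v - 1 - T) \<in> W.J (m + 2)" using twist_J[OF v, of b] by simp
  ultimately show ?thesis using W.J_add by metis
qed

end

subsection \<open>The nilpotency class of the symmetric units\<close>

context oriented_cyclic
begin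

lemma central_sum:
  fixes A :: "nat set"
  assumes "finite A" "\<And>i r. i \<in> A \<Longrightarrow> u i * r = r * (u i :: 'g \<Rightarrow>\<^sub>0 'f)"
  shows "(\<Sum>i\<in>A. u i) * r = r * (\<Sum>i\<in>A. u i)"
  using assms(2) by (simp add: sum_distrib_left sum_distrib_right)

lemma eq_uminus_zero: assumes "r = - (r :: 'g \<Rightarrow>\<^sub>0 'f)" shows "r = 0"
proof (rule poly_mapping_eqI)
  fix k
  have "Poly_Mapping.lookup r k = - Poly_Mapping.lookup r k"
    by (subst assms) (rule lookup_uminus)
  then have "2 * Poly_Mapping.lookup r k = 0" by (simp add: eq_neg_iff_add_eq_0)
  then show "Poly_Mapping.lookup r k = Poly_Mapping.lookup 0 k" using two_nonzero by simp
qed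

text \<open>With \<open>z\<close> central of order \<open>2\<^sup>k\<close> and \<open>\<sigma> z = -1\<close>, the idempotent \<open>f\<close> of the trivial character of
  \<open>\<langle>z\<rangle>\<close> satisfies \<open>z f = f\<close>, whence \<open>f\<^sup>* z = - f\<^sup>*\<close> and \<open>f f\<^sup>* = 0\<close>.\<close>

lemma orthogonal_idempotents:
  assumes tor: "torsion_group (group_of_type :: 'g monoid)"
  obtains z N and f :: "'g \<Rightarrow>\<^sub>0 'f" where
    "\<And>g. z + g = g + z" "of_nat N \<noteq> (0 :: 'f)"
    "f = sc (inverse (of_nat N)) * (\<Sum>j<N. gel (nmul j z))"
    "f * f = f" "\<And>r. f * r = r * f" "cinv f * cinv f = cinv f" "\<And>r. cinv f * r = r * cinv f"
    "f * cinv f = 0"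
proof -
  obtain z0 :: 'g where z0: "\<And>g. z0 + g = g + z0" "\<sigma> z0 = -1" using central_odd_element by blast
  obtain m where m: "m > 0" "nmul m z0 = 0"
    using tor unfolding torsion_group_def by (auto simp: pow_group_of_type)
  obtain s r where sr: "m = 2 ^ s * r" "odd r" using odd_part[OF m(1)] .
  \<comment> \<open>The odd power keeps \<sigma> equal to -1 and leaves an exponent N = 2^s, which
    is invertible in F.\<close>
  define z where "z = nmul r z0"
  define N :: nat where "N = 2 ^ s"
  have zc: "nmul j z + g = g + nmul j z" for j g unfolding z_def nmul_mult[symmetric] by (rule nmul_central[OF z0(1)])
  have z1: "z + g = g + z" for g using zc[of 1] by simp
  have \<sigma>z: "\<sigma> z = -1" unfolding z_def \<sigma>_nmul z0(2) using sr(2) by simp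
  have Nz: "nmul N z = 0" using m(2) unfolding z_def N_def nmul_mult[symmetric] sr(1) .
  have N0: "of_nat N \<noteq> (0 :: 'f)"
  proof (rule of_nat_nonzero)
    show "\<not> p dvd N"
    proof
      assume "p dvd N"
      then have "p dvd 2" unfolding N_def using prime_p prime_dvd_power by blast
      then show False using p_ge_3 by (auto dest: dvd_imp_le)
    qed
  qed
  define W where "W = (\<Sum>j<N. gel (nmul j z) :: 'g \<Rightarrow>\<^sub>0 'f)"
  define f where "f = sc (inverse (of_nat N)) * W"
  have zW: "gel z * W = W"
  proof -
    have "gel z * W = (\<Sum>j<N. gel (nmul (Suc j) z))"
      unfolding W_def by (simp add: sum_distrib_left gel_mult)
    moreover have "gel (nmul 0 z) + (\<Sum>j<N. gel (nmul (Suc j) z)) = W + (gel (nmul N z) :: 'g \<Rightarrow>\<^sub>0 'f)"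
      unfolding W_def by (subst sum.lessThan_Suc[symmetric], subst sum.lessThan_Suc_shift) simp
    ultimately show ?thesis by (simp add: Nz)
  qed
  have zf: "gel z * f = f"
  proof -
    have "gel z * f = sc (inverse (of_nat N)) * (gel z * W)"
      unfolding f_def by (simp only: mult.assoc[symmetric] scalar_central[of _ "gel z"])
    then show ?thesis by (simp add: zW f_def)
  qed
  have zjf: "gel (nmul j z) * f = f" for j
  proof (induct j)
    case (Suc j)
    have "gel (nmul (Suc j) z) * f = gel z * (gel (nmul j z) * f)" by (simp add: gel_mult flip: mult.assoc)
    then show ?case by (simp add: Suc zf)
  qed simp
  have "W * f = of_nat N * f" unfolding W_def by (simp add: sum_distrib_right zjf)
  moreover have "sc (inverse (of_nat N)) * of_nat N = 1"
    using N0 by (simp add: mult_single flip: single_of_nat)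
  ultimately have ff: "f * f = f" by (metis f_def mult.assoc mult_1_left)
  have Wc: "W * r = r * W" for r
    unfolding W_def by (rule central_sum) (auto intro: gel_central zc)
  have fc: "f * r = r * f" for r
  proof -
    have "f * r = sc (inverse (of_nat N)) * r * W" unfolding f_def by (simp only: mult.assoc Wc[of r])
    then show ?thesis unfolding f_def by (simp only: scalar_central[of _ r] mult.assoc)
  qed
  have f'c: "cinv f * r = r * cinv f" for r
  proof -
    have "cinv f * r = cinv (cinv r * f)" by (simp add: cinv_mult)
    also have "\<dots> = cinv (f * cinv r)" by (simp only: fc)
    finally show ?thesis by (simp add: cinv_mult)
  qed
  have f'f': "cinv f * cinv f = cinv f" using cinv_mult[of f f] ff by simp
  have "cinv f = - (cinv f * gel (- z))"
  proof -
    have "cinv (gel z * f) = cinv f * cinv (gel z)" by (rule cinv_mult)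
    then show ?thesis by (simp add: zf \<sigma>z single_uminus)
  qed
  then have "cinv f * gel z = - (cinv f * gel (- z)) * gel z" by simp
  also have "\<dots> = - cinv f" by (simp add: mult.assoc)
  finally have f'z: "cinv f * gel z = - cinv f" .
  have "f * cinv f = (f * gel z) * cinv f" by (simp only: fc[of "gel z"] zf)
  also have "\<dots> = f * (cinv f * gel z)" by (simp only: mult.assoc f'c[of "gel z"])
  finally have "f * cinv f = - (f * cinv f)" by (simp add: f'z)
  then have ff': "f * cinv f = 0" by (rule eq_uminus_zero)
  show thesis by (rule that[OF z1 N0 f_def[unfolded W_def] ff fc f'f' f'c ff'])
qed

text \<open>After multiplication by f, symmetric units can stand in for arbitrary units, so the
  commutators of 1 + a with b, b, ... may be formed in the full unit group. If the q-th term were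
  trivial, f times the exact value of the last leading term would vanish.\<close>

lemma group_gamma_symmetric_units_nontrivial:
  assumes tor: "torsion_group (group_of_type :: 'g monoid)" and q1: "q > 1"
  shows "group_gamma unit_group q (symmetric_units \<sigma> :: ('g \<Rightarrow>\<^sub>0 'f) set) \<noteq> {1}"
proof
  let ?U = "symmetric_units \<sigma> :: ('g \<Rightarrow>\<^sub>0 'f) set"
  assume trivial: "group_gamma unit_group q ?U = {1}"
  obtain z N and f :: "'g \<Rightarrow>\<^sub>0 'f" where z: "\<And>g. z + g = g + z" and N0: "of_nat N \<noteq> (0 :: 'f)"
    and f: "f = sc (inverse (of_nat N)) * (\<Sum>j<N. gel (nmul j z))"
    and ff: "f * f = f" and fc: "\<And>r. f * r = r * f" and f'f': "cinv f * cinv f = cinv f"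
    and f'c: "\<And>r. cinv f * r = r * cinv f" and ff': "f * cinv f = 0"
    using orthogonal_idempotents[OF tor] by blast
  have UC: "?U \<subseteq> carrier unit_group" unfolding symmetric_units_def by blast
  have symmetrize: "\<exists>s\<in>?U. f * s = f * v" if vw: "v * w = 1" "w * v = 1" for v w
  proof -
    have vw': "cinv v * cinv w = 1" "cinv w * cinv v = 1"
      using cinv_mult[of w v] cinv_mult[of v w] vw by simp_all
    \<comment> \<open>The involution exchanges the last two summands and fixes the first.\<close>
    let ?s = "(1 - f - cinv f) + f * v + cinv f * cinv v"
    let ?t = "(1 - f - cinv f) + f * w + cinv f * cinv w"
    have "?s * ?t = 1" by (rule central_idempotents_inverse[OF ff fc f'f' f'c ff' vw(1) vw'(1)])
    moreover have "?t * ?s = 1" by (rule central_idempotents_inverse[OF ff fc f'f' f'c ff' vw(2) vw'(2)])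
    ultimately have "?s \<in> carrier unit_group" using carrier_unit_group by blast
    moreover have "cinv ?s = ?s"
      by (simp add: cinv_add cinv_diff cinv_mult fc[of v] f'c[of "cinv v"])
    ultimately have "?s \<in> ?U" by (simp add: symmetric_units_def symmetric_elements_def)
    moreover have "f * ?s = f * v"
      by (simp add: distrib_left right_diff_distrib ff ff' flip: mult.assoc)
    ultimately show ?thesis by blast
  qed
  \<comment> \<open>Equality after multiplication by f acts as a congruence compatible with products
    and inverses.\<close>
  have f_mult: "f * (X * Y) = f * (X' * Y')" if "f * X = f * X'" "f * Y = f * Y'" for X X' Y Y'
  proof -
    have "f * (X * Y) = X' * (f * Y)" using that(1) fc[of X'] by (metis mult.assoc)
    also have "\<dots> = f * (X' * Y')" using that(2) fc[of X'] by (metis mult.assoc)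
    finally show ?thesis .
  qed
  have f_inv: "f * s' = f * w" if "f * s = f * v" "s' * s = 1" "v * w = 1" for s s' v w
  proof -
    have "f * s' = s' * (f * v) * w" using that(3) fc[of s'] by (metis mult.assoc mult_1_right)
    also have "\<dots> = f * w" using that(1,2) fc[of s'] by (metis mult.assoc mult_1_left)
    finally show ?thesis .
  qed

  obtain a0 b :: 'g and n0 where ab0: "gcomm a0 b = nmul n0 x" "\<not> p dvd n0" using noncommuting_pair[OF q1] .
  obtain k0 where k0: "k0 > 0" "nmul k0 a0 = 0"
    using tor unfolding torsion_group_def by (auto simp: pow_group_of_type)
  obtain s0 r0 where sr: "k0 = 2 ^ s0 * r0" "odd r0" using odd_part[OF k0(1)] .
  \<comment> \<open>Passing to this power makes the order odd; the commutator exponent is multiplied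
    by a power of 2 modulo p and stays prime to p.\<close>
  define a where "a = nmul (2 ^ s0) a0"
  obtain t where t: "gcomm a b = nmul (2 ^ s0 * n0 + p * t) x"
    using gcomm_nmul_left[OF ab0(1)] unfolding a_def by blast
  define n where "n = 2 ^ s0 * n0 + p * t"
  have ab: "gcomm a b = nmul n x" using t by (simp add: n_def)
  have pn: "\<not> p dvd n"
  proof
    assume "p dvd n"
    then have "p dvd 2 ^ s0 * n0" unfolding n_def by (simp add: dvd_add_left_iff)
    then have "p dvd 2" using prime_p ab0(2) by (meson prime_dvd_mult_iff prime_dvd_power)
    then show False using p_ge_3 by (auto dest: dvd_imp_le)
  qed
  \<comment> \<open>The extra factor p makes the multiples of p below r exactly m p with m < r0, an
    odd number of them.\<close>
  define r where "r = r0 * p"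
  have r: "odd r" using sr(2) odd_p by (simp add: r_def)
  have ra: "nmul r a = 0"
  proof -
    have "nmul r a = nmul (p * k0) a0" unfolding r_def a_def sr(1) nmul_mult[symmetric] by (simp add: ac_simps)
    then show ?thesis by (simp add: nmul_mult k0(2))
  qed

  define u :: "'g \<Rightarrow>\<^sub>0 'f" where "u = 1 + gel a"
  \<comment> \<open>A geometric series in -a: since (-a)^r = -1, it satisfies u \<Sigma> =
    2.\<close>
  define \<Sigma> :: "'g \<Rightarrow>\<^sub>0 'f" where "\<Sigma> = (\<Sum>i<r. (- gel a) ^ i)"
  define w where "w = sc (1/2) * \<Sigma>"
  have half: "sc (1/2) * (2 :: 'g \<Rightarrow>\<^sub>0 'f) = 1"
    using two_nonzero by (simp add: mult_single flip: single_numeral)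
  have u\<Sigma>: "u * \<Sigma> = 2"
  proof -
    have "(- gel a) ^ r - 1 = (- gel a - 1) * \<Sigma>" unfolding \<Sigma>_def by (rule power_diff_one_factor)
    moreover have "(- gel a :: 'g \<Rightarrow>\<^sub>0 'f) ^ r = - 1" using r ra by (simp add: gel_power)
    ultimately have "- 1 - 1 = - (u * \<Sigma>)" by (simp add: u_def algebra_simps)
    then show ?thesis by (metis minus_diff_eq minus_minus one_add_one diff_minus_eq_add)
  qed
  have "gel a * \<Sigma> = \<Sigma> * gel a"
  proof -
    have "- gel a * \<Sigma> = \<Sigma> * - gel a"
      unfolding \<Sigma>_def sum_distrib_left sum_distrib_right by (simp only: power_commutes)
    then show ?thesis by simp
  qed
  then have \<Sigma>u: "\<Sigma> * u = 2" using u\<Sigma> by (simp add: u_def algebra_simps)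
  have wu: "w * u = 1" unfolding w_def by (simp add: mult.assoc \<Sigma>u half)
  have uw: "u * w = 1"
  proof -
    have "u * w = sc (1/2) * (u * \<Sigma>)"
      unfolding w_def by (simp only: mult.assoc[symmetric] scalar_central[of _ u])
    then show ?thesis by (simp add: u\<Sigma> half)
  qed

  \<comment> \<open>The first commutator is 1 + g exactly. It is treated apart because u - 1 = a has
    weight 0, while the leading-term lemma requires positive weight.\<close>
  define g where "g = w * twist b u"
  have gJ: "g \<in> W.J 1"
    unfolding g_def using ideal_mult_left[OF W.J_ideal twist_J[OF J_0, of b u]] by simp
  obtain B where B: "B \<in> ?U" "f * B = f * gel b"
    using symmetrize[of "gel b" "gel (- b)"] by auto
  have BC: "B \<in> carrier unit_group" using B(1) UC by blast
  have commutator_step: "\<exists>V'\<in>group_gamma unit_group (Suc (Suc m)) ?U. f * V' = f * (w' * gel (- b) * v * gel b)"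
    if V: "V \<in> group_gamma unit_group (Suc m) ?U" "f * V = f * v" and vw: "v * w' = 1" "w' * v = 1"
    for V v w' m
  proof -
    have VC: "V \<in> carrier unit_group" using group_gamma_subset_upper_lie[OF UC] V(1) by blast
    obtain V' where V': "V' * V = 1" "V * V' = 1" using VC carrier_unit_group by blast
    obtain B' where B': "B' * B = 1" "B * B' = 1" using BC carrier_unit_group by blast
    have "V' * B' * V * B \<in> group_gamma unit_group (Suc (Suc m)) ?U"
      using group_gamma_generator[OF V(1) B(1)] by (simp add: inv_unit_group[OF V'(2,1)] inv_unit_group[OF B'(2,1)] del: group_gamma.simps)
    moreover have fV': "f * V' = f * w'" by (rule f_inv[OF V(2) V'(1) vw(1)])
    moreover have fB': "f * B' = f * gel (- b)" by (rule f_inv[OF B(2) B'(1)]) simp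
    have "f * (V' * B' * V * B) = f * (w' * gel (- b) * v * gel b)"
      by (rule f_mult[OF f_mult[OF f_mult[OF fV' fB'] V(2)] B(2)])
    ultimately show ?thesis by blast
  qed
  have chain: "\<exists>V v w'. V \<in> group_gamma unit_group (Suc (Suc k)) ?U \<and> f * V = f * v \<and> v * w' = 1 \<and> w' * v = 1
      \<and> v - 1 - (twist b ^^ k) g \<in> W.J (Suc k + 1)" for k
  proof (induct k)
    case 0
    obtain V where V: "V \<in> ?U" "f * V = f * u" using symmetrize[OF uw wu] by blast
    then have "V \<in> group_gamma unit_group (Suc 0) ?U" by simp
    from commutator_step[OF this V(2) uw wu]
    obtain V' where V': "V' \<in> group_gamma unit_group (Suc (Suc 0)) ?U"
      "f * V' = f * (w * gel (- b) * u * gel b)" by blast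
    have g1: "w * gel (- b) * u * gel b = 1 + g"
      by (simp add: g_def twist_conj right_diff_distrib wu mult.assoc)
    show ?case
    proof (intro exI conjI)
      show "V' \<in> group_gamma unit_group (Suc (Suc 0)) ?U" by (rule V'(1))
      show "f * V' = f * (w * gel (- b) * u * gel b)" by (rule V'(2))
      show "w * gel (- b) * u * gel b - 1 - (twist b ^^ 0) g \<in> W.J (Suc 0 + 1)"
        unfolding g1 using ideal_0[OF W.J_ideal] by simp
    qed (rule inverse_of_commutator[OF uw wu])+
  next
    case (Suc k)
    then obtain V v w' where V: "V \<in> group_gamma unit_group (Suc (Suc k)) ?U" "f * V = f * v"
      and vw: "v * w' = 1" "w' * v = 1" and v: "v - 1 - (twist b ^^ k) g \<in> W.J (Suc k + 1)" by blast
    obtain V' where V': "V' \<in> group_gamma unit_group (Suc (Suc (Suc k))) ?U"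
      "f * V' = f * (w' * gel (- b) * v * gel b)" using commutator_step[OF V vw] by blast
    have "(twist b ^^ k) g \<in> W.J (Suc k)" using twist_iter_J[OF gJ, where b = b and m = k] by simp
    from group_commutator_leading_term[OF vw _ this v, of b]
    have "w' * gel (- b) * v * gel b - 1 - (twist b ^^ Suc k) g \<in> W.J (Suc (Suc k) + 1)" by simp
    then show ?case using V' inverse_of_commutator[OF vw, of b] by blast
  qed
  have q2: "Suc (Suc (q - 2)) = q" "Suc (q - 2) + 1 = q" "2 + (q - 2) = q" "q - 1 + 1 = q" "1 + (q - 2) = q - 1"
    using q1 by simp_all
  \<comment> \<open>For k = q - 2 the error lies in J q, which is zero, so the leading term is
    exact.\<close>
  obtain V v where "V \<in> group_gamma unit_group q ?U" "f * V = f * v" "v - 1 - (twist b ^^ (q - 2)) g \<in> W.J q"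
    using chain[of "q - 2"] unfolding q2 by blast
  then have "f * 1 = f * v" "v = 1 + (twist b ^^ (q - 2)) g"
    using trivial J_q by (auto simp: algebra_simps)
  then have zero: "f * (twist b ^^ (q - 2)) g = 0" by (simp add: distrib_left)

  \<comment> \<open>The leading term of g is n w a Y, and c i is the coefficient of a^(i + 1) in n w
    a. The remaining q - 2 twists multiply it by a power of the eigenvalue (i + 1) n, which gives d
    i.\<close>
  define c :: "nat \<Rightarrow> 'f" where "c i = of_nat n * (1/2) * (-1) ^ i" for i
  define d where "d i = c i * of_nat (Suc i * n) ^ (q - 2)" for i
  have eig_a: "eig b n (gel a)" by (rule eig_gel[OF ab])
  have eig_ai: "eig b (Suc i * n) (gel (nmul (Suc i) a))" for i
    using eig_power[OF eig_a, of "Suc i"] by (simp only: gel_power)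
  have wa: "sc (of_nat n) * (w * gel a) = (\<Sum>i<r. sc (c i) * gel (nmul (Suc i) a))"
  proof -
    have "(- gel a) ^ i * gel a = sc ((-1) ^ i) * (gel (nmul (Suc i) a) :: 'g \<Rightarrow>\<^sub>0 'f)" for i
    proof -
      have "(- gel a :: 'g \<Rightarrow>\<^sub>0 'f) ^ i = sc ((-1) ^ i) * gel (nmul i a)"
        by (subst power_minus) (simp add: gel_power single_power[symmetric] single_uminus)
      then show ?thesis by (simp only: mult.assoc gel_mult nmul_Suc2)
    qed
    then have "\<Sigma> * gel a = (\<Sum>i<r. sc ((-1) ^ i) * gel (nmul (Suc i) a))"
      unfolding \<Sigma>_def by (simp only: sum_distrib_right)
    then have "sc (of_nat n) * (w * gel a) = sc (of_nat n) * sc (1/2) * (\<Sum>i<r. sc ((-1) ^ i) * gel (nmul (Suc i) a))"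
      unfolding w_def by (simp only: mult.assoc)
    also have "\<dots> = (\<Sum>i<r. sc (c i) * gel (nmul (Suc i) a))"
      by (simp only: sum_distrib_left mult.assoc[symmetric] mult_single c_def add_0_left)
    finally show ?thesis .
  qed
  define j where "j = g - (\<Sum>i<r. sc (c i) * (gel (nmul (Suc i) a) * Y ^ 1))"
  have jJ: "j \<in> W.J 2"
  proof -
    have "w * (twist b (gel a) - sc (of_nat n) * gel a * Y) \<in> W.J 2"
      using eig_a unfolding eig_def by (rule ideal_mult_left[OF W.J_ideal])
    moreover have "w * (sc (of_nat n) * gel a * Y) = (\<Sum>i<r. sc (c i) * (gel (nmul (Suc i) a) * Y ^ 1))"
    proof -
      have "w * (sc (of_nat n) * gel a * Y) = sc (of_nat n) * (w * gel a) * Y"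
        by (simp only: mult.assoc[symmetric] scalar_central[of _ w])
      then show ?thesis unfolding wa by (simp add: sum_distrib_right mult.assoc)
    qed
    moreover have "twist b u = twist b (gel a)" by (simp add: u_def twist_add)
    ultimately show ?thesis unfolding j_def g_def by (simp add: right_diff_distrib)
  qed
  have tj: "(twist b ^^ (q - 2)) j = 0"
    using twist_iter_J[OF jJ, where b = b and m = "q - 2"] unfolding q2 J_q by simp
  have ti: "(twist b ^^ (q - 2)) (gel (nmul (Suc i) a) * Y ^ 1)
      = sc (of_nat (Suc i * n) ^ (q - 2)) * gel (nmul (Suc i) a) * Y ^ (q - 1)" for i
    using eig_iter[OF eig_ai[of i], where m = "q - 2" and k = 1] unfolding q2 J_q
    by (simp only: singleton_iff eq_iff_diff_eq_0[symmetric])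
  define \<rho> where "\<rho> = (\<Sum>i<r. sc (d i) * gel (nmul (Suc i) a) :: 'g \<Rightarrow>\<^sub>0 'f)"
  have "(twist b ^^ (q - 2)) g = (twist b ^^ (q - 2)) ((\<Sum>i<r. sc (c i) * (gel (nmul (Suc i) a) * Y ^ 1)) + j)"
    by (simp add: j_def)
  also have "\<dots> = (\<Sum>i<r. sc (c i) * (sc (of_nat (Suc i * n) ^ (q - 2)) * gel (nmul (Suc i) a) * Y ^ (q - 1)))"
    unfolding twist_iter_add tj by (subst twist_iter_sum) (simp_all only: finite_lessThan ti add_0_right)
  also have "\<dots> = \<rho> * Y ^ (q - 1)"
    unfolding \<rho>_def d_def sum_distrib_right by (simp only: mult.assoc[symmetric] mult_single add_0_left)
  finally have "(f * \<rho>) * Y ^ (q - 1) = 0" using zero by (simp add: mult.assoc)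
  \<comment> \<open>S selects the exponents i + 1 congruent to 1 modulo p, where d i depends on i
    only through its sign.\<close>
  define S where "S = {h :: 'g. eig b n (gel h)}"
  have lin0: "lin (\<lambda>h. if h \<in> S then 1 else 0) (f * \<rho>) = (0 :: 'f)"
    by (rule annihilator_Y_power[OF _ \<open>(f * \<rho>) * Y ^ (q - 1) = 0\<close>]) (simp add: S_def eig_translate)
  have S_iff: "nmul j z + nmul (Suc i) a \<in> S \<longleftrightarrow> p dvd i" for i j
  proof -
    have "gcomm (nmul j z) b = nmul 0 x"
      using nmul_central[OF z, of j b] by (simp add: gcomm_def group_word_simps del: add_uminus_conv_diff)
    then have "eig b 0 (gel (nmul j z))" by (rule eig_gel)
    from eig_mult[OF this eig_ai[of i]]
    have "eig b (Suc i * n) (gel (nmul j z + nmul (Suc i) a))" by (simp only: gel_mult add_0_left)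
    then have "nmul j z + nmul (Suc i) a \<in> S \<longleftrightarrow> of_nat (Suc i * n) = (of_nat n :: 'f)"
      unfolding S_def using eig_gel_unique[OF q1] by blast
    also have "\<dots> \<longleftrightarrow> of_nat (i * n) = (0 :: 'f)" by simp
    also have "\<dots> \<longleftrightarrow> p dvd i * n" using of_nat_eq_0_iff_char_dvd[where 'a='f] char_p by metis
    also have "\<dots> \<longleftrightarrow> p dvd i" using pn prime_p by (metis prime_dvd_mult_iff dvd_mult2)
    finally show ?thesis .
  qed
  have d_p: "d i = of_nat n ^ (q - 1) * (1/2) * (-1) ^ i" if "p dvd i" for i
  proof -
    have "of_nat i = (0 :: 'f)" using that of_nat_eq_0_iff_char_dvd[where 'a='f] char_p by metis
    then have "d i = of_nat n * of_nat n ^ (q - 2) * (1/2) * (-1) ^ i"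
      unfolding d_def c_def by simp
    also have "of_nat n * of_nat n ^ (q - 2) = (of_nat n :: 'f) ^ (q - 1)"
      using q2 by (metis power_Suc Suc_1 diff_Suc_1 plus_1_eq_Suc)
    finally show ?thesis .
  qed
  have "lin (\<lambda>h. if h \<in> S then 1 else 0) (f * \<rho>)
      = (\<Sum>j<N. \<Sum>i<r. if p dvd i then inverse (of_nat N) * d i else 0)"
  proof -
    have "f * \<rho> = (\<Sum>j<N. \<Sum>i<r. Poly_Mapping.single (nmul j z + nmul (Suc i) a) (inverse (of_nat N) * d i))"
      unfolding f \<rho>_def sum_distrib_left sum_distrib_right
      by (subst sum.swap) (simp add: mult_single)
    then show ?thesis
      by (simp only: lin_sum finite_lessThan lin_single S_iff)
         (intro sum.cong refl, simp)
  qed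
  also have "\<dots> = of_nat N * (\<Sum>i<r. if p dvd i then inverse (of_nat N) * d i else 0)" by simp
  also have "\<dots> = (\<Sum>i<r. if p dvd i then d i else 0)"
    unfolding sum_distrib_left using N0 by (intro sum.cong refl) (simp flip: mult.assoc)
  also have "\<dots> = (\<Sum>m<r0. d (m * p))" unfolding r_def by (rule sum_prime_multiples) simp
  \<comment> \<open>As p is odd, (-1)^(m p) = (-1)^m; an odd number of alternating signs sums to
    1.\<close>
  also have "\<dots> = (\<Sum>m<r0. of_nat n ^ (q - 1) * (1/2) * (-1) ^ m)"
    using odd_p by (intro sum.cong refl) (simp add: d_p power_mult mult.commute[of _ p])
  also have "\<dots> = of_nat n ^ (q - 1) * (1/2) * (\<Sum>m<r0. (-1) ^ m)" by (rule sum_distrib_left[symmetric])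
  also have "\<dots> = of_nat n ^ (q - 1) * (1/2)" by (simp add: alternating_sum_odd[OF sr(2)])
  finally show False using lin0 two_nonzero of_nat_nonzero[OF pn] by simp
qed

end

subsection \<open>Reading off the two invariants\<close>

text \<open>Cyclicity in the library uses integer powers; since G' is finite, negative exponents can
  be replaced by natural ones.\<close>

lemma (in lie_nilpotent_algebra) cyclic_G'_iff:
  "cyclic_group (subgroup_generated group_of_type (G' :: 'g set))
    \<longleftrightarrow> (\<exists>x :: 'g. x \<in> G' \<and> (\<forall>h\<in>G'. \<exists>t. h = nmul t x))"
proof -
  let ?K = "subgroup_generated group_of_type (G' :: 'g set)"
  have carrier: "carrier ?K = G'"
    using subgroup.carrier_subgroup_generated_subgroup[OF subgrp_G'[unfolded subgrp_iff]] .
  define pw where "pw x n = x [^]\<^bsub>?K\<^esub> n" for x and n :: int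
  have pw: "pw x n = (if n < 0 then - nmul (nat (- n)) x else nmul (nat n) x)" if "x \<in> G'" for x n
  proof -
    have "pw x n = x [^]\<^bsub>group_of_type\<^esub> n"
      unfolding pw_def using got.int_pow_subgroup_generated[of x "G'" n] carrier that by metis
    then show ?thesis by (simp add: int_pow_def2 pow_group_of_type)
  qed
  have "cyclic_group ?K \<longleftrightarrow> (\<exists>x\<in>carrier ?K. carrier ?K = range (\<lambda>n::int. x [^]\<^bsub>?K\<^esub> n))"
    by (rule group.cyclic_group[OF got.group_subgroup_generated])
  then have "cyclic_group ?K \<longleftrightarrow> (\<exists>x\<in>G'. G' = range (pw x))"
    unfolding carrier pw_def[symmetric] .
  also have "\<dots> \<longleftrightarrow> (\<exists>x :: 'g. x \<in> G' \<and> (\<forall>h\<in>G'. \<exists>t. h = nmul t x))"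
  proof
    assume "\<exists>x\<in>G'. G' = range (pw x)"
    then obtain x :: 'g where x: "x \<in> G'" "G' = range (pw x)" by blast
    have "\<exists>t. h = nmul t x" if "h \<in> G'" for h
    proof -
      have "h \<in> range (pw x)" using that by (simp only: x(2)[symmetric])
      then obtain n where n: "h = pw x n" by blast
      have "card (G' :: 'g set) > 0" using x(1) finite_G' by (auto simp: card_gt_0_iff)
      then show ?thesis
        using n minus_nmul[OF card_G'_nmul[OF x(1)]] unfolding pw[OF x(1)] by (metis (full_types))
    qed
    then show "\<exists>x :: 'g. x \<in> G' \<and> (\<forall>h\<in>G'. \<exists>t. h = nmul t x)" using x(1) by blast
  next
    assume "\<exists>x :: 'g. x \<in> G' \<and> (\<forall>h\<in>G'. \<exists>t. h = nmul t x)"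
    then obtain x :: 'g where x: "x \<in> G'" "\<And>h :: 'g. h \<in> G' \<Longrightarrow> \<exists>t. h = nmul t x" by blast
    have "G' = range (pw x)"
    proof (intro equalityI subsetI)
      fix h :: 'g assume "h \<in> G'"
      then obtain t where "h = nmul t x" using x(2) by blast
      then have "h = pw x (int t)" by (simp add: pw[OF x(1)])
      then show "h \<in> range (pw x)" by blast
    next
      fix h assume "h \<in> range (pw x)"
      then show "h \<in> G'"
        by (auto simp: pw[OF x(1)] intro: subgrp_minus[OF subgrp_G'] subgrp_nmul[OF subgrp_G' x(1)])
    qed
    then show "\<exists>x\<in>G'. G' = range (pw x)" using x(1) by blast
  qed
  finally show ?thesis .
qed

lemma lie_nilpotency_index_eq_iff:
  fixes S :: "'a::ring_1 set"
  assumes "lie_gamma (Suc q) S = {0}" "S \<noteq> {0}" "q > 0"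
  shows "lie_nilpotency_index S = q + 1 \<longleftrightarrow> lie_gamma q S \<noteq> {0}"
proof
  assume idx: "lie_nilpotency_index S = q + 1"
  show "lie_gamma q S \<noteq> {0}"
  proof
    assume "lie_gamma q S = {0}"
    then have "lie_nilpotency_index S \<le> q"
      unfolding lie_nilpotency_index_def using assms(3) by (intro Least_le) simp
    then show False using idx by simp
  qed
next
  assume ne: "lie_gamma q S \<noteq> {0}"
  show "lie_nilpotency_index S = q + 1"
    unfolding lie_nilpotency_index_def
  proof (rule Least_equality)
    fix n assume n: "1 \<le> n \<and> lie_gamma n S = {0}"
    then obtain n' where n': "n = Suc n'" by (cases n) auto
    show "q + 1 \<le> n"
    proof (rule ccontr)
      assume "\<not> q + 1 \<le> n"
      then have "lie_gamma (Suc (q - 1)) S = {0}"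
        using lie_gamma_trivial_mono[of n' S "q - 1"] n n' by auto
      then show False using ne assms(3) by simp
    qed
  qed (use assms(1) in simp)
qed

lemma nilpotency_class_eq_iff:
  assumes G: "group G" and H: "H \<subseteq> carrier G" and "group_gamma G (Suc q) H = {\<one>\<^bsub>G\<^esub>}" "q > 0"
  shows "nilpotency_class G H = q \<longleftrightarrow> group_gamma G q H \<noteq> {\<one>\<^bsub>G\<^esub>}"
proof -
  have q: "Suc (q - 1) = q" using assms(4) by simp
  show ?thesis
  proof
    assume idx: "nilpotency_class G H = q"
    show "group_gamma G q H \<noteq> {\<one>\<^bsub>G\<^esub>}"
    proof
      assume "group_gamma G q H = {\<one>\<^bsub>G\<^esub>}"
      then have "nilpotency_class G H \<le> q - 1"
        unfolding nilpotency_class_def by (intro Least_le) (simp only: q)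
      then show False using idx assms(4) by simp
    qed
  next
    assume ne: "group_gamma G q H \<noteq> {\<one>\<^bsub>G\<^esub>}"
    show "nilpotency_class G H = q"
      unfolding nilpotency_class_def
    proof (rule Least_equality)
      show "group_gamma G (Suc q) H = {\<one>\<^bsub>G\<^esub>}" by (rule assms(3))
      fix n assume n: "group_gamma G (Suc n) H = {\<one>\<^bsub>G\<^esub>}"
      show "q \<le> n"
      proof (rule ccontr)
        assume "\<not> q \<le> n"
        then have "group_gamma G (Suc (q - 1)) H = {\<one>\<^bsub>G\<^esub>}"
          by (intro group_gamma_trivial_mono[OF G H n]) simp
        then show False using ne q by simp
      qed
    qed
  qed
qed

theorem theorem3p1:
  fixes \<sigma> :: "'g::group_add \<Rightarrow> int"
    and p :: nat
  assumes "CHAR('f::field) = p" and "odd p"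
    and "orientation \<sigma>" and "\<exists>g. \<sigma> g \<noteq> 1"
    and "lie_nilpotent (UNIV :: ('g \<Rightarrow>\<^sub>0 'f) set)"
  shows "(lie_nilpotency_index (symmetric_elements \<sigma> :: ('g \<Rightarrow>\<^sub>0 'f) set)
            = card (commutator_subgroup :: 'g set) + 1
          \<longleftrightarrow> cyclic_group (subgroup_generated group_of_type (commutator_subgroup :: 'g set)))
       \<and> (torsion_group (group_of_type :: 'g monoid) \<longrightarrow>
           (nilpotency_class unit_group (symmetric_units \<sigma> :: ('g \<Rightarrow>\<^sub>0 'f) set)
              = card (commutator_subgroup :: 'g set)
            \<longleftrightarrow> cyclic_group (subgroup_generated group_of_type (commutator_subgroup :: 'g set))))"
proof -
  interpret lie_nilpotent_algebra p "TYPE('g \<Rightarrow>\<^sub>0 'f)"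
    by unfold_locales (use assms in auto)
  interpret oriented_group \<sigma> by unfold_locales (rule assms)
  let ?S = "symmetric_elements \<sigma> :: ('g \<Rightarrow>\<^sub>0 'f) set"
  let ?U = "symmetric_units \<sigma> :: ('g \<Rightarrow>\<^sub>0 'f) set"
  let ?q = "card (G' :: 'g set)"
  let ?cyc = "\<exists>x :: 'g. x \<in> G' \<and> (\<forall>h\<in>G'. \<exists>t. h = nmul t x)"
  have q0: "?q > 0" using subgrp_0[OF subgrp_G'] finite_G' by (auto simp: card_gt_0_iff)
  have UC: "?U \<subseteq> carrier unit_group" unfolding symmetric_units_def by blast
  have S1: "1 \<in> ?S" by (simp add: symmetric_elements_def)
  have S0: "?S \<noteq> {0}"
  proof
    assume "?S = {0}"
    then have "1 \<in> ({0} :: ('g \<Rightarrow>\<^sub>0 'f) set)" using S1 by (simp only:)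
    then show False by simp
  qed
  have gamma_zero: "lie_gamma (Suc m) ?S = {0}" if m: "upper_lie m = ({0} :: ('g \<Rightarrow>\<^sub>0 'f) set)" "m > 0" for m
  proof -
    obtain m' where "m = Suc m'" using m(2) by (cases m) auto
    then have "0 \<in> lie_gamma (Suc m) ?S" by simp
    then show ?thesis using lie_gamma_subset_upper_lie[of m ?S] m(1) by blast
  qed
  have group_gamma_one: "group_gamma unit_group (Suc m) ?U = {\<one>\<^bsub>unit_group\<^esub>}"
    if m: "upper_lie m = ({0} :: ('g \<Rightarrow>\<^sub>0 'f) set)" "m > 0" for m
  proof -
    obtain m' where "m = Suc m'" using m(2) by (cases m) auto
    then have "\<one>\<^bsub>unit_group\<^esub> \<in> group_gamma unit_group (Suc m) ?U" by (simp only: group_gamma.simps generate.one)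
    then show ?thesis using group_gamma_subset_upper_lie[OF UC, of m] m(1) by auto
  qed
  show ?thesis
  proof (cases ?cyc)
    case False
    have small: "upper_lie (?q - 1) = ({0} :: ('g \<Rightarrow>\<^sub>0 'f) set)" by (rule noncyclic_upper_lie[OF False])
    \<comment> \<open>\<open>upper_lie 0\<close> is the whole ring, which is not zero.\<close>
    then have q1: "?q - 1 > 0" by (metis UNIV_I gr0I singletonD upper_lie.simps(1) zero_neq_one)
    have q: "Suc (?q - 1) = ?q" using q0 by simp
    have lie_q: "lie_gamma ?q ?S = {0}" using gamma_zero[OF small q1] unfolding q .
    have gr_q: "group_gamma unit_group ?q ?U = {\<one>\<^bsub>unit_group\<^esub>}" using group_gamma_one[OF small q1] unfolding q .
    have "lie_gamma (Suc ?q) ?S = {0}"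
      using lie_gamma_trivial_mono[of "?q - 1" ?S ?q] lie_q q by simp
    then have "lie_nilpotency_index ?S \<noteq> ?q + 1" using lie_nilpotency_index_eq_iff[OF _ S0 q0] lie_q by blast
    moreover have "group_gamma unit_group (Suc ?q) ?U = {\<one>\<^bsub>unit_group\<^esub>}"
      using group_gamma_trivial_mono[OF ug.is_group UC, of "?q - 1" ?q] gr_q q by simp
    then have "nilpotency_class unit_group ?U \<noteq> ?q"
      using nilpotency_class_eq_iff[OF ug.is_group UC _ q0] gr_q by blast
    ultimately show ?thesis unfolding cyclic_G'_iff using False by blast
  next
    case True
    then obtain x :: 'g where x: "x \<in> G'" "\<And>h :: 'g. h \<in> G' \<Longrightarrow> \<exists>t. h = nmul t x" by blast
    obtain e where e: "?q = p ^ e" using card_G' by blast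
    interpret oriented_cyclic p "TYPE('g \<Rightarrow>\<^sub>0 'f)" x e \<sigma>
      by unfold_locales (use x e assms in auto)
    have up: "upper_lie ?q = ({0} :: ('g \<Rightarrow>\<^sub>0 'f) set)" unfolding e by (rule upper_lie_q)
    have "lie_gamma ?q ?S \<noteq> {0}"
    proof (cases "?q = 1")
      case True
      then show ?thesis using S0 by simp
    next
      case False
      then have "p ^ e > 1" using q0 unfolding e by linarith
      then show ?thesis unfolding e by (rule lie_gamma_symmetric_nontrivial)
    qed
    then have "lie_nilpotency_index ?S = ?q + 1"
      using lie_nilpotency_index_eq_iff[OF gamma_zero[OF up q0] S0 q0] by blast
    moreover have "nilpotency_class unit_group ?U = ?q" if tor: "torsion_group (group_of_type :: 'g monoid)"
    proof -
      have "group_gamma unit_group ?q ?U \<noteq> {\<one>\<^bsub>unit_group\<^esub>}"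
      proof (cases "?q = 1")
        case True
        \<comment> \<open>For trivial G' the class 1 means that the set of symmetric units itself is
          not {1}; the unit -1 shows this.\<close>
        have "- 1 \<in> ?U"
          unfolding symmetric_units_def symmetric_elements_def
          by (auto simp: carrier_unit_group cinv_uminus intro: exI[of _ "-1"])
        moreover have "(- 1 :: 'g \<Rightarrow>\<^sub>0 'f) \<noteq> 1"
          using eq_uminus_zero[of 1] by auto
        ultimately show ?thesis using True by auto
      next
        case False
        then have "p ^ e > 1" using q0 unfolding e by linarith
        then show ?thesis
          using group_gamma_symmetric_units_nontrivial[OF tor] unfolding e unit_group_simps by blast
      qed
      then show ?thesis using nilpotency_class_eq_iff[OF ug.is_group UC group_gamma_one[OF up q0] q0] by blast
    qed
    ultimately show ?thesis unfolding cyclic_G'_iff using True by blast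
  qed
qed

end
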